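(* Let $c_0$ be the constant defined in the context. If $c > c_0$, then there exist $0<\alpha<1$ and $\beta>0$ (and a number of iterations $t$ as specified in the context) such that, given $G \in G(n,\tfrac12, c\sqrt{n})$, the probability that the set $K^* = K^*(\alpha,\beta)$ output by the algorithm described in the context equals the hidden clique is at least $1 - \mathrm{e}^{-\Theta(n^{\varepsilon_0})}$ for some $\varepsilon_0 = \varepsilon_0(c) > 0$.
   Context: Hidden clique model $G(n,\tfrac12,k)$: on a vertex set of size $n$, a uniformly random subset $K$ of $k$ vertices (the hidden clique) is made into a clique, and every other pair of vertices is an edge independently with probability $\tfrac12$. For a graph $H$, a vertex $v$ and a vertex set $S$, $d_S(v)$ is the number of neighbors of $v$ in $S$. $\varphi(x)=\frac{1}{\sqrt{2\pi}}e^{-x^2/2}$, $\Phi(x)=\int_{-\infty}^x\varphi$, $\bar\Phi(x)=1-\Phi(x)$. Logarithms are base 2. For $0<\alpha<1$, $\beta>0$ and $c>0$ set $\tau=(1-\alpha)\bar\Phi(\beta)$ and $\rho=(1-\alpha)\bar\Phi(\beta-c\sqrt{\alpha})$. For each $\alpha,\beta$, let $\tilde c(\alpha,\beta)$ be the minimal $c$ for which $\rho\ge\sqrt{\tau}$, and let $c_0$ be the infimum of $\tilde c(\alpha,\beta)$ over $0<\alpha<1$, $\beta>0$. The algorithm (parameters $\alpha,\beta$, number of iterations $t$), on input $G$ with $n$ vertices and hidden clique size $k$: Phase 1: $G_0=G$; given $G_i$, choose $S_i\subseteq V(G_i)$ containing each vertex independently with probability $\alpha$, let $\tilde V_i=\{v\in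 V(G_i)\setminus S_i : d_{S_i}(v)\ge \tfrac12|S_i|+\beta\tfrac{\sqrt{|S_i|}}{2}\}$ (edges of $G_i$), and let $G_{i+1}$ be the subgraph of $G_i$ induced on $\tilde V_i$; do this for $i=0,\dots,t-1$. The number of iterations is logarithmic: $t=\varepsilon_4\log n/\log(\rho^2/\tau)$ for a suitable constant $\varepsilon_4>0$. Phase 2: let $k_t=\rho^t k$, let $K'$ be the set of $k_t$ vertices of largest degree in $G_t$, and let $\tilde K=\{v\in V(G_t): d_{K'}(v)\ge \tfrac{3k_t}{4}\}$. Phase 3: let $G'$ be the subgraph of $G$ induced on $\tilde K$ together with all vertices adjacent to every vertex of $\tilde K$, and let $K^*$ be the set of $k$ vertices of largest degree in $G'$; output $K^*$. *)

theory Defs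
  imports "HOL-Probability.Probability" "HOL-Library.Landau_Symbols"
begin

subsection \<open>The constant \<open>c\<^sub>0\<close>\<close>

definition Phi :: "real \<Rightarrow> real" where
  "Phi x = (LBINT y:{..x}. std_normal_density y)"

definition Phi_bar :: "real \<Rightarrow> real" where
  "Phi_bar x = 1 - Phi x"

definition tau :: "real \<Rightarrow> real \<Rightarrow> real" where
  "tau \<alpha> \<beta> = (1 - \<alpha>) * Phi_bar \<beta>"

definition rho :: "real \<Rightarrow> real \<Rightarrow> real \<Rightarrow> real" where
  "rho \<alpha> \<beta> c = (1 - \<alpha>) * Phi_bar (\<beta> - c * sqrt \<alpha>)"

text \<open>
  As a function of \<open>c\<close>, \<open>rho \<alpha> \<beta> c\<close> is continuous and increasing, with limit \<open>1 - \<alpha>\<close> at infinity;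
  it lies below \<open>sqrt (tau \<alpha> \<beta>)\<close> for \<open>c\<close> near \<open>0\<close>.  Hence the minimum in \<open>c_tilde\<close> is attained
  whenever some \<open>c\<close> is admissible, but for some pairs (those with \<open>1 - \<alpha> \<le> Phi_bar \<beta>\<close>) none is.
  Such pairs have \<open>c_tilde\<close> infinite in the usual convention, so \<open>c_zero\<close> leaves them out.
\<close>

definition c_tilde :: "real \<Rightarrow> real \<Rightarrow> real" where
  "c_tilde \<alpha> \<beta> = (LEAST c. 0 < c \<and> rho \<alpha> \<beta> c \<ge> sqrt (tau \<alpha> \<beta>))"

definition c_zero :: real where
  "c_zero = Inf {c_tilde \<alpha> \<beta> | \<alpha> \<beta>. 0 < \<alpha> \<and> \<alpha> < 1 \<and> 0 < \<beta> \<and>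
                   (\<exists>c>0. rho \<alpha> \<beta> c \<ge> sqrt (tau \<alpha> \<beta>))}"


subsection \<open>The hidden clique model\<close>

text \<open>Graphs have vertex set \<open>{..<n}\<close>; an edge is a two-element set of vertices.\<close>

definition pairs :: "'a set \<Rightarrow> 'a set set" where
  "pairs V = {e. e \<subseteq> V \<and> card e = 2}"

definition random_subset :: "real \<Rightarrow> 'a set \<Rightarrow> 'a set pmf" where
  "random_subset p A = map_pmf (\<lambda>f. {x \<in> A. f x}) (Pi_pmf A False (\<lambda>_. bernoulli_pmf p))"

text \<open>The joint distribution of the hidden clique and the edge set, meaningful for \<open>k \<le> n\<close>.\<close>

definition hidden_clique_pmf :: "nat \<Rightarrow> nat \<Rightarrow> (nat set \<times> nat set set) pmf" where
  "hidden_clique_pmf n k = do {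
     K \<leftarrow> pmf_of_set {K. K \<subseteq> {..<n} \<and> card K = k};
     R \<leftarrow> random_subset (1/2) (pairs {..<n} - pairs K);
     return_pmf (K, pairs K \<union> R)
   }"


subsection \<open>The algorithm\<close>

text \<open>
  All graphs in the algorithm are induced subgraphs of the input graph, so they are represented by
  their vertex sets; \<open>E\<close> is always the edge set of the input graph.
\<close>

definition deg :: "'a set set \<Rightarrow> 'a set \<Rightarrow> 'a \<Rightarrow> nat" where
  "deg E S v = card {u \<in> S. {u, v} \<in> E}"

definition filter_step :: "real \<Rightarrow> real \<Rightarrow> 'a set set \<Rightarrow> 'a set \<Rightarrow> 'a set pmf" where
  "filter_step \<alpha> \<beta> E V = do {
     S \<leftarrow> random_subset \<alpha> V;
     return_pmf {v \<in> V - S. real (deg E S v) \<ge> real (card S) / 2 + \<beta> * (sqrt (real (card S)) / 2)}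
   }"

primrec phase1 :: "real \<Rightarrow> real \<Rightarrow> 'a set set \<Rightarrow> 'a set \<Rightarrow> nat \<Rightarrow> 'a set pmf" where
  "phase1 \<alpha> \<beta> E V 0 = return_pmf V"
| "phase1 \<alpha> \<beta> E V (Suc i) = do { W \<leftarrow> phase1 \<alpha> \<beta> E V i; filter_step \<alpha> \<beta> E W }"

text \<open>
  \<open>sel m d A\<close> is a set of \<open>m\<close> elements of \<open>A\<close> with the largest values of \<open>d\<close> (all of \<open>A\<close> if \<open>A\<close> has
  fewer than \<open>m\<close> elements).  Such a set is not unique if there are ties: a function \<open>sel\<close> with
  this property amounts to a tie-breaking rule.
\<close>

definition selects_largest :: "(nat \<Rightarrow> ('a \<Rightarrow> nat) \<Rightarrow> 'a set \<Rightarrow> 'a set) \<Rightarrow> bool" where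
  "selects_largest sel \<longleftrightarrow>
     (\<forall>m d A. finite A \<longrightarrow>
        sel m d A \<subseteq> A \<and> card (sel m d A) = min m (card A) \<and>
        (\<forall>u \<in> sel m d A. \<forall>v \<in> A - sel m d A. d v \<le> d u))"

definition phase2 ::
  "(nat \<Rightarrow> ('a \<Rightarrow> nat) \<Rightarrow> 'a set \<Rightarrow> 'a set) \<Rightarrow> 'a set set \<Rightarrow> 'a set \<Rightarrow> nat \<Rightarrow> 'a set" where
  "phase2 sel E W k' =
     (let K' = sel k' (deg E W) W
      in {v \<in> W. real (deg E K' v) \<ge> 3 * real k' / 4})"

definition phase3 ::
  "(nat \<Rightarrow> ('a \<Rightarrow> nat) \<Rightarrow> 'a set \<Rightarrow> 'a set) \<Rightarrow> 'a set set \<Rightarrow> 'a set \<Rightarrow> 'a set \<Rightarrow> nat \<Rightarrow> 'a set" where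
  "phase3 sel E V L k =
     (let V' = L \<union> {v \<in> V. \<forall>u \<in> L. {u, v} \<in> E}
      in sel k (deg E V') V')"

text \<open>
  The real quantities \<open>\<epsilon> log n / log (\<rho>\<^sup>2/\<tau>)\<close> and \<open>\<rho>\<^sup>t k\<close> are rounded down to natural numbers.
\<close>

definition num_iterations :: "real \<Rightarrow> real \<Rightarrow> real \<Rightarrow> real \<Rightarrow> nat \<Rightarrow> nat" where
  "num_iterations \<alpha> \<beta> c \<epsilon> n = nat \<lfloor>\<epsilon> * log 2 (real n) / log 2 ((rho \<alpha> \<beta> c)\<^sup>2 / tau \<alpha> \<beta>)\<rfloor>"

definition find_clique ::
  "(nat \<Rightarrow> (nat \<Rightarrow> nat) \<Rightarrow> nat set \<Rightarrow> nat set) \<Rightarrow> real \<Rightarrow> real \<Rightarrow> real \<Rightarrow> nat \<Rightarrow>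
   nat \<Rightarrow> nat \<Rightarrow> nat set set \<Rightarrow> nat set pmf" where
  "find_clique sel \<alpha> \<beta> c t n k E = do {
     W \<leftarrow> phase1 \<alpha> \<beta> E {..<n} t;
     let L = phase2 sel E W (nat \<lfloor>rho \<alpha> \<beta> c ^ t * real k\<rfloor>);
     return_pmf (phase3 sel E {..<n} L k)
   }"

text \<open>The joint distribution of the hidden clique and the output of the algorithm.\<close>

definition clique_experiment ::
  "(nat \<Rightarrow> (nat \<Rightarrow> nat) \<Rightarrow> nat set \<Rightarrow> nat set) \<Rightarrow> real \<Rightarrow> real \<Rightarrow> real \<Rightarrow> nat \<Rightarrow>
   nat \<Rightarrow> nat \<Rightarrow> (nat set \<times> nat set) pmf" where
  "clique_experiment sel \<alpha> \<beta> c t n k = do {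
     (K, E) \<leftarrow> hidden_clique_pmf n k;
     Kstar \<leftarrow> find_clique sel \<alpha> \<beta> c t n k E;
     return_pmf (K, Kstar)
   }"

end

theory Submission
  imports Defs "HOL-Real_Asymp.Real_Asymp"
begin

text \<open>
  The filter in Phase 1 only looks at edges between the sampled set and its complement, so the graph
  induced on the survivors is again a planted clique graph with fresh edges, and Phase 1 is a Markov
  chain on vertex sets.  Each step multiplies the number of vertices by about \<open>\<tau>\<close> (central limit
  theorem and Hoeffding's inequality).  It multiplies the size of the clique by about \<open>\<rho>\<close> in the first
  step and, because the ratio of the clique size to the square root of the number of vertices has
  then grown beyond \<open>c\<close>, by a strictly larger factor later on.  Hence the clique vertices
  that survive number at least \<open>\<rho>\<^sup>t k\<close>, and they exceed the square root of the number of
  surviving vertices by a power of \<open>n\<close>.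
  Convergence without a rate is enough in the central limit theorem: a small constant relative error
  per step is absorbed by the strict inequality \<open>\<rho> > sqrt \<tau>\<close>.

  In Phase 2 there may be far more than \<open>\<rho>\<^sup>t k\<close> clique vertices left, so \<open>K'\<close> is a proper subset
  that depends on all edges.  For a vertex \<open>v\<close> outside the clique, anti-concentration of the degrees
  shows that \<open>K'\<close> agrees, up to few vertices, with a set defined without the edges at \<open>v\<close>.
  Phase 3 follows from a union bound over all large subsets of the clique.
\<close>

section \<open>Random subsets\<close>

text \<open>The three phases reuse the same edges, and their dependence is never tracked. Phases 1
  and 2 are linked by an exact identity of laws for the pair (surviving set, induced graph), while
  Phase 3 is covered by an event of the whole input graph; the final union bound uses only these two
  marginals of one run. The iteration count is \<open>s * ln n\<close> up to rounding, with
  \<open>s\<close> so small that the accumulated shrinking factors stay above n^(-1/20). So at least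
  n^(19/20) vertices, and clique vertices of order at least n^(9/20), remain. This keeps the
  one-step estimates valid and suffices for everything except separating clique degrees from the
  other degrees. That separation needs (clique size)^2 / (number of vertices) to be large. This
  ratio starts at a constant and grows by a fixed factor above 1 per step, hence reaches order n^(2
  \<eta>) for some \<eta> > 0. It is the bottleneck of the failure probability, and giving up half
  of the exponent pays for the polynomial factors of the union bounds.\<close>

lemma set_random_subset: "S \<in> set_pmf (random_subset p A) \<Longrightarrow> S \<subseteq> A"
  by (auto simp: random_subset_def)

text \<open>The product measure splits over disjoint ground sets. This is the device by which one
  group of edges is revealed while another stays fresh.\<close>

lemma random_subset_Un:
  assumes "finite A" "finite B" "A \<inter> B = {}"
  shows "random_subset p (A \<union> B) =
    do {X \<leftarrow> random_subset p A; Y \<leftarrow> random_subset p B; return_pmf (X \<union> Y)}"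
proof -
  have "random_subset p (A \<union> B) =
      map_pmf (\<lambda>(f, g). {x\<in>A. f x} \<union> {x\<in>B. g x})
        (pair_pmf (Pi_pmf A False (\<lambda>_. bernoulli_pmf p)) (Pi_pmf B False (\<lambda>_. bernoulli_pmf p)))"
    unfolding random_subset_def Pi_pmf_union[OF assms] map_pmf_comp
    by (intro map_pmf_cong) (use assms in auto)
  also have "\<dots> = do {X \<leftarrow> random_subset p A; Y \<leftarrow> random_subset p B; return_pmf (X \<union> Y)}"
    by (simp add: random_subset_def map_pmf_def pair_pmf_def bind_assoc_pmf bind_return_pmf)
  finally show ?thesis .
qed

lemma random_subset_Int:
  assumes "finite A"
  shows "map_pmf (\<lambda>X. X \<inter> B) (random_subset p A) = random_subset p (A \<inter> B)"
  unfolding random_subset_def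
  by (subst Pi_pmf_subset[OF assms, of "A \<inter> B"])
    (auto simp: map_pmf_comp intro!: map_pmf_cong)

lemma card_random_subset:
  assumes "finite A" "p \<in> {0..1}"
  shows "map_pmf card (random_subset p A) = binomial_pmf (card A) p"
  by (subst binomial_pmf_altdef'[OF assms(1) refl assms(2), of False])
    (simp add: random_subset_def map_pmf_comp)

text \<open>Used with \<open>B\<close> a set of potential edges at one vertex, so that random
  degrees become binomial variables.\<close>

lemma card_Int_random_subset:
  assumes "finite A" "p \<in> {0..1}" "B \<subseteq> A"
  shows "map_pmf (\<lambda>X. card (X \<inter> B)) (random_subset p A) = binomial_pmf (card B) p"
proof -
  have "map_pmf (\<lambda>X. card (X \<inter> B)) (random_subset p A) = map_pmf card (random_subset p (A \<inter> B))"
    by (simp add: random_subset_Int[OF assms(1), symmetric] map_pmf_comp)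
  then show ?thesis
    using assms by (simp add: card_random_subset Int_absorb1 finite_subset)
qed

lemma prob_card_Int_random_subset:
  assumes "finite A" "p \<in> {0..1}" "B \<subseteq> A"
  shows "measure_pmf.prob (random_subset p A) {X. P (card (X \<inter> B))} =
    measure_pmf.prob (binomial_pmf (card B) p) {j. P j}"
  by (simp add: card_Int_random_subset[OF assms, symmetric] vimage_def)

section \<open>Monotonicity, union bounds and conditioning for pmf probabilities\<close>

lemma prob_pmf_mono:
  assumes "\<And>x. x \<in> set_pmf M \<Longrightarrow> P x \<Longrightarrow> Q x"
  shows "measure_pmf.prob M {x. P x} \<le> measure_pmf.prob M {x. Q x}"
proof -
  have "measure_pmf.prob M {x. P x} = measure_pmf.prob M ({x. P x} \<inter> set_pmf M)"
    by (simp add: measure_Int_set_pmf)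
  also have "\<dots> \<le> measure_pmf.prob M {x. Q x}"
    using assms by (intro measure_pmf.finite_measure_mono) auto
  finally show ?thesis .
qed

lemma prob_pmf_disj:
  "measure_pmf.prob M {x. P x \<or> Q x} \<le> measure_pmf.prob M {x. P x} + measure_pmf.prob M {x. Q x}"
  using measure_Un_le[of "{x. P x}" "measure_pmf M" "{x. Q x}"]
  by (simp add: Collect_disj_eq)

lemma prob_pmf_Bex:
  assumes "finite I"
  shows "measure_pmf.prob M {x. \<exists>i\<in>I. P i x} \<le> (\<Sum>i\<in>I. measure_pmf.prob M {x. P i x})"
proof -
  have "{x. \<exists>i\<in>I. P i x} = (\<Union>i\<in>I. {x. P i x})" by auto
  then show ?thesis
    using measure_pmf.finite_measure_subadditive_finite[OF assms, of "\<lambda>i. {x. P i x}" M] by simp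
qed

lemma prob_pmf_Bex_le:
  fixes b :: real
  assumes "finite I" "\<And>i. i \<in> I \<Longrightarrow> measure_pmf.prob M {x. P i x} \<le> b"
  shows "measure_pmf.prob M {x. \<exists>i\<in>I. P i x} \<le> card I * b"
  using order.trans[OF prob_pmf_Bex[OF assms(1)] sum_bounded_above[OF assms(2)]] by simp

lemma prob_bind_pmf:
  "measure_pmf.prob (bind_pmf M f) A = measure_pmf.expectation M (\<lambda>x. measure_pmf.prob (f x) A)"
  by (simp add: measure_pmf_bind measure_pmf.measure_bind[where N="count_space UNIV"] measure_pmf_in_subprob_algebra)

lemma prob_bind_pmf_le:
  assumes "\<And>x. x \<in> set_pmf M \<Longrightarrow> measure_pmf.prob (f x) A \<le> b"
  shows "measure_pmf.prob (bind_pmf M f) A \<le> b"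
proof -
  have "measure_pmf.prob (bind_pmf M f) A \<le> measure_pmf.expectation M (\<lambda>x. b)"
    unfolding prob_bind_pmf
  proof (rule integral_mono_AE)
    show "integrable (measure_pmf M) (\<lambda>x. measure_pmf.prob (f x) A)"
      by (intro measure_pmf.integrable_const_bound[where B=1]) auto
  qed (use assms in \<open>auto simp: AE_measure_pmf_iff\<close>)
  then show ?thesis by simp
qed

text \<open>Conditioning on the first stage: bad outcomes are charged in full, good ones contribute
  at most \<open>b\<close> on average.\<close>

lemma prob_bind_pmf_le_except:
  assumes "\<And>x. x \<in> set_pmf M \<Longrightarrow> \<not> P x \<Longrightarrow> measure_pmf.prob (f x) A \<le> b" "0 \<le> b"
  shows "measure_pmf.prob (bind_pmf M f) A \<le> measure_pmf.prob M {x. P x} + b"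
proof -
  have "measure_pmf.prob (bind_pmf M f) A \<le> measure_pmf.expectation M (\<lambda>x. indicator {x. P x} x + b)"
    unfolding prob_bind_pmf
  proof (rule integral_mono_AE)
    show "integrable (measure_pmf M) (\<lambda>x. measure_pmf.prob (f x) A)"
      by (intro measure_pmf.integrable_const_bound[where B=1]) auto
    show "integrable (measure_pmf M) (\<lambda>x. indicator {x. P x} x + b)"
      by (intro Bochner_Integration.integrable_add measure_pmf.integrable_const_bound[where B=1 and f="indicator {x. P x}"]) auto
    show "AE x in measure_pmf M. measure_pmf.prob (f x) A \<le> indicator {x. P x} x + b"
      using assms by (auto simp: AE_measure_pmf_iff indicator_def add_increasing2)
  qed
  also have "\<dots> = measure_pmf.prob M {x. P x} + b"
    by (subst Bochner_Integration.integral_add) (auto intro!: measure_pmf.integrable_const_bound[where B="1"])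
  finally show ?thesis .
qed

text \<open>\<open>A v\<close> is decided by the part of \<open>R\<close> in the block
  \<open>B v\<close>. Disjoint blocks make these events independent, though not necessarily equally
  likely, so Hoeffding's inequality applies to the number of them that occur.\<close>

lemma Hoeffding_random_subset:
  fixes A :: "'v \<Rightarrow> 'e set \<Rightarrow> bool" and P :: "'e set" and p :: real
  assumes P: "finite P" and I: "finite I"
    and B: "\<And>v. v \<in> I \<Longrightarrow> B v \<subseteq> P" "disjoint_family_on B I"
    and A: "\<And>v R. v \<in> I \<Longrightarrow> R \<subseteq> P \<Longrightarrow> A v R \<longleftrightarrow> A v (R \<inter> B v)"
    and e: "e \<ge> 0"
  defines "M \<equiv> random_subset p P"
  defines "\<mu> \<equiv> (\<Sum>v\<in>I. measure_pmf.prob M {R. A v R})"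
  shows "measure_pmf.prob M {R. real (card {v\<in>I. A v R}) \<ge> \<mu> + e} \<le> exp (-2 * e\<^sup>2 / card I)" (is ?ge)
    and "measure_pmf.prob M {R. real (card {v\<in>I. A v R}) \<le> \<mu> - e} \<le> exp (-2 * e\<^sup>2 / card I)" (is ?le)
proof -
  define N where "N = Pi_pmf P False (\<lambda>_. bernoulli_pmf p)"
  define g where "g f = {x\<in>P. f x}" for f :: "'e \<Rightarrow> bool"
  define X where "X v f = (of_bool (A v (g f)) :: real)" for v f
  have M: "M = map_pmf g N" by (simp add: M_def random_subset_def N_def g_def[abs_def])
  note N = measure_pmf.prob_space_axioms[of N]
  have X_eq: "X v f = (\<lambda>h. of_bool (A v {x\<in>B v. h x})) (restrict f (B v))" if "v \<in> I" for v f
  proof -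
    have "A v (g f) \<longleftrightarrow> A v (g f \<inter> B v)" using that by (intro A) (auto simp: g_def)
    also have "g f \<inter> B v = {x\<in>B v. restrict f (B v) x}" using B(1)[OF that] by (auto simp: g_def)
    finally show ?thesis by (simp add: X_def)
  qed
  have fB: "finite (B v)" if "v \<in> I" for v using B(1)[OF that] P finite_subset by auto
  have ind: "prob_space.indep_vars N (\<lambda>_. borel) X I"
  proof -
    have "prob_space.indep_vars N (\<lambda>v. PiM (B v) (\<lambda>_. count_space UNIV)) (\<lambda>v f. restrict (\<lambda>i. f i) (B v)) I"
      using indep_vars_Pi_pmf[OF P] B unfolding N_def
      by (intro prob_space.indep_vars_restrict[where I=P] measure_pmf.prob_space_axioms)
    then have "prob_space.indep_vars N (\<lambda>_. borel)
        (\<lambda>v f. (\<lambda>h. of_bool (A v {x\<in>B v. h x}) :: real) (restrict (\<lambda>i. f i) (B v))) I"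
    proof (rule prob_space.indep_vars_compose2[OF N])
      fix v assume "v \<in> I"
      \<comment> \<open>On a finite block the product sigma-algebra is discrete, so every function
        of the restriction is measurable.\<close>
      then have "PiM (B v) (\<lambda>_. count_space (UNIV :: bool set)) = count_space (PiE (B v) (\<lambda>_. UNIV))"
        using fB by (intro count_space_PiM_finite) auto
      then show "(\<lambda>h. of_bool (A v {x\<in>B v. h x}) :: real) \<in> Pi\<^sub>M (B v) (\<lambda>_. count_space UNIV) \<rightarrow>\<^sub>M borel"
        by simp
    qed
    then show ?thesis
      by (subst prob_space.indep_vars_cong[OF N refl _ refl, of _ X]) (use X_eq in auto)
  qed
  interpret H: Hoeffding_ineq "measure_pmf N" I X "\<lambda>_. 0" "\<lambda>_. 1" "\<Sum>v\<in>I. measure_pmf.expectation N (X v)"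
    by unfold_locales (auto simp: I ind X_def)
  have mu: "(\<Sum>v\<in>I. measure_pmf.expectation N (X v)) = \<mu>"
    unfolding \<mu>_def
  proof (intro sum.cong refl)
    fix v assume "v \<in> I"
    have "X v = indicator (g -` {R. A v R})" by (auto simp: X_def indicator_def)
    then show "measure_pmf.expectation N (X v) = measure_pmf.prob M {R. A v R}"
      by (simp add: M)
  qed
  have S: "(\<Sum>v\<in>I. X v f) = real (card {v\<in>I. A v (g f)})" for f
  proof -
    have "(\<Sum>v\<in>I. X v f) = (\<Sum>v\<in>I. if A v (g f) then 1 else 0)"
      by (simp add: X_def of_bool_def)
    also have "\<dots> = real (card {v\<in>I. A v (g f)})"
      using I by (simp add: sum.If_cases Int_def)
    finally show ?thesis .
  qed
  have *: ?ge ?le if "I \<noteq> {}"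
  proof -
    have c: "0 < card I" using that I by (simp add: card_gt_0_iff)
    have "measure_pmf.prob N {f. (\<Sum>v\<in>I. X v f) \<ge> \<mu> + e} \<le> exp (-2 * e\<^sup>2 / card I)"
      using H.Hoeffding_ineq_ge[OF e] c by (simp add: mu)
    then show ?ge by (simp add: S M vimage_def)
    have "measure_pmf.prob N {f. (\<Sum>v\<in>I. X v f) \<le> \<mu> - e} \<le> exp (-2 * e\<^sup>2 / card I)"
      using H.Hoeffding_ineq_le[OF e] c by (simp add: mu)
    then show ?le by (simp add: S M vimage_def)
  qed
  \<comment> \<open>For empty \<open>I\<close> the division by \<open>card I\<close> yields 0, so
    the claimed bound is \<open>exp 0 = 1\<close>.\<close>
  show ?ge ?le
    using * by (cases "I = {}"; simp)+
qed

lemma Hoeffding_card_Int: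
  fixes p :: real
  assumes "finite P" "B \<subseteq> P" "p \<in> {0..1}" "e \<ge> 0"
  shows "measure_pmf.prob (random_subset p P) {R. real (card (R \<inter> B)) \<ge> card B * p + e} \<le> exp (-2 * e\<^sup>2 / card B)"
    and "measure_pmf.prob (random_subset p P) {R. real (card (R \<inter> B)) \<le> card B * p - e} \<le> exp (-2 * e\<^sup>2 / card B)"
proof -
  interpret binomial_distribution "card B" p by standard (rule assms)
  show "measure_pmf.prob (random_subset p P) {R. real (card (R \<inter> B)) \<ge> card B * p + e} \<le> exp (-2 * e\<^sup>2 / card B)"
    unfolding prob_card_Int_random_subset[OF assms(1,3,2), of "\<lambda>j. real j \<ge> card B * p + e"]
    using prob_ge[OF _ assms(4)] by (cases "card B > 0") auto
  show "measure_pmf.prob (random_subset p P) {R. real (card (R \<inter> B)) \<le> card B * p - e} \<le> exp (-2 * e\<^sup>2 / card B)"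
    unfolding prob_card_Int_random_subset[OF assms(1,3,2), of "\<lambda>j. real j \<le> card B * p - e"]
    using prob_le[OF _ assms(4)] by (cases "card B > 0") auto
qed

section \<open>The normal tail and the central limit theorem for binomial tails\<close>

lemma Phi_eq_cdf: "Phi x = cdf std_normal_distribution x"
proof -
  have "cdf std_normal_distribution x = (\<integral>y. indicator {..x} y \<partial>std_normal_distribution)"
    by (simp add: cdf_def)
  also have "\<dots> = (LBINT y. std_normal_density y *\<^sub>R indicator {..x} y)"
    by (subst integral_density) auto
  also have "\<dots> = Phi x"
    by (simp add: Phi_def set_lebesgue_integral_def mult.commute)
  finally show ?thesis ..
qed

text \<open>The density is positive everywhere, so an interval that is null for the normal law would
  be null for Lebesgue measure.\<close>

lemma Phi_strict_mono: "x < y \<Longrightarrow> Phi x < Phi y"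
proof -
  assume xy: "x < y"
  interpret S: prob_space std_normal_distribution
    using real_dist_normal_dist real_distribution_def by blast
  have "0 < measure std_normal_distribution {x<..y}"
  proof (rule ccontr)
    assume "\<not> 0 < measure std_normal_distribution {x<..y}"
    then have "measure std_normal_distribution {x<..y} = 0"
      using measure_nonneg[of std_normal_distribution "{x<..y}"] by linarith
    then have "emeasure std_normal_distribution {x<..y} = 0"
      by (simp add: S.emeasure_eq_measure)
    then have "{x<..y} \<in> null_sets std_normal_distribution" by auto
    then have "AE z in lborel. z \<in> {x<..y} \<longrightarrow> ennreal (std_normal_density z) = 0"
      by (subst (asm) null_sets_density_iff) auto
    then have "AE z in lborel. z \<notin> {x<..y}"
      by eventually_elim (auto simp: normal_density_def)
    then have "{x<..y} \<in> null_sets lborel"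
      by (subst (asm) AE_iff_null_sets[symmetric]) auto
    then show False using xy by auto
  qed
  moreover have "cdf std_normal_distribution y - cdf std_normal_distribution x = measure std_normal_distribution {x<..y}"
    using xy real_dist_normal_dist
    by (intro finite_borel_measure.cdf_diff_eq real_distribution.finite_borel_measure_M) auto
  ultimately show ?thesis by (simp add: Phi_eq_cdf)
qed

lemma Phi_bar_strict_antimono: "x < y \<Longrightarrow> Phi_bar y < Phi_bar x"
  by (simp add: Phi_bar_def Phi_strict_mono)

lemma Phi_bar_pos: "0 < Phi_bar x"
  using Phi_strict_mono[of x "x + 1"] real_distribution.cdf_bounded_prob[OF real_dist_normal_dist, of "x + 1"]
  by (simp add: Phi_bar_def Phi_eq_cdf)

lemma Phi_bar_less_1: "Phi_bar x < 1"
  using Phi_strict_mono[of "x - 1" x] 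
    finite_borel_measure.cdf_nonneg[OF real_distribution.finite_borel_measure_M[OF real_dist_normal_dist], of "x - 1"]
  by (simp add: Phi_bar_def Phi_eq_cdf)

text \<open>A distribution function is continuous where its law has no atom, and a law with a
  density has none.\<close>

lemma isCont_Phi: "isCont Phi x"
proof -
  interpret S: prob_space std_normal_distribution
    using real_dist_normal_dist real_distribution_def by blast
  have "{x} \<in> null_sets std_normal_distribution"
    using AE_lborel_singleton[of x] by (subst null_sets_density_iff) (auto simp: frequently_def)
  then have "measure std_normal_distribution {x} = 0"
    by (simp add: measure_def null_sets_def)
  then have "isCont (cdf std_normal_distribution) x"
    using finite_borel_measure.isCont_cdf[OF real_distribution.finite_borel_measure_M[OF real_dist_normal_dist]]
    by simp
  moreover have "Phi = cdf std_normal_distribution" by (auto simp: Phi_eq_cdf)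
  ultimately show ?thesis by simp
qed

lemma isCont_Phi_bar: "isCont Phi_bar x"
  unfolding Phi_bar_def[abs_def] by (intro continuous_intros isCont_Phi)

lemma tendsto_Phi_bar [tendsto_intros]: "(f \<longlongrightarrow> x) F \<Longrightarrow> ((\<lambda>y. Phi_bar (f y)) \<longlongrightarrow> Phi_bar x) F"
  using isCont_Phi_bar isCont_tendsto_compose by blast

lemma Phi_bar_at_bot: "(Phi_bar \<longlongrightarrow> 1) at_bot"
proof -
  have "(cdf std_normal_distribution \<longlongrightarrow> 0) at_bot"
    by (intro finite_borel_measure.cdf_lim_at_bot real_distribution.finite_borel_measure_M real_dist_normal_dist)
  moreover have "Phi = cdf std_normal_distribution" by (auto simp: Phi_eq_cdf)
  ultimately have "((\<lambda>x. 1 - Phi x) \<longlongrightarrow> 1 - 0) at_bot"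
    by (intro tendsto_intros) simp
  then show ?thesis by (simp add: Phi_bar_def[abs_def])
qed

text \<open>The upper tail of the symmetric binomial law in units of its standard deviation
  \<open>sqrt m / 2\<close>, with the threshold in the form used by the filter.\<close>

definition btail :: "nat \<Rightarrow> real \<Rightarrow> real" where
  "btail m y = measure_pmf.prob (binomial_pmf m (1/2)) {j. real j \<ge> m / 2 + y * (sqrt m / 2)}"

abbreviation normalized_binomial :: "nat \<Rightarrow> real measure" where
  "normalized_binomial m \<equiv> distr (measure_pmf (binomial_pmf m (1/2))) borel (\<lambda>j. (2 * real j - m) / sqrt m)"

text \<open>Here 2 j - m behaves like a sum of m random signs: expanding the m-th power of the
  average of \<open>cis s\<close> and \<open>cis (- s)\<close> by the binomial theorem reproduces
  the expectation term by term.\<close>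

lemma char_normalized_binomial: "char (normalized_binomial m) t = of_real (cos (t / sqrt m) ^ m)"
proof -
  define s where "s = t / sqrt m"
  have e: "iexp (t * ((2 * real k - real m) / sqrt m)) = cis s ^ k * cis (- s) ^ (m - k)"
    if "k \<le> m" for k
  proof -
    have "cis s ^ k * cis (- s) ^ (m - k) = cis (real k * s - real (m - k) * s)"
      unfolding Complex.DeMoivre cis_mult by simp
    also have "real k * s - real (m - k) * s = t * ((2 * real k - real m) / sqrt m)"
      using that by (simp add: s_def of_nat_diff algebra_simps add_divide_distrib diff_divide_distrib)
    finally show ?thesis by (simp add: cis_conv_exp)
  qed
  have "char (normalized_binomial m) t =
      measure_pmf.expectation (binomial_pmf m (1/2)) (\<lambda>k. iexp (t * ((2 * real k - real m) / sqrt m)))"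
    unfolding char_def by (subst integral_distr) auto
  also have "\<dots> = (\<Sum>k\<le>m. pmf (binomial_pmf m (1/2)) k *\<^sub>R iexp (t * ((2 * real k - real m) / sqrt m)))"
    using set_pmf_binomial_eq[of "1/2" m] by (intro integral_measure_pmf) (auto split: if_splits)
  also have "\<dots> = (\<Sum>k\<le>m. of_nat (m choose k) * (cis s / 2) ^ k * (cis (- s) / 2) ^ (m - k))"
  proof (intro sum.cong refl)
    fix k assume "k \<in> {..m}"
    then have k: "k \<le> m" by simp
    show "pmf (binomial_pmf m (1/2)) k *\<^sub>R iexp (t * ((2 * real k - real m) / sqrt m)) =
        of_nat (m choose k) * (cis s / 2) ^ k * (cis (- s) / 2) ^ (m - k)"
      unfolding e[OF k] by (simp add: scaleR_conv_of_real power_divide)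
  qed
  also have "\<dots> = (cis s / 2 + cis (- s) / 2) ^ m"
    by (simp add: binomial_ring)
  also have "cis s / 2 + cis (- s) / 2 = of_real (cos s)"
    by (simp add: complex_eq_iff)
  finally show ?thesis by (simp add: s_def)
qed

text \<open>Levy's continuity theorem. Computing the characteristic functions directly avoids
  realizing the binomial law as a sum of independent variables.\<close>

lemma normalized_binomial_weak_conv: "weak_conv_m normalized_binomial std_normal_distribution"
proof (rule levy_continuity)
  fix t :: real
  have "(\<lambda>m. cos (t / sqrt (real m)) ^ m) \<longlonglongrightarrow> exp (- (t * t / 2))"
    by real_asymp
  then have "(\<lambda>m. cos (t / sqrt (real m)) ^ m) \<longlonglongrightarrow> exp (- (t\<^sup>2) / 2)"
    by (simp add: power2_eq_square)
  then show "(\<lambda>m. char (normalized_binomial m) t) \<longlonglongrightarrow> char std_normal_distribution t"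
    unfolding char_normalized_binomial char_std_normal_distribution by (intro tendsto_of_real) 
qed (auto intro!: real_dist_normal_dist prob_space.real_distribution_distr measure_pmf.prob_space_axioms)

text \<open>The filter keeps vertices that meet the threshold exactly, whereas the complement of a
  distribution function is a strict tail. The closed tail at \<open>y\<close> lies between the
  strict tails at \<open>y\<close> and at \<open>y - d\<close>, and \<open>d\<close> is made small
  by continuity of \<open>Phi_bar\<close>.\<close>

lemma btail_tendsto: "(\<lambda>m. btail m y) \<longlonglongrightarrow> Phi_bar y"
proof -
  define F where "F m = cdf (normalized_binomial m)" for m
  have F: "(\<lambda>m. F m x) \<longlonglongrightarrow> Phi x" for x
  proof -
    have "Phi = cdf std_normal_distribution" by (auto simp: Phi_eq_cdf)
    then show ?thesis
      using normalized_binomial_weak_conv isCont_Phi[of x]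
      by (simp add: weak_conv_m_def weak_conv_def F_def)
  qed
  have F_eq: "1 - F m x = measure_pmf.prob (binomial_pmf m (1/2)) {j. (2 * real j - m) / sqrt m > x}" for m x
  proof -
    have "F m x = measure_pmf.prob (binomial_pmf m (1/2)) {j. (2 * real j - m) / sqrt m \<le> x}"
      by (simp add: F_def cdf_def measure_distr vimage_def)
    also have "\<dots> = 1 - measure_pmf.prob (binomial_pmf m (1/2)) {j. (2 * real j - m) / sqrt m > x}"
      by (subst measure_pmf.prob_compl[symmetric]) (auto intro!: arg_cong2[where f=measure])
    finally show ?thesis by simp
  qed
  have b: "btail m y = measure_pmf.prob (binomial_pmf m (1/2)) {j. (2 * real j - m) / sqrt m \<ge> y}" if "m > 0" for m
    unfolding btail_def using that
    by (intro arg_cong2[where f=measure] refl Collect_cong) (simp add: field_simps)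
  have lo: "1 - F m y \<le> btail m y" and up: "btail m y \<le> 1 - F m (y - d)" if "m > 0" "d > 0" for m d
    unfolding b[OF that(1)] F_eq using that(2)
    by (auto intro!: measure_pmf.finite_measure_mono)
  show ?thesis
  proof (rule order_tendstoI)
    fix a assume "a < Phi_bar y"
    have "(\<lambda>m. 1 - F m y) \<longlonglongrightarrow> Phi_bar y"
      unfolding Phi_bar_def by (intro tendsto_intros F)
    then have "eventually (\<lambda>m. 1 - F m y > a) sequentially"
      using \<open>a < Phi_bar y\<close> by (rule order_tendstoD)
    with eventually_gt_at_top[of 0] show "eventually (\<lambda>m. a < btail m y) sequentially"
    proof eventually_elim
      case (elim m)
      then show ?case using lo[of m 1] by simp
    qed
  next
    fix a assume a: "a > Phi_bar y"
    have "((\<lambda>d. Phi_bar (y - d)) \<longlongrightarrow> Phi_bar (y - 0)) (at_right 0)"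
      by (intro tendsto_intros)
    then have "eventually (\<lambda>d. Phi_bar (y - d) < a) (at_right 0)"
      using a by (intro order_tendstoD) auto
    with eventually_at_right_less[of 0] have "eventually (\<lambda>d. 0 < d \<and> Phi_bar (y - d) < a) (at_right 0)"
      by eventually_elim auto
    then obtain d where d: "d > 0" "Phi_bar (y - d) < a"
      using eventually_happens[of _ "at_right (0::real)"] by (auto simp: trivial_limit_at_right_real)
    have "(\<lambda>m. 1 - F m (y - d)) \<longlonglongrightarrow> Phi_bar (y - d)"
      unfolding Phi_bar_def by (intro tendsto_intros F)
    then have "eventually (\<lambda>m. 1 - F m (y - d) < a) sequentially"
      using d(2) by (rule order_tendstoD)
    with eventually_gt_at_top[of 0] show "eventually (\<lambda>m. btail m y < a) sequentially"
    proof eventually_elim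
      case (elim m)
      then show ?case using up[of m d] d(1) by simp
    qed
  qed
qed

section \<open>Admissible parameters\<close>

lemma rho_strict_mono: "0 < \<alpha> \<Longrightarrow> \<alpha> < 1 \<Longrightarrow> c < c' \<Longrightarrow> rho \<alpha> \<beta> c < rho \<alpha> \<beta> c'"
  unfolding rho_def by (intro mult_strict_left_mono Phi_bar_strict_antimono) auto

lemma isCont_rho: "isCont (rho \<alpha> \<beta>) c"
  unfolding rho_def[abs_def] isCont_def by (intro tendsto_intros)

lemma tau_pos: "\<alpha> < 1 \<Longrightarrow> 0 < tau \<alpha> \<beta>"
  by (simp add: tau_def Phi_bar_pos)

lemma tau_less_1: "0 < \<alpha> \<Longrightarrow> \<alpha> < 1 \<Longrightarrow> tau \<alpha> \<beta> < 1"
  unfolding tau_def using mult_strict_mono[of "1 - \<alpha>" 1 "Phi_bar \<beta>" 1] Phi_bar_less_1[of \<beta>] Phi_bar_pos[of \<beta>] by simp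

lemma rho_pos: "\<alpha> < 1 \<Longrightarrow> 0 < rho \<alpha> \<beta> c"
  by (simp add: rho_def Phi_bar_pos)

lemma rho_less_1: "0 < \<alpha> \<Longrightarrow> \<alpha> < 1 \<Longrightarrow> rho \<alpha> \<beta> c < 1"
  unfolding rho_def using mult_strict_mono[of "1 - \<alpha>" 1 "Phi_bar (\<beta> - c * sqrt \<alpha>)" 1]
    Phi_bar_less_1[of "\<beta> - c * sqrt \<alpha>"] Phi_bar_pos[of "\<beta> - c * sqrt \<alpha>"] by simp

text \<open>At c = 0 the value of \<open>rho\<close> is \<open>tau\<close>, which lies below its own
  square root because it is less than 1. The intermediate value theorem gives a crossing, and strict
  monotonicity makes it the least admissible point.\<close>

lemma c_tilde_attained:
  assumes \<alpha>: "0 < \<alpha>" "\<alpha> < 1" and ex: "0 < c" "rho \<alpha> \<beta> c \<ge> sqrt (tau \<alpha> \<beta>)"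
  shows "0 < c_tilde \<alpha> \<beta>" "rho \<alpha> \<beta> (c_tilde \<alpha> \<beta>) = sqrt (tau \<alpha> \<beta>)"
proof -
  have t: "0 < tau \<alpha> \<beta>" "tau \<alpha> \<beta> < 1" using \<alpha> tau_pos tau_less_1 by auto
  have r0: "rho \<alpha> \<beta> 0 = tau \<alpha> \<beta>" by (simp add: rho_def tau_def)
  have sq: "tau \<alpha> \<beta> < sqrt (tau \<alpha> \<beta>)"
    using t by (intro real_less_rsqrt) (simp add: power2_eq_square)
  then obtain m where m: "0 \<le> m" "m \<le> c" "rho \<alpha> \<beta> m = sqrt (tau \<alpha> \<beta>)"
    using IVT[of "rho \<alpha> \<beta>" 0 "sqrt (tau \<alpha> \<beta>)" c] isCont_rho ex r0 by auto
  have "m > 0" using m sq r0 by (cases "m = 0") auto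
  have "c_tilde \<alpha> \<beta> = m"
    unfolding c_tilde_def
  proof (rule Least_equality)
    show "0 < m \<and> sqrt (tau \<alpha> \<beta>) \<le> rho \<alpha> \<beta> m" using m \<open>m > 0\<close> by simp
  next
    fix y assume "0 < y \<and> sqrt (tau \<alpha> \<beta>) \<le> rho \<alpha> \<beta> y"
    then show "m \<le> y" using rho_strict_mono[OF \<alpha>, of y m \<beta>] m by (cases "y < m") auto
  qed
  then show "0 < c_tilde \<alpha> \<beta>" "rho \<alpha> \<beta> (c_tilde \<alpha> \<beta>) = sqrt (tau \<alpha> \<beta>)" using m \<open>m > 0\<close> by auto
qed

text \<open>Ensures that \<open>c_zero\<close> is the infimum of a nonempty set. The choice of
  \<open>\<alpha>\<close> gives \<open>q < 1 - \<alpha>\<close>, which amounts to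
  \<open>sqrt (tau \<alpha> 1) < 1 - \<alpha>\<close>, and the right side is the limit of
  \<open>rho\<close> for large c.\<close>

lemma admissible_exists:
  "\<exists>\<alpha> \<beta> c. 0 < \<alpha> \<and> \<alpha> < 1 \<and> 0 < \<beta> \<and> 0 < c \<and> rho \<alpha> \<beta> c \<ge> sqrt (tau \<alpha> \<beta>)"
proof -
  define q where "q = Phi_bar 1"
  define \<alpha> where "\<alpha> = (1 - q) / 2"
  have q: "0 < q" "q < 1" unfolding q_def by (rule Phi_bar_pos, rule Phi_bar_less_1)
  then have \<alpha>: "0 < \<alpha>" "\<alpha> < 1" by (auto simp: \<alpha>_def)
  have "q < 1 - \<alpha>" using q by (simp add: \<alpha>_def field_simps)
  then have "sqrt (tau \<alpha> 1) < 1 - \<alpha>"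
    using \<alpha> q by (intro real_less_lsqrt) (auto simp: tau_def q_def[symmetric] power2_eq_square)
  moreover have "((\<lambda>c. rho \<alpha> 1 c) \<longlongrightarrow> 1 - \<alpha>) at_top"
  proof -
    have "filterlim (\<lambda>c. 1 - c * sqrt \<alpha>) at_bot at_top"
      using \<alpha> by real_asymp
    then have "((\<lambda>c. (1 - \<alpha>) * Phi_bar (1 - c * sqrt \<alpha>)) \<longlongrightarrow> (1 - \<alpha>) * 1) at_top"
      by (intro tendsto_intros filterlim_compose[OF Phi_bar_at_bot])
    then show ?thesis by (simp add: rho_def)
  qed
  ultimately have "eventually (\<lambda>c. sqrt (tau \<alpha> 1) < rho \<alpha> 1 c) at_top"
    by (intro order_tendstoD)
  with eventually_gt_at_top[of 0] have "eventually (\<lambda>c. 0 < c \<and> sqrt (tau \<alpha> 1) < rho \<alpha> 1 c) at_top"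
    by eventually_elim auto
  then obtain c where "0 < c" "sqrt (tau \<alpha> 1) < rho \<alpha> 1 c"
    using eventually_happens[of _ "at_top :: real filter"] by auto
  then show ?thesis using \<alpha> by (intro exI[of _ \<alpha>] exI[of _ 1] exI[of _ c]) auto
qed

text \<open>Some \<open>c_tilde\<close> lies strictly below c. At that point \<open>rho\<close>
  equals \<open>sqrt (tau \<alpha> \<beta>)\<close>, so monotonicity in c turns the gap into a
  strict inequality.\<close>

lemma parameters_exist:
  assumes "c > c_zero"
  obtains \<alpha> \<beta> where "0 < \<alpha>" "\<alpha> < 1" "0 < \<beta>" "rho \<alpha> \<beta> c > sqrt (tau \<alpha> \<beta>)" "0 < c"
proof -
  let ?A = "{c_tilde \<alpha> \<beta> | \<alpha> \<beta>. 0 < \<alpha> \<and> \<alpha> < 1 \<and> 0 < \<beta> \<and> (\<exists>c>0. rho \<alpha> \<beta> c \<ge> sqrt (tau \<alpha> \<beta>))}"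
  have ne: "?A \<noteq> {}" using admissible_exists by blast
  have "bdd_below ?A" by (intro bdd_belowI[of _ 0]) (use c_tilde_attained(1) in force)
  then obtain x where "x \<in> ?A" "x < c"
    using assms ne cInf_less_iff[of ?A c] unfolding c_zero_def by auto
  then obtain \<alpha> \<beta> c' where *: "0 < \<alpha>" "\<alpha> < 1" "0 < \<beta>" "c' > 0" "rho \<alpha> \<beta> c' \<ge> sqrt (tau \<alpha> \<beta>)" "c_tilde \<alpha> \<beta> < c"
    by auto
  have "rho \<alpha> \<beta> c > sqrt (tau \<alpha> \<beta>)"
    using rho_strict_mono[OF *(1,2) *(6), of \<beta>] c_tilde_attained(2)[OF *(1,2,4,5)] by simp
  then show ?thesis using * c_tilde_attained(1)[OF *(1,2,4,5)] by (intro that[of \<alpha> \<beta>]) auto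
qed

section \<open>The planted model and fresh edges\<close>

lemma doubleton_in_pairs [simp]: "{u, v} \<in> pairs V \<longleftrightarrow> u \<in> V \<and> v \<in> V \<and> u \<noteq> v"
  by (cases "u = v") (auto simp: pairs_def)

lemma finite_pairs: "finite V \<Longrightarrow> finite (pairs V)"
  unfolding pairs_def by (rule finite_subset[of _ "Pow V"]) auto

lemma pairs_mono: "A \<subseteq> B \<Longrightarrow> pairs A \<subseteq> pairs B"
  by (auto simp: pairs_def)

lemma pairs_Int: "pairs A \<inter> pairs B = pairs (A \<inter> B)"
  by (auto simp: pairs_def)

text \<open>The potential edges from \<open>v\<close> to \<open>S\<close>. If \<open>v\<close> lies
  in \<open>S\<close>, the degenerate set \<open>{v}\<close> is included, which no set of pairs
  contains.\<close>

definition star :: "'a set \<Rightarrow> 'a \<Rightarrow> 'a set set" where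
  "star S v = (\<lambda>u. {u, v}) ` S"

lemma inj_on_star: "inj_on (\<lambda>u. {u, v}) S"
  by (auto simp: inj_on_def doubleton_eq_iff)

lemma card_star [simp]: "card (star S v) = card S"
  unfolding star_def by (rule card_image[OF inj_on_star])

lemma finite_star [simp]: "finite S \<Longrightarrow> finite (star S v)"
  by (simp add: star_def)

lemma deg_eq_card_star: "deg E S v = card (E \<inter> star S v)"
proof -
  have "E \<inter> star S v = (\<lambda>u. {u, v}) ` {u \<in> S. {u, v} \<in> E}"
    by (auto simp: star_def)
  then show ?thesis
    unfolding deg_def by (simp add: card_image[OF inj_on_star])
qed

text \<open>The independence of the filter decisions at different vertices rests on this.\<close>

lemma disjoint_star: "I \<inter> S = {} \<Longrightarrow> disjoint_family_on (star S) I"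
  by (auto simp: disjoint_family_on_def star_def doubleton_eq_iff)

lemma star_subset_non_clique:
  assumes "S \<subseteq> V" "v \<in> V" "v \<notin> S" "v \<notin> K \<or> S \<inter> K = {}"
  shows "star S v \<subseteq> pairs V - pairs K"
  using assms by (auto simp: star_def)

definition planted :: "'a set \<Rightarrow> 'a set \<Rightarrow> 'a set set pmf" where
  "planted V K = map_pmf (\<lambda>R. pairs K \<union> R) (random_subset (1/2) (pairs V - pairs K))"

lemma deg_planted_outside:
  "v \<notin> K \<Longrightarrow> deg (pairs K \<union> R) S v = card (R \<inter> star S v)"
  unfolding deg_eq_card_star by (rule arg_cong[where f=card]) (auto simp: star_def)

text \<open>The pairs inside the clique contribute deterministically, so only the edges from
  \<open>v\<close> to \<open>S - K\<close> are random.\<close>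

lemma deg_planted_inside:
  assumes "v \<in> K" "R \<inter> pairs K = {}" "{v} \<notin> R" "finite S"
  shows "deg (pairs K \<union> R) S v = card (S \<inter> K - {v}) + card (R \<inter> star (S - K) v)"
proof -
  have "(pairs K \<union> R) \<inter> star S v = star (S \<inter> K - {v}) v \<union> (R \<inter> star (S - K) v)"
    using assms by (auto simp: star_def)
  moreover have "star (S \<inter> K - {v}) v \<inter> (R \<inter> star (S - K) v) = {}"
    using assms by (auto simp: star_def doubleton_eq_iff)
  ultimately show ?thesis
    unfolding deg_eq_card_star using assms by (simp add: card_Un_disjoint)
qed

definition survivors :: "real \<Rightarrow> 'a set set \<Rightarrow> 'a set \<Rightarrow> 'a set \<Rightarrow> 'a set" where
  "survivors \<beta> E S V =
    {v \<in> V - S. real (deg E S v) \<ge> real (card S) / 2 + \<beta> * (sqrt (real (card S)) / 2)}"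

lemma filter_step_eq: "filter_step \<alpha> \<beta> E V = map_pmf (\<lambda>S. survivors \<beta> E S V) (random_subset \<alpha> V)"
  by (simp add: filter_step_def survivors_def map_pmf_def)

lemma survivors_cong:
  assumes "\<And>u v. u \<in> S \<Longrightarrow> v \<in> V - S \<Longrightarrow> {u, v} \<in> E \<longleftrightarrow> {u, v} \<in> E'"
  shows "survivors \<beta> E S V = survivors \<beta> E' S V"
proof -
  have "deg E S v = deg E' S v" if "v \<in> V - S" for v
    unfolding deg_def using assms that by (intro arg_cong[where f=card]) auto
  then show ?thesis by (auto simp: survivors_def)
qed

lemma survivors_subset: "survivors \<beta> E S V \<subseteq> V - S"
  by (auto simp: survivors_def)

text \<open>The filter only inspects edges between \<open>S\<close> and its complement, so the edges among the
  survivors are still fresh.\<close>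

lemma survivors_fresh:
  assumes "finite W" "J \<subseteq> W" "S \<subseteq> W"
  shows "map_pmf (\<lambda>E. (survivors \<beta> E S W, E \<inter> pairs (survivors \<beta> E S W))) (planted W J) =
    do {E \<leftarrow> planted W J;
        map_pmf (Pair (survivors \<beta> E S W))
          (planted (survivors \<beta> E S W) (J \<inter> survivors \<beta> E S W))}"
proof -
  \<comment> \<open>\<open>A\<close> collects the unplanted pairs that avoid \<open>S\<close>, and
    \<open>B\<close> those that meet it. The set of survivors depends on \<open>B\<close> only.
    Apart from planted pairs, the graph induced on the survivors uses \<open>A\<close> only.\<close>
  define A where "A = pairs (W - S) - pairs J"
  define B where "B = pairs W - pairs J - A"
  define f where "f R = survivors \<beta> (pairs J \<union> R) S W" for R
  have fin: "finite A" "finite B"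
    using assms by (auto simp: A_def B_def finite_pairs)
  have AB: "pairs W - pairs J = B \<union> A" "B \<inter> A = {}"
    using pairs_mono[of "W - S" W] by (auto simp: A_def B_def)
  have f_Un: "f (X \<union> Y) = f X" if "Y \<subseteq> A" for X Y
    unfolding f_def by (rule survivors_cong) (use that in \<open>auto simp: A_def\<close>)
  have split: "planted W J = do {X \<leftarrow> random_subset (1/2) B; Y \<leftarrow> random_subset (1/2) A;
      return_pmf (pairs J \<union> (X \<union> Y))}"
    unfolding planted_def AB(1) random_subset_Un[OF fin(2,1) AB(2)]
    by (simp add: map_pmf_def bind_assoc_pmf bind_return_pmf)
  have restr: "(pairs J \<union> (X \<union> Y)) \<inter> pairs (f X) = pairs (J \<inter> f X) \<union> (Y \<inter> pairs (f X))"
    if "X \<subseteq> B" "Y \<subseteq> A" for X Y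
  proof -
    have "f X \<subseteq> W - S" unfolding f_def by (rule survivors_subset)
    then have "X \<inter> pairs (f X) = {}"
      using that(1) pairs_mono[of "f X" "W - S"] by (auto simp: A_def B_def)
    then show ?thesis using pairs_Int[of J "f X"] by auto
  qed
  have fresh: "map_pmf (\<lambda>Y. pairs (J \<inter> f X) \<union> (Y \<inter> pairs (f X))) (random_subset (1/2) A) =
      planted (f X) (J \<inter> f X)" for X
  proof -
    have "f X \<subseteq> W - S" unfolding f_def by (rule survivors_subset)
    then have e: "A \<inter> pairs (f X) = pairs (f X) - pairs (J \<inter> f X)"
      using pairs_mono[of "f X" "W - S"] pairs_Int[of J "f X"] by (auto simp: A_def)
    show ?thesis
      unfolding planted_def e[symmetric] random_subset_Int[OF fin(1), symmetric] map_pmf_comp ..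
  qed
  have "map_pmf (\<lambda>E. (survivors \<beta> E S W, E \<inter> pairs (survivors \<beta> E S W))) (planted W J) =
      do {X \<leftarrow> random_subset (1/2) B; Y \<leftarrow> random_subset (1/2) A;
        return_pmf (f (X \<union> Y), (pairs J \<union> (X \<union> Y)) \<inter> pairs (f (X \<union> Y)))}"
    by (simp add: split map_pmf_def bind_assoc_pmf bind_return_pmf f_def)
  also have "\<dots> = do {X \<leftarrow> random_subset (1/2) B; Y \<leftarrow> random_subset (1/2) A;
        return_pmf (f X, pairs (J \<inter> f X) \<union> (Y \<inter> pairs (f X)))}"
    by (intro bind_pmf_cong refl) (simp add: f_Un restr set_random_subset)
  also have "\<dots> = do {X \<leftarrow> random_subset (1/2) B; map_pmf (Pair (f X)) (planted (f X) (J \<inter> f X))}"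
    by (simp add: fresh[symmetric] map_pmf_def bind_assoc_pmf bind_return_pmf)
  \<comment> \<open>A dummy draw of the \<open>A\<close> part is inserted, so that both parts
    reassemble into a full planted graph.\<close>
  also have "\<dots> = do {X \<leftarrow> random_subset (1/2) B; Y \<leftarrow> random_subset (1/2) A;
      map_pmf (Pair (f (X \<union> Y))) (planted (f (X \<union> Y)) (J \<inter> f (X \<union> Y)))}"
  proof (intro bind_pmf_cong refl)
    fix X
    have "map_pmf (Pair (f X)) (planted (f X) (J \<inter> f X)) =
        do {Y \<leftarrow> random_subset (1/2) A; map_pmf (Pair (f X)) (planted (f X) (J \<inter> f X))}"
      by simp
    also have "\<dots> = do {Y \<leftarrow> random_subset (1/2) A;
        map_pmf (Pair (f (X \<union> Y))) (planted (f (X \<union> Y)) (J \<inter> f (X \<union> Y)))}"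
      by (intro bind_pmf_cong refl) (simp add: f_Un set_random_subset)
    finally show "map_pmf (Pair (f X)) (planted (f X) (J \<inter> f X)) = \<dots>" .
  qed
  also have "\<dots> = do {E \<leftarrow> planted W J; map_pmf (Pair (survivors \<beta> E S W))
          (planted (survivors \<beta> E S W) (J \<inter> survivors \<beta> E S W))}"
    by (simp add: split bind_assoc_pmf bind_return_pmf f_def)
  finally show ?thesis .
qed

text \<open>Redrawing all edges before each step makes the transition depend on the current vertex
  set alone.\<close>

primrec fresh_chain :: "real \<Rightarrow> real \<Rightarrow> 'a set \<Rightarrow> 'a set \<Rightarrow> nat \<Rightarrow> 'a set pmf" where
  "fresh_chain \<alpha> \<beta> K V 0 = return_pmf V"
| "fresh_chain \<alpha> \<beta> K V (Suc i) =
    do {W \<leftarrow> fresh_chain \<alpha> \<beta> K V i; S \<leftarrow> random_subset \<alpha> W; E \<leftarrow> planted W (K \<inter> W);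
        return_pmf (survivors \<beta> E S W)}"

lemma set_fresh_chain: "W \<in> set_pmf (fresh_chain \<alpha> \<beta> K V i) \<Longrightarrow> W \<subseteq> V"
proof (induction i arbitrary: W)
  case (Suc i)
  then show ?case using survivors_subset by fastforce
qed simp

lemma set_phase1: "W \<in> set_pmf (phase1 \<alpha> \<beta> E V i) \<Longrightarrow> W \<subseteq> V"
proof (induction i arbitrary: W)
  case (Suc i)
  then show ?case using survivors_subset by (fastforce simp: filter_step_eq)
qed simp

lemma set_planted: "E \<in> set_pmf (planted V K) \<Longrightarrow> K \<subseteq> V \<Longrightarrow> E \<subseteq> pairs V"
  using pairs_mono[of K V] by (auto simp: planted_def dest!: set_random_subset)

text \<open>An equality of joint laws for the surviving set and the graph induced on it, which is
  all that Phase 2 looks at. Edges leaving \<open>W\<close> are excluded because earlier steps may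
  have inspected them.\<close>

lemma phase1_fresh:
  assumes "finite V" "K \<subseteq> V"
  shows "do {E \<leftarrow> planted V K; W \<leftarrow> phase1 \<alpha> \<beta> E V i; return_pmf (W, E \<inter> pairs W)} =
    do {W \<leftarrow> fresh_chain \<alpha> \<beta> K V i; map_pmf (Pair W) (planted W (K \<inter> W))}"
proof (induction i)
  case 0
  have "map_pmf (\<lambda>E. (V, E \<inter> pairs V)) (planted V K) = map_pmf (Pair V) (planted V K)"
    using assms set_planted[OF _ assms(2)] by (intro map_pmf_cong) auto
  then show ?case using assms
    by (simp add: bind_return_pmf map_pmf_def Int_absorb2)
next
  case (Suc i)
  have "do {E \<leftarrow> planted V K; W \<leftarrow> phase1 \<alpha> \<beta> E V (Suc i); return_pmf (W, E \<inter> pairs W)} =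
      do {E \<leftarrow> planted V K; W \<leftarrow> phase1 \<alpha> \<beta> E V i; S \<leftarrow> random_subset \<alpha> W;
        return_pmf (survivors \<beta> E S W, E \<inter> pairs (survivors \<beta> E S W))}"
    by (simp add: filter_step_eq map_pmf_def bind_assoc_pmf bind_return_pmf)
  \<comment> \<open>The filter on \<open>W\<close> sees only the graph induced on \<open>W\<close>,
    so the step is a function of the pair covered by the induction hypothesis.\<close>
  also have "\<dots> = do {E \<leftarrow> planted V K; W \<leftarrow> phase1 \<alpha> \<beta> E V i; S \<leftarrow> random_subset \<alpha> W;
        return_pmf (survivors \<beta> (E \<inter> pairs W) S W,
          (E \<inter> pairs W) \<inter> pairs (survivors \<beta> (E \<inter> pairs W) S W))}"
  proof (intro bind_pmf_cong refl)
    fix E W S assume "S \<in> set_pmf (random_subset \<alpha> W)"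
    then have "S \<subseteq> W" by (rule set_random_subset)
    then have s: "survivors \<beta> (E \<inter> pairs W) S W = survivors \<beta> E S W"
      by (intro survivors_cong) auto
    moreover have "pairs (survivors \<beta> E S W) \<subseteq> pairs W"
      using survivors_subset[of \<beta> E S W] by (intro pairs_mono) auto
    ultimately show "return_pmf (survivors \<beta> E S W, E \<inter> pairs (survivors \<beta> E S W)) =
      return_pmf (survivors \<beta> (E \<inter> pairs W) S W,
          (E \<inter> pairs W) \<inter> pairs (survivors \<beta> (E \<inter> pairs W) S W))"
      by (simp add: Int_assoc Int_absorb1)
  qed
  also have "\<dots> = do {(W, F) \<leftarrow> do {E \<leftarrow> planted V K; W \<leftarrow> phase1 \<alpha> \<beta> E V i; return_pmf (W, E \<inter> pairs W)};
      S \<leftarrow> random_subset \<alpha> W; return_pmf (survivors \<beta> F S W, F \<inter> pairs (survivors \<beta> F S W))}"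
    by (simp add: bind_assoc_pmf bind_return_pmf)
  also have "\<dots> = do {W \<leftarrow> fresh_chain \<alpha> \<beta> K V i; F \<leftarrow> planted W (K \<inter> W); S \<leftarrow> random_subset \<alpha> W;
      return_pmf (survivors \<beta> F S W, F \<inter> pairs (survivors \<beta> F S W))}"
    unfolding Suc.IH by (simp add: map_pmf_def bind_assoc_pmf bind_return_pmf)
  \<comment> \<open>Given \<open>W\<close>, the sample \<open>S\<close> is independent of the edges.
    Exchanging the two draws allows the freshness statement for a fixed \<open>S\<close> to be
    used.\<close>
  also have "\<dots> = do {W \<leftarrow> fresh_chain \<alpha> \<beta> K V i; S \<leftarrow> random_subset \<alpha> W;
      map_pmf (\<lambda>F. (survivors \<beta> F S W, F \<inter> pairs (survivors \<beta> F S W))) (planted W (K \<inter> W))}"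
    unfolding map_pmf_def by (intro bind_pmf_cong refl) (rule bind_commute_pmf)
  also have "\<dots> = do {W \<leftarrow> fresh_chain \<alpha> \<beta> K V i; S \<leftarrow> random_subset \<alpha> W; F \<leftarrow> planted W (K \<inter> W);
        map_pmf (Pair (survivors \<beta> F S W))
          (planted (survivors \<beta> F S W) (K \<inter> survivors \<beta> F S W))}"
  proof (intro bind_pmf_cong refl)
    fix W S assume W: "W \<in> set_pmf (fresh_chain \<alpha> \<beta> K V i)" and S: "S \<in> set_pmf (random_subset \<alpha> W)"
    have "K \<inter> W \<inter> survivors \<beta> F S W = K \<inter> survivors \<beta> F S W" for F
      using survivors_subset[of \<beta> F S W] by auto
    then show "map_pmf (\<lambda>F. (survivors \<beta> F S W, F \<inter> pairs (survivors \<beta> F S W))) (planted W (K \<inter> W)) =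
        do {F \<leftarrow> planted W (K \<inter> W); map_pmf (Pair (survivors \<beta> F S W))
          (planted (survivors \<beta> F S W) (K \<inter> survivors \<beta> F S W))}"
      using survivors_fresh[of W "K \<inter> W" S \<beta>] set_random_subset[OF S]
        finite_subset[OF set_fresh_chain[OF W] assms(1)] by simp
  qed
  also have "\<dots> = do {W \<leftarrow> fresh_chain \<alpha> \<beta> K V (Suc i); map_pmf (Pair W) (planted W (K \<inter> W))}"
    by (simp add: bind_assoc_pmf bind_return_pmf)
  finally show ?case .
qed

section \<open>Concentration of one filtering step\<close>

definition step_pmf :: "real \<Rightarrow> real \<Rightarrow> 'a set \<Rightarrow> 'a set \<Rightarrow> 'a set pmf" where
  "step_pmf \<alpha> \<beta> W J =
    do {S \<leftarrow> random_subset \<alpha> W; E \<leftarrow> planted W J; return_pmf (survivors \<beta> E S W)}"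

lemma prob_survives_outside:
  assumes "finite W" "S \<subseteq> W" "v \<in> W - S" "v \<notin> J"
  shows "measure_pmf.prob (planted W J) {E. v \<in> survivors \<beta> E S W} = btail (card S) \<beta>"
proof -
  have "measure_pmf.prob (planted W J) {E. v \<in> survivors \<beta> E S W} =
      measure_pmf.prob (random_subset (1/2) (pairs W - pairs J))
        {R. real (card (R \<inter> star S v)) \<ge> real (card S) / 2 + \<beta> * (sqrt (real (card S)) / 2)}"
    using assms by (simp add: planted_def survivors_def vimage_def deg_planted_outside)
  also have "\<dots> = btail (card S) \<beta>"
    unfolding btail_def using assms
    by (subst prob_card_Int_random_subset) (auto simp: finite_pairs star_subset_non_clique)
  finally show ?thesis .
qed

text \<open>A clique vertex gets \<open>card (S \<inter> J)\<close> neighbors for free, so its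
  random degree into \<open>S - J\<close> has to reach only a lowered threshold. The hypothesis on
  \<open>y\<close> places this threshold at most \<open>y\<close> standard deviations above the
  mean.\<close>

lemma prob_survives_inside:
  assumes W: "finite W" "S \<subseteq> W" and v: "v \<in> J - S" and J: "J \<subseteq> W"
    and y: "\<beta> * sqrt (card S) - card (S \<inter> J) \<le> y * sqrt (card (S - J))"
  shows "btail (card (S - J)) y \<le> measure_pmf.prob (planted W J) {E. v \<in> survivors \<beta> E S W}"
proof -
  let ?P = "random_subset (1/2) (pairs W - pairs J)"
  have fin: "finite S" using W finite_subset by auto
  have star: "star (S - J) v \<subseteq> pairs W - pairs J"
    using assms by (intro star_subset_non_clique) auto
  have cS: "card S = card (S - J) + card (S \<inter> J)"
    using fin by (metis card_Diff_subset_Int finite_Int Int_lower1 card_mono le_add_diff_inverse2)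
  have "btail (card (S - J)) y =
      measure_pmf.prob ?P {R. real (card (R \<inter> star (S - J) v)) \<ge> card (S - J) / 2 + y * (sqrt (card (S - J)) / 2)}"
    unfolding btail_def using W star
    by (subst prob_card_Int_random_subset) (auto simp: finite_pairs)
  also have "\<dots> \<le> measure_pmf.prob ?P {R. v \<in> survivors \<beta> (pairs J \<union> R) S W}"
  proof (rule prob_pmf_mono)
    fix R assume "R \<in> set_pmf ?P" and *: "real (card (R \<inter> star (S - J) v)) \<ge> card (S - J) / 2 + y * (sqrt (card (S - J)) / 2)"
    then have R: "R \<subseteq> pairs W - pairs J" by (auto dest: set_random_subset)
    then have "{v} \<notin> R" by (auto simp: pairs_def)
    then have "deg (pairs J \<union> R) S v = card (S \<inter> J - {v}) + card (R \<inter> star (S - J) v)"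
      using R v fin by (intro deg_planted_inside) auto
    moreover have "S \<inter> J - {v} = S \<inter> J" using v by auto
    ultimately have "real (deg (pairs J \<union> R) S v) \<ge> card (S \<inter> J) + card (S - J) / 2 + y * sqrt (card (S - J)) / 2"
      using * by simp
    then have "real (deg (pairs J \<union> R) S v) \<ge> real (card S) / 2 + \<beta> * (sqrt (real (card S)) / 2)"
      using y unfolding cS of_nat_add by argo
    then show "v \<in> survivors \<beta> (pairs J \<union> R) S W"
      using v J by (auto simp: survivors_def)
  qed
  also have "\<dots> = measure_pmf.prob (planted W J) {E. v \<in> survivors \<beta> E S W}"
    by (simp add: planted_def vimage_def)
  finally show ?thesis .
qed

text \<open>For a fixed sample each decision is determined by one star, and stars of vertices
  outside \<open>S\<close> are disjoint. Planted pairs are removed from the blocks because they are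
  not random.\<close>

lemma survivors_concentration:
  fixes \<beta> \<delta> q :: real
  assumes W: "finite W" "S \<subseteq> W" and I: "I \<subseteq> W - S" and \<delta>: "\<delta> \<ge> 0"
  shows "(\<And>v. v \<in> I \<Longrightarrow> q \<le> measure_pmf.prob (planted W J) {E. v \<in> survivors \<beta> E S W}) \<Longrightarrow>
      measure_pmf.prob (planted W J) {E. real (card (I \<inter> survivors \<beta> E S W)) \<le> (q - \<delta>) * card I}
        \<le> exp (-2 * \<delta>\<^sup>2 * card I)"
    and "(\<And>v. v \<in> I \<Longrightarrow> measure_pmf.prob (planted W J) {E. v \<in> survivors \<beta> E S W} \<le> q) \<Longrightarrow>
      measure_pmf.prob (planted W J) {E. real (card (I \<inter> survivors \<beta> E S W)) \<ge> (q + \<delta>) * card I}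
        \<le> exp (-2 * \<delta>\<^sup>2 * card I)"
proof -
  let ?P = "pairs W - pairs J"
  define A where "A v R \<longleftrightarrow> v \<in> survivors \<beta> (pairs J \<union> R) S W" for v R
  define \<mu> where "\<mu> = (\<Sum>v\<in>I. measure_pmf.prob (random_subset (1/2) ?P) {R. A v R})"
  have finI: "finite I" using W I finite_subset by (metis finite_Diff)
  have dep: "A v R \<longleftrightarrow> A v (R \<inter> (star S v - pairs J))" if "v \<in> I" "R \<subseteq> ?P" for v R
  proof -
    have "deg (pairs J \<union> R) S v = deg (pairs J \<union> R \<inter> (star S v - pairs J)) S v"
      unfolding deg_eq_card_star by (rule arg_cong[where f=card]) auto
    then show ?thesis by (simp add: A_def survivors_def)
  qed
  have disj: "disjoint_family_on (\<lambda>v. star S v - pairs J) I"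
    using disjoint_star[of I S] I by (auto simp: disjoint_family_on_def)
  have sub: "star S v - pairs J \<subseteq> ?P" if "v \<in> I" for v
    using that I W by (auto simp: star_def)
  have eq: "real (card {v \<in> I. A v R}) = card (I \<inter> survivors \<beta> (pairs J \<union> R) S W)" for R
    by (simp add: A_def Int_def)
  have p: "measure_pmf.prob (random_subset (1/2) ?P) {R. A v R} =
      measure_pmf.prob (planted W J) {E. v \<in> survivors \<beta> E S W}" for v
    by (simp add: planted_def vimage_def A_def)
  have e: "-2 * (\<delta> * card I)\<^sup>2 / card I = -2 * \<delta>\<^sup>2 * card I"
    by (simp add: power2_eq_square)
  have fP: "finite ?P" using W by (simp add: finite_pairs)
  have \<delta>I: "0 \<le> \<delta> * card I" using \<delta> by simp
  note H = Hoeffding_random_subset[where p="1/2" and A=A and e="\<delta> * card I", OF fP finI sub disj dep \<delta>I, folded \<mu>_def, unfolded e eq]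
  {
    assume lo: "\<And>v. v \<in> I \<Longrightarrow> q \<le> measure_pmf.prob (planted W J) {E. v \<in> survivors \<beta> E S W}"
    have "q * card I \<le> \<mu>"
      unfolding \<mu>_def p using sum_bounded_below[of I q] lo by (simp add: mult.commute)
    then have "measure_pmf.prob (random_subset (1/2) ?P)
        {R. real (card (I \<inter> survivors \<beta> (pairs J \<union> R) S W)) \<le> (q - \<delta>) * card I} \<le> exp (-2 * \<delta>\<^sup>2 * card I)"
      by (intro order.trans[OF prob_pmf_mono H(2)]) (auto simp: algebra_simps)
    then show "measure_pmf.prob (planted W J) {E. real (card (I \<inter> survivors \<beta> E S W)) \<le> (q - \<delta>) * card I}
        \<le> exp (-2 * \<delta>\<^sup>2 * card I)"
      by (simp add: planted_def vimage_def)
  next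
    assume hi: "\<And>v. v \<in> I \<Longrightarrow> measure_pmf.prob (planted W J) {E. v \<in> survivors \<beta> E S W} \<le> q"
    have "\<mu> \<le> q * card I"
      unfolding \<mu>_def p using sum_bounded_above[of I _ q] hi by (simp add: mult.commute)
    then have "measure_pmf.prob (random_subset (1/2) ?P)
        {R. real (card (I \<inter> survivors \<beta> (pairs J \<union> R) S W)) \<ge> (q + \<delta>) * card I} \<le> exp (-2 * \<delta>\<^sup>2 * card I)"
      by (intro order.trans[OF prob_pmf_mono H(1)]) (auto simp: algebra_simps)
    then show "measure_pmf.prob (planted W J) {E. real (card (I \<inter> survivors \<beta> E S W)) \<ge> (q + \<delta>) * card I}
        \<le> exp (-2 * \<delta>\<^sup>2 * card I)"
      by (simp add: planted_def vimage_def)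
  }
qed

lemma random_subset_concentration:
  fixes \<alpha> \<delta> :: real
  assumes "finite W" "T \<subseteq> W" "0 \<le> \<alpha>" "\<alpha> \<le> 1" "\<delta> \<ge> 0" and b: "2 * exp (-2 * \<delta>\<^sup>2 * card T) \<le> b"
  shows "measure_pmf.prob (random_subset \<alpha> W)
      {S. real (card (S \<inter> T)) \<le> (\<alpha> - \<delta>) * card T \<or> real (card (S \<inter> T)) \<ge> (\<alpha> + \<delta>) * card T}
    \<le> b"
proof -
  have e: "-2 * (\<delta> * card T)\<^sup>2 / card T = -2 * \<delta>\<^sup>2 * card T"
    by (simp add: power2_eq_square)
  have "measure_pmf.prob (random_subset \<alpha> W) {S. real (card (S \<inter> T)) \<le> (\<alpha> - \<delta>) * card T} \<le> exp (-2 * \<delta>\<^sup>2 * card T)"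
    using Hoeffding_card_Int(2)[of W T \<alpha> "\<delta> * card T"] assms unfolding e by (simp add: algebra_simps)
  moreover have "measure_pmf.prob (random_subset \<alpha> W) {S. real (card (S \<inter> T)) \<ge> (\<alpha> + \<delta>) * card T} \<le> exp (-2 * \<delta>\<^sup>2 * card T)"
    using Hoeffding_card_Int(1)[of W T \<alpha> "\<delta> * card T"] assms unfolding e by (simp add: algebra_simps)
  ultimately show ?thesis
    using b by (intro order.trans[OF prob_pmf_disj]) simp
qed

lemma step_prob_bound:
  assumes "\<And>S. S \<subseteq> W \<Longrightarrow> \<not> Bad S \<Longrightarrow> measure_pmf.prob (planted W J) {E. P (survivors \<beta> E S W)} \<le> b" "0 \<le> b"
    and "measure_pmf.prob (random_subset \<alpha> W) {S. Bad S} \<le> b'"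
  shows "measure_pmf.prob (step_pmf \<alpha> \<beta> W J) {W'. P W'} \<le> b' + b"
proof -
  have s: "step_pmf \<alpha> \<beta> W J = random_subset \<alpha> W \<bind> (\<lambda>S. map_pmf (\<lambda>E. survivors \<beta> E S W) (planted W J))"
    by (simp add: step_pmf_def map_pmf_def)
  have "measure_pmf.prob (step_pmf \<alpha> \<beta> W J) {W'. P W'} \<le> measure_pmf.prob (random_subset \<alpha> W) {S. Bad S} + b"
    unfolding s by (intro prob_bind_pmf_le_except) (use assms(1,2) in \<open>auto dest: set_random_subset simp: vimage_def\<close>)
  with assms(3) show ?thesis by simp
qed

text \<open>The clique makes up at most a fraction \<open>\<delta>\<close> of \<open>W\<close>, so
  both bounds can be read off the other vertices. The same \<open>\<delta>\<close> is the slack for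
  the central limit error, for both Hoeffding deviations and for the neglected clique.\<close>

lemma step_non_clique:
  fixes \<alpha> \<beta> a b :: real
  assumes \<alpha>: "0 < \<alpha>" "\<alpha> < 1" and ab: "a < tau \<alpha> \<beta>" "tau \<alpha> \<beta> < b"
  shows "\<exists>(\<delta>::real) (\<gamma>::real) N0. 0 < \<delta> \<and> 0 < \<gamma> \<and> (\<forall>W J :: 'a set. finite W \<longrightarrow> J \<subseteq> W \<longrightarrow> N0 \<le> card W \<longrightarrow> card J \<le> \<delta> * card W \<longrightarrow>
    measure_pmf.prob (step_pmf \<alpha> \<beta> W J) {W'. \<not> (a * card W \<le> card W' \<and> card W' \<le> b * card W)} \<le> 4 * exp (- \<gamma> * card W))"
proof -
  define p where "p = Phi_bar \<beta>"
  have p: "0 < p" unfolding p_def by (rule Phi_bar_pos)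
  have t: "tau \<alpha> \<beta> = p * (1 - \<alpha>)" by (simp add: tau_def p_def)
  \<comment> \<open>The change of \<open>p\<close> by \<open>2 * \<delta>\<close> allows for the
    central limit error and the fluctuation of the survivors. The other factor bounds the fraction
    of vertices in \<open>I\<close>, and the final \<open>\<delta>\<close> adds the clique
    back.\<close>
  have "((\<lambda>\<delta>. (p + 2 * \<delta>) * (1 - \<alpha> + \<delta>) + \<delta>) \<longlongrightarrow> (p + 2 * 0) * (1 - \<alpha> + 0) + 0) (at_right 0)"
    by (intro tendsto_intros)
  then have e1: "eventually (\<lambda>\<delta>. (p + 2 * \<delta>) * (1 - \<alpha> + \<delta>) + \<delta> < b) (at_right 0)"
    using ab t by (intro order_tendstoD) auto
  have "((\<lambda>\<delta>. (p - 2 * \<delta>) * (1 - \<alpha> - 2 * \<delta>)) \<longlongrightarrow> (p - 2 * 0) * (1 - \<alpha> - 2 * 0)) (at_right 0)"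
    by (intro tendsto_intros)
  then have e2: "eventually (\<lambda>\<delta>. (p - 2 * \<delta>) * (1 - \<alpha> - 2 * \<delta>) > a) (at_right 0)"
    using ab t by (intro order_tendstoD) auto
  have e3: "eventually (\<lambda>\<delta>. \<delta> \<in> {0<..<Min {p / 2, (1 - \<alpha>) / 4, \<alpha> / 2}}) (at_right 0)"
    using p \<alpha> by (intro eventually_at_right_real) auto
  from eventually_happens[OF eventually_conj[OF e1 eventually_conj[OF e2 e3]]]
  obtain \<delta> where \<delta>: "(p + 2 * \<delta>) * (1 - \<alpha> + \<delta>) + \<delta> < b" "(p - 2 * \<delta>) * (1 - \<alpha> - 2 * \<delta>) > a"
    "0 < \<delta>" "2 * \<delta> < p" "4 * \<delta> < 1 - \<alpha>" "2 * \<delta> < \<alpha>"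
    by (auto simp: trivial_limit_at_right_real)
  define \<gamma> where "\<gamma> = 2 * \<delta>\<^sup>2 * (1 - \<alpha> - 2 * \<delta>)"
  have \<gamma>: "0 < \<gamma>" using \<delta> unfolding \<gamma>_def by simp
  have \<gamma>_le: "\<gamma> \<le> 2 * \<delta>\<^sup>2" using \<delta> \<alpha> unfolding \<gamma>_def by (intro mult_right_le_one_le) auto
  have "eventually (\<lambda>m. btail m \<beta> \<in> {p - \<delta><..<p + \<delta>}) sequentially"
    using btail_tendsto[of \<beta>] \<delta>(3) unfolding p_def
    by (intro topological_tendstoD) auto
  then obtain m0 where m0: "\<And>m. m \<ge> m0 \<Longrightarrow> p - \<delta> \<le> btail m \<beta> \<and> btail m \<beta> \<le> p + \<delta>"
    by (auto simp: eventually_sequentially intro: less_imp_le)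
  \<comment> \<open>Forces a typical sample to have at least \<open>m0\<close> elements, so that
    \<open>btail\<close> is within \<open>\<delta>\<close> of its limit.\<close>
  define N0 where "N0 = nat \<lceil>m0 / (\<alpha> - \<delta>)\<rceil>"
  show ?thesis
  proof (rule exI[of _ \<delta>], rule exI[of _ \<gamma>], rule exI[of _ N0], intro conjI \<delta>(3) \<gamma> allI impI)
    fix W J :: "'a set"
    assume W: "finite W" and J: "J \<subseteq> W" and N: "N0 \<le> card W" and Jc: "card J \<le> \<delta> * card W"
    define n where "n = real (card W)"
    have m0n: "m0 \<le> (\<alpha> - \<delta>) * n"
    proof -
      have "m0 / (\<alpha> - \<delta>) \<le> n" using N unfolding N0_def n_def by linarith
      then show ?thesis using \<delta> by (simp add: field_simps)
    qed
    define Bad where "Bad S \<longleftrightarrow> real (card (S \<inter> W)) \<le> (\<alpha> - \<delta>) * card W \<or> real (card (S \<inter> W)) \<ge> (\<alpha> + \<delta>) * card W" for S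
    have bad: "measure_pmf.prob (random_subset \<alpha> W) {S. Bad S} \<le> 2 * exp (- \<gamma> * n)"
    proof -
      have "2 * exp (-2 * \<delta>\<^sup>2 * n) \<le> 2 * exp (- \<gamma> * n)"
        using \<gamma>_le by (simp add: n_def mult_right_mono)
      then show ?thesis
        using W \<alpha> \<delta> unfolding Bad_def n_def by (intro random_subset_concentration) auto
    qed
    have main: "measure_pmf.prob (planted W J) {E. \<not> (a * card W \<le> card (survivors \<beta> E S W) \<and> card (survivors \<beta> E S W) \<le> b * card W)}
      \<le> 2 * exp (- \<gamma> * n)" if S: "S \<subseteq> W" "\<not> Bad S" for S
    proof -
      define I where "I = W - S - J"
      have Sc: "(\<alpha> - \<delta>) * n < card S" "card S < (\<alpha> + \<delta>) * n"
        using S by (auto simp: Bad_def n_def Int_absorb2)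
      have finS: "finite S" "finite J" using S J W finite_subset by auto
      have WS: "real (card (W - S)) = n - card S"
        using S W finS by (simp add: card_Diff_subset n_def of_nat_diff card_mono)
      have "card (W - S) \<le> card I + card J"
      proof -
        have "W - S \<subseteq> I \<union> J" by (auto simp: I_def)
        then have "card (W - S) \<le> card (I \<union> J)" using W finS by (intro card_mono) (auto simp: I_def)
        also have "\<dots> \<le> card I + card J" by (rule card_Un_le)
        finally show ?thesis .
      qed
      then have I_lo: "(1 - \<alpha> - 2 * \<delta>) * n \<le> card I"
        using WS Sc Jc by (simp add: n_def[symmetric] algebra_simps)
      have "card I \<le> card (W - S)" using W by (intro card_mono) (auto simp: I_def)
      then have I_hi: "card I \<le> (1 - \<alpha> + \<delta>) * n"
        using WS Sc by (simp add: algebra_simps)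
      have pr: "measure_pmf.prob (planted W J) {E. v \<in> survivors \<beta> E S W} = btail (card S) \<beta>" if "v \<in> I" for v
        using that W S by (intro prob_survives_outside) (auto simp: I_def)
      have "m0 \<le> card S" using m0n Sc by linarith
      note bt = m0[OF this]
      have Isub: "I \<subseteq> W - S" by (auto simp: I_def)
      have ex: "exp (-2 * \<delta>\<^sup>2 * card I) \<le> exp (- \<gamma> * n)"
      proof -
        have "\<gamma> * n \<le> 2 * \<delta>\<^sup>2 * card I"
          using mult_left_mono[OF I_lo, of "2 * \<delta>\<^sup>2"] by (simp add: \<gamma>_def mult.assoc)
        then show ?thesis by simp
      qed
      have "measure_pmf.prob (planted W J) {E. \<not> (a * card W \<le> card (survivors \<beta> E S W) \<and> card (survivors \<beta> E S W) \<le> b * card W)}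
        \<le> measure_pmf.prob (planted W J) {E. real (card (I \<inter> survivors \<beta> E S W)) \<le> (p - \<delta> - \<delta>) * card I \<or>
              real (card (I \<inter> survivors \<beta> E S W)) \<ge> (p + \<delta> + \<delta>) * card I}"
      proof (rule prob_pmf_mono, rule ccontr)
        fix E
        let ?X = "survivors \<beta> E S W"
        assume "\<not> (real (card (I \<inter> ?X)) \<le> (p - \<delta> - \<delta>) * card I \<or> real (card (I \<inter> ?X)) \<ge> (p + \<delta> + \<delta>) * card I)"
        then have c: "(p - 2 * \<delta>) * card I < card (I \<inter> ?X)" "card (I \<inter> ?X) < (p + 2 * \<delta>) * card I"
          by (auto simp: algebra_simps not_le)
        assume neg: "\<not> (a * card W \<le> card ?X \<and> card ?X \<le> b * card W)"
        have finX: "finite ?X" using survivors_subset[of \<beta> E S W] W finite_subset by blast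
        have "card (I \<inter> ?X) \<le> card ?X" using finX by (intro card_mono) auto
        moreover have "a * n \<le> (p - 2 * \<delta>) * card I"
        proof -
          have "a * n \<le> ((p - 2 * \<delta>) * (1 - \<alpha> - 2 * \<delta>)) * n"
            using \<delta>(2) by (intro mult_right_mono) (auto simp: n_def)
          also have "\<dots> \<le> (p - 2 * \<delta>) * card I"
            using mult_left_mono[OF I_lo, of "p - 2 * \<delta>"] \<delta> by (simp add: mult.assoc)
          finally show ?thesis .
        qed
        ultimately have lo: "a * n \<le> card ?X" using c by linarith
        have "?X \<subseteq> (I \<inter> ?X) \<union> J" using survivors_subset[of \<beta> E S W] by (auto simp: I_def)
        then have "card ?X \<le> card ((I \<inter> ?X) \<union> J)" using finX finS by (intro card_mono) auto
        also have "\<dots> \<le> card (I \<inter> ?X) + card J" by (rule card_Un_le)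
        finally have "card ?X \<le> (p + 2 * \<delta>) * card I + \<delta> * n" using c Jc by (simp add: n_def)
        also have "\<dots> \<le> (p + 2 * \<delta>) * ((1 - \<alpha> + \<delta>) * n) + \<delta> * n"
          using I_hi \<delta> p by (intro add_mono mult_left_mono) auto
        also have "\<dots> = ((p + 2 * \<delta>) * (1 - \<alpha> + \<delta>) + \<delta>) * n" by (simp add: algebra_simps)
        also have "\<dots> \<le> b * n" using \<delta>(1) by (intro mult_right_mono) (auto simp: n_def)
        finally show False using lo neg by (simp add: n_def)
      qed
      also have "\<dots> \<le> exp (- \<gamma> * n) + exp (- \<gamma> * n)"
        using survivors_concentration(1)[OF W S(1) Isub, where q="p - \<delta>" and J=J and \<beta>=\<beta> and \<delta>=\<delta>]
          survivors_concentration(2)[OF W S(1) Isub, where q="p + \<delta>" and J=J and \<beta>=\<beta> and \<delta>=\<delta>] ex bt pr \<delta>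
        by (intro order.trans[OF prob_pmf_disj] add_mono) (auto intro: order.trans)
      finally show ?thesis by simp
    qed
    show "measure_pmf.prob (step_pmf \<alpha> \<beta> W J) {W'. \<not> (a * card W \<le> card W' \<and> card W' \<le> b * card W)} \<le> 4 * exp (- \<gamma> * card W)"
      using step_prob_bound[where P="\<lambda>W'. \<not> (a * card W \<le> card W' \<and> card W' \<le> b * card W)", OF main _ bad] by (simp add: n_def)
  qed
qed

text \<open>A typical sample has about \<open>\<alpha> * card W\<close> vertices, of which at least
  about \<open>\<alpha> * cs * sqrt (card W)\<close> are in the clique. In standard units this
  lowers the threshold for a clique vertex from \<open>\<beta>\<close> to
  \<open>\<beta> - cs * sqrt \<alpha>\<close>, the argument in \<open>rho\<close>. A larger clique
  lowers it further, so a lower bound on \<open>card J\<close> is the right hypothesis here.\<close>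

lemma step_clique:
  fixes \<alpha> \<beta> cs p :: real
  assumes \<alpha>: "0 < \<alpha>" "\<alpha> < 1" and \<beta>: "0 < \<beta>" and cs: "0 < cs" and p: "p < rho \<alpha> \<beta> cs"
  shows "\<exists>(\<delta>::real) (\<gamma>::real) N0. 0 < \<delta> \<and> 0 < \<gamma> \<and> (\<forall>W J :: 'a set. finite W \<longrightarrow> J \<subseteq> W \<longrightarrow> N0 \<le> card W \<longrightarrow>
      cs * sqrt (card W) \<le> card J \<longrightarrow> card J \<le> \<delta> * card W \<longrightarrow>
    measure_pmf.prob (step_pmf \<alpha> \<beta> W J) {W'. card (J \<inter> W') < p * card J} \<le> 5 * exp (- \<gamma> * card J))"
proof -
  define x where "x = \<beta> - cs * sqrt \<alpha>"
  have "((\<lambda>y. (1 - \<alpha>) * Phi_bar y) \<longlongrightarrow> (1 - \<alpha>) * Phi_bar x) (at_right x)"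
    by (intro tendsto_intros)
  then have "eventually (\<lambda>y. (1 - \<alpha>) * Phi_bar y > p) (at_right x)"
    using p by (intro order_tendstoD) (auto simp: rho_def x_def)
  then have "eventually (\<lambda>y. y > x \<and> (1 - \<alpha>) * Phi_bar y > p) (at_right x)"
    using eventually_at_right_less[of x] by eventually_elim auto
  from eventually_happens[OF this] obtain y where y: "y > x" "p < (1 - \<alpha>) * Phi_bar y"
    by (auto simp: trivial_limit_at_right_real)
  define q where "q = Phi_bar y"
  have q: "0 < q" unfolding q_def by (rule Phi_bar_pos)
  \<comment> \<open>This is \<open>x < y\<close> times \<open>sqrt \<alpha>\<close>: the survival
    condition without errors, divided by \<open>sqrt (card W)\<close>. Its strictness leaves room
    for the perturbations by \<open>\<delta>\<close>.\<close>
  have sq: "\<beta> * sqrt \<alpha> - \<alpha> * cs < y * sqrt \<alpha>"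
  proof -
    have "x * sqrt \<alpha> < y * sqrt \<alpha>" using y \<alpha> by simp
    moreover have "x * sqrt \<alpha> = \<beta> * sqrt \<alpha> - \<alpha> * cs" using \<alpha> by (simp add: x_def algebra_simps)
    ultimately show ?thesis by simp
  qed
  have "((\<lambda>\<delta>. (q - 2 * \<delta>) * (1 - \<alpha> - \<delta>)) \<longlongrightarrow> (q - 2 * 0) * (1 - \<alpha> - 0)) (at_right 0)"
    by (intro tendsto_intros)
  then have e1: "eventually (\<lambda>\<delta>. (q - 2 * \<delta>) * (1 - \<alpha> - \<delta>) > p) (at_right 0)"
    using y by (intro order_tendstoD) (auto simp: q_def mult.commute)
  have "((\<lambda>\<delta>. y * sqrt (\<alpha> - 2 * \<delta>) - (\<beta> * sqrt (\<alpha> + \<delta>) - (\<alpha> - \<delta>) * cs)) \<longlongrightarrow>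
      y * sqrt (\<alpha> - 2 * 0) - (\<beta> * sqrt (\<alpha> + 0) - (\<alpha> - 0) * cs)) (at_right 0)"
    by (intro tendsto_intros)
  then have e2: "eventually (\<lambda>\<delta>. y * sqrt (\<alpha> - 2 * \<delta>) - (\<beta> * sqrt (\<alpha> + \<delta>) - (\<alpha> - \<delta>) * cs) > 0) (at_right 0)"
    using sq by (intro order_tendstoD) auto
  \<comment> \<open>Since \<open>y\<close> may have either sign, \<open>y * sqrt m\<close> is
    smallest at the least or at the largest possible \<open>m\<close>; the condition is therefore
    secured at both ends.\<close>
  have "((\<lambda>\<delta>. y * sqrt (\<alpha> + \<delta>) - (\<beta> * sqrt (\<alpha> + \<delta>) - (\<alpha> - \<delta>) * cs)) \<longlongrightarrow>
      y * sqrt (\<alpha> + 0) - (\<beta> * sqrt (\<alpha> + 0) - (\<alpha> - 0) * cs)) (at_right 0)"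
    by (intro tendsto_intros)
  then have e3: "eventually (\<lambda>\<delta>. y * sqrt (\<alpha> + \<delta>) - (\<beta> * sqrt (\<alpha> + \<delta>) - (\<alpha> - \<delta>) * cs) > 0) (at_right 0)"
    using sq by (intro order_tendstoD) auto
  have e4: "eventually (\<lambda>\<delta>. \<delta> \<in> {0<..<Min {q / 2, (1 - \<alpha>) / 4, \<alpha> / 4}}) (at_right 0)"
    using q \<alpha> by (intro eventually_at_right_real) auto
  from eventually_happens[OF eventually_conj[OF e1 eventually_conj[OF e2 eventually_conj[OF e3 e4]]]]
  obtain \<delta> where \<delta>: "(q - 2 * \<delta>) * (1 - \<alpha> - \<delta>) > p"
    "\<beta> * sqrt (\<alpha> + \<delta>) - (\<alpha> - \<delta>) * cs \<le> y * sqrt (\<alpha> - 2 * \<delta>)"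
    "\<beta> * sqrt (\<alpha> + \<delta>) - (\<alpha> - \<delta>) * cs \<le> y * sqrt (\<alpha> + \<delta>)"
    "0 < \<delta>" "2 * \<delta> < q" "4 * \<delta> < 1 - \<alpha>" "4 * \<delta> < \<alpha>"
    by (auto simp: trivial_limit_at_right_real)
  define \<gamma> where "\<gamma> = 2 * \<delta>\<^sup>2 * (1 - \<alpha> - \<delta>)"
  have \<gamma>: "0 < \<gamma>" using \<delta> unfolding \<gamma>_def by simp
  have \<gamma>_le: "\<gamma> \<le> 2 * \<delta>\<^sup>2" using \<delta> \<alpha> unfolding \<gamma>_def by (intro mult_right_le_one_le) auto
  have "eventually (\<lambda>m. btail m y > q - \<delta>) sequentially"
    using btail_tendsto[of y] \<delta>(4) unfolding q_def
    by (intro order_tendstoD) auto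
  then obtain m0 where m0: "\<And>m. m \<ge> m0 \<Longrightarrow> q - \<delta> \<le> btail m y"
    by (auto simp: eventually_sequentially intro: less_imp_le)
  define N0 where "N0 = nat \<lceil>m0 / (\<alpha> - 2 * \<delta>)\<rceil>"
  show ?thesis
  proof (rule exI[of _ \<delta>], rule exI[of _ \<gamma>], rule exI[of _ N0], intro conjI \<delta>(4) \<gamma> allI impI)
    fix W J :: "'a set"
    assume W: "finite W" and J: "J \<subseteq> W" and N: "N0 \<le> card W" and Jl: "cs * sqrt (card W) \<le> card J"
      and Jc: "card J \<le> \<delta> * card W"
    define n where "n = real (card W)"
    define k where "k = real (card J)"
    have n0: "0 \<le> n" by (simp add: n_def)
    have kn: "k \<le> n" using J W unfolding k_def n_def by (simp add: card_mono)
    have m0n: "m0 \<le> (\<alpha> - 2 * \<delta>) * n"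
    proof -
      have "m0 / (\<alpha> - 2 * \<delta>) \<le> n" using N unfolding N0_def n_def by linarith
      then show ?thesis using \<delta> by (simp add: field_simps)
    qed
    define BadT where "BadT T S \<longleftrightarrow> real (card (S \<inter> T)) \<le> (\<alpha> - \<delta>) * card T \<or> real (card (S \<inter> T)) \<ge> (\<alpha> + \<delta>) * card T" for S T :: "'a set"
    define Bad where "Bad S \<longleftrightarrow> BadT W S \<or> BadT J S" for S
    have bad: "measure_pmf.prob (random_subset \<alpha> W) {S. Bad S} \<le> 4 * exp (- \<gamma> * k)"
    proof -
      have "2 * exp (-2 * \<delta>\<^sup>2 * n) \<le> 2 * exp (- \<gamma> * k)"
        using mult_mono[OF \<gamma>_le kn] by (simp add: k_def)
      moreover have "2 * exp (-2 * \<delta>\<^sup>2 * k) \<le> 2 * exp (- \<gamma> * k)"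
        using \<gamma>_le by (simp add: k_def mult_right_mono)
      ultimately have "measure_pmf.prob (random_subset \<alpha> W) {S. BadT W S} \<le> 2 * exp (- \<gamma> * k)"
        "measure_pmf.prob (random_subset \<alpha> W) {S. BadT J S} \<le> 2 * exp (- \<gamma> * k)"
        using W J \<alpha> \<delta> unfolding BadT_def n_def k_def
        by - (intro random_subset_concentration; simp)+
      then have "measure_pmf.prob (random_subset \<alpha> W) {S. Bad S} \<le> 2 * exp (- \<gamma> * k) + 2 * exp (- \<gamma> * k)"
        unfolding Bad_def by (intro order.trans[OF prob_pmf_disj] add_mono)
      then show ?thesis by simp
    qed
    have main: "measure_pmf.prob (planted W J) {E. card (J \<inter> survivors \<beta> E S W) < p * card J}
      \<le> exp (- \<gamma> * k)" if S: "S \<subseteq> W" "\<not> Bad S" for S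
    proof -
      define I where "I = J - S"
      define s j m where "s = real (card S)" and "j = real (card (S \<inter> J))" and "m = real (card (S - J))"
      have Sc: "(\<alpha> - \<delta>) * n < s" "s < (\<alpha> + \<delta>) * n" "(\<alpha> - \<delta>) * k < j" "j < (\<alpha> + \<delta>) * k"
        using S by (auto simp: Bad_def BadT_def n_def k_def s_def j_def Int_absorb2)
      have finS: "finite S" "finite J" using S J W finite_subset by auto
      have sm: "s = m + j"
        using finS unfolding s_def m_def j_def
        by (metis card_Diff_subset_Int finite_Int Int_lower1 card_mono le_add_diff_inverse2 of_nat_add)
      have jJ: "j \<le> k" unfolding j_def k_def using finS by (simp add: card_mono)
      have "j \<le> \<delta> * n" using jJ Jc by (simp add: k_def n_def)
      then have m_lo: "(\<alpha> - 2 * \<delta>) * n \<le> m" using Sc sm by (simp add: algebra_simps)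
      have m_hi: "m \<le> (\<alpha> + \<delta>) * n" using Sc sm by (simp add: j_def)
      have "k = real (card I) + j"
        using finS unfolding k_def I_def j_def
        by (metis card_Diff_subset_Int finite_Int Int_lower1 card_mono le_add_diff_inverse2 of_nat_add Int_commute)
      then have I_lo: "(1 - \<alpha> - \<delta>) * k \<le> card I"
        using Sc by (simp add: algebra_simps)
      have thr: "\<beta> * sqrt s - j \<le> y * sqrt m"
      proof -
        have "\<beta> * sqrt s \<le> \<beta> * (sqrt (\<alpha> + \<delta>) * sqrt n)"
          using Sc \<beta> by (intro mult_left_mono) (auto simp: real_sqrt_mult[symmetric])
        moreover have "(\<alpha> - \<delta>) * (cs * sqrt n) \<le> (\<alpha> - \<delta>) * k"
          using Jl \<delta>(4,7) by (intro mult_left_mono) (auto simp: n_def k_def)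
        then have "(\<alpha> - \<delta>) * (cs * sqrt n) \<le> j" using Sc(3) by linarith
        ultimately have "\<beta> * sqrt s - j \<le> (\<beta> * sqrt (\<alpha> + \<delta>) - (\<alpha> - \<delta>) * cs) * sqrt n"
          by (simp add: algebra_simps)
        also have "\<dots> \<le> y * sqrt m"
        proof (cases "y \<ge> 0")
          case True
          have "(\<beta> * sqrt (\<alpha> + \<delta>) - (\<alpha> - \<delta>) * cs) * sqrt n \<le> y * sqrt (\<alpha> - 2 * \<delta>) * sqrt n"
            using \<delta>(2) n0 by (intro mult_right_mono) auto
          also have "\<dots> = y * sqrt ((\<alpha> - 2 * \<delta>) * n)" by (simp add: real_sqrt_mult)
          also have "\<dots> \<le> y * sqrt m" using m_lo True by (intro mult_left_mono) auto
          finally show ?thesis .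
        next
          case False
          have "(\<beta> * sqrt (\<alpha> + \<delta>) - (\<alpha> - \<delta>) * cs) * sqrt n \<le> y * sqrt (\<alpha> + \<delta>) * sqrt n"
            using \<delta>(3) n0 by (intro mult_right_mono) auto
          also have "\<dots> = y * sqrt ((\<alpha> + \<delta>) * n)" by (simp add: real_sqrt_mult)
          also have "\<dots> \<le> y * sqrt m" using m_hi False by (intro mult_left_mono_neg) auto
          finally show ?thesis .
        qed
        finally show ?thesis .
      qed
      have "m0 \<le> card (S - J)" using m0n m_lo unfolding m_def by linarith
      note bt = m0[OF this]
      have pr: "q - \<delta> \<le> measure_pmf.prob (planted W J) {E. v \<in> survivors \<beta> E S W}" if "v \<in> I" for v
        using that W S J thr unfolding s_def j_def m_def
        by (intro order.trans[OF bt] prob_survives_inside) (auto simp: I_def)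
      have Isub: "I \<subseteq> W - S" using J by (auto simp: I_def)
      have ex: "exp (-2 * \<delta>\<^sup>2 * card I) \<le> exp (- \<gamma> * k)"
      proof -
        have "\<gamma> * k \<le> 2 * \<delta>\<^sup>2 * card I"
          using mult_left_mono[OF I_lo, of "2 * \<delta>\<^sup>2"] by (simp add: \<gamma>_def mult.assoc)
        then show ?thesis by simp
      qed
      have "measure_pmf.prob (planted W J) {E. card (J \<inter> survivors \<beta> E S W) < p * card J}
        \<le> measure_pmf.prob (planted W J) {E. real (card (I \<inter> survivors \<beta> E S W)) \<le> (q - \<delta> - \<delta>) * card I}"
      proof (rule prob_pmf_mono, rule ccontr)
        fix E
        let ?X = "survivors \<beta> E S W"
        assume "\<not> (real (card (I \<inter> ?X)) \<le> (q - \<delta> - \<delta>) * card I)"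
        then have c: "(q - 2 * \<delta>) * card I < card (I \<inter> ?X)" by auto
        assume neg: "card (J \<inter> survivors \<beta> E S W) < p * card J"
        have "card (I \<inter> ?X) \<le> card (J \<inter> ?X)" using finS by (intro card_mono) (auto simp: I_def)
        moreover have "p * k \<le> (q - 2 * \<delta>) * card I"
        proof -
          have "p * k \<le> ((q - 2 * \<delta>) * (1 - \<alpha> - \<delta>)) * k"
            using \<delta>(1) by (intro mult_right_mono) (auto simp: k_def)
          also have "\<dots> \<le> (q - 2 * \<delta>) * card I"
            using mult_left_mono[OF I_lo, of "q - 2 * \<delta>"] \<delta> by (simp add: mult.assoc)
          finally show ?thesis .
        qed
        ultimately show False using c neg unfolding k_def by linarith
      qed
      also have "\<dots> \<le> exp (-2 * \<delta>\<^sup>2 * card I)"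
        using \<delta> pr by (intro survivors_concentration(1) W S Isub) auto
      also note ex
      finally show ?thesis .
    qed
    show "measure_pmf.prob (step_pmf \<alpha> \<beta> W J) {W'. card (J \<inter> W') < p * card J} \<le> 5 * exp (- \<gamma> * card J)"
      using step_prob_bound[where P="\<lambda>W'. card (J \<inter> W') < p * card J", OF main _ bad] by (simp add: k_def)
  qed
qed

section \<open>Anti-concentration of the binomial distribution\<close>

text \<open>A form without square roots of the bound 4^l / sqrt (2 l + 1), suited to induction: one
  step multiplies the left side by 4 (2 l + 1) (2 l + 3) / (l + 1)^2, and (2 l + 1) (2 l + 3) = 4 (l
  + 1)^2 - 1.\<close>

lemma central_binomial_upper: "real ((2 * l) choose l) ^ 2 * (2 * l + 1) \<le> 16 ^ l"
proof (induction l)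
  case (Suc l)
  define C where "C = real ((2 * l) choose l)"
  have "Suc (2 * l + 1) = 2 * Suc l" by simp
  with Suc_times_binomial_eq[of "2 * l + 1" l]
  have "2 * Suc l * ((2 * l + 1) choose l) = ((2 * Suc l) choose Suc l) * Suc l" by metis
  then have "Suc l * ((2 * Suc l) choose Suc l) = Suc l * (2 * ((2 * l + 1) choose l))"
    by (simp only: mult_ac)
  then have 1: "(2 * Suc l) choose Suc l = 2 * ((2 * l + 1) choose l)"
    by (simp only: Suc_mult_cancel1)
  have "Suc (2 * l) = 2 * l + 1" by simp
  with Suc_times_binomial_eq[of "2 * l" l]
  have "Suc l * ((2 * l + 1) choose Suc l) = (2 * l + 1) * ((2 * l) choose l)"
    by (metis mult.commute)
  moreover have "(2 * l + 1) choose Suc l = (2 * l + 1) choose l"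
    by (subst binomial_symmetric) auto
  ultimately have "real (Suc l) * real ((2 * l + 1) choose l) = real (2 * l + 1) * C"
    unfolding C_def by (metis of_nat_mult)
  then have 2: "real ((2 * Suc l) choose Suc l) = 2 * (2 * l + 1) * C / (l + 1)"
    using 1 by (simp add: field_simps)
  have "real ((2 * Suc l) choose Suc l) ^ 2 * (2 * Suc l + 1) =
      (C ^ 2 * (2 * l + 1)) * (4 * ((2 * l + 1) * (2 * l + 3)) / (l + 1) ^ 2)"
    unfolding 2 by (simp add: power_divide power_mult_distrib power2_eq_square algebra_simps)
  also have "\<dots> \<le> 16 ^ l * 16"
  proof (rule mult_mono)
    show "C ^ 2 * (2 * l + 1) \<le> 16 ^ l" using Suc by (simp add: C_def)
    have "4 * ((2 * l + 1) * (2 * l + 3)) \<le> 16 * (l + 1) ^ 2"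
      by (simp add: power2_eq_square algebra_simps)
    then have "real (4 * ((2 * l + 1) * (2 * l + 3))) \<le> real (16 * (l + 1) ^ 2)"
      by (rule of_nat_mono)
    then show "4 * ((2 * l + 1) * (2 * l + 3)) / (l + 1) ^ 2 \<le> (16 :: real)"
      by (simp only: of_nat_mult of_nat_power) (simp add: divide_le_eq)
  qed auto
  finally show ?case by simp
qed simp

text \<open>In an even row the central coefficient is the largest. An odd row reduces to the even
  row before it, since Pascal's rule makes its probabilities averages of two neighboring ones
  there.\<close>

lemma pmf_binomial_half_le:
  assumes "m > 0"
  shows "pmf (binomial_pmf m (1/2)) j \<le> 1 / sqrt m"
proof -
  define l where "l = m div 2"
  have even: "real ((2 * l) choose i) / 4 ^ l \<le> 1 / sqrt (2 * l + 1)" for i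
  proof -
    have "real ((2 * l) choose i) \<le> real ((2 * l) choose l)"
      using binomial_maximum[of "2 * l" i] by simp
    also have "\<dots> \<le> 4 ^ l / sqrt (2 * l + 1)"
    proof -
      have "(real ((2 * l) choose l) * sqrt (2 * l + 1)) ^ 2 \<le> (4 ^ l) ^ 2"
      proof -
        have "((4::real) ^ l)\<^sup>2 = (4\<^sup>2) ^ l"
          by (simp only: power_mult[symmetric] mult.commute)
        then show ?thesis
          using central_binomial_upper[of l] by (simp add: power_mult_distrib)
      qed
      then have "real ((2 * l) choose l) * sqrt (2 * l + 1) \<le> 4 ^ l"
        by (rule power2_le_imp_le) auto
      then show ?thesis by (simp add: field_simps)
    qed
    finally show ?thesis by (simp add: field_simps)
  qed
  have "pmf (binomial_pmf m (1/2)) j = real (m choose j) / 2 ^ m"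
  proof (cases "j \<le> m")
    case True
    then have "(1/2 :: real) ^ j * (1/2) ^ (m - j) = 1 / 2 ^ m"
      by (simp add: power_add[symmetric] power_one_over)
    then show ?thesis by (simp add: field_simps)
  qed (simp add: binomial_eq_0)
  also have "\<dots> \<le> 1 / sqrt (2 * l + 1)"
  proof (cases "even m")
    case True
    then have "m = 2 * l" by (simp add: l_def)
    then show ?thesis using even[of j] by (simp add: power_mult)
  next
    case False
    then have m: "m = Suc (2 * l)" by (simp add: l_def)
    have "real (m choose j) / 2 ^ m \<le> (1 / sqrt (2 * l + 1) + 1 / sqrt (2 * l + 1)) / 2"
    proof (cases j)
      case 0
      have "real (m choose j) / 2 ^ m \<le> real ((2 * l) choose 0) / 4 ^ l"
        using 0 by (simp add: m power_mult frac_le)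
      then show ?thesis using even[of 0] by simp
    next
      case (Suc i)
      then have "real (m choose j) / 2 ^ m = (real ((2 * l) choose i) / 4 ^ l + real ((2 * l) choose Suc i) / 4 ^ l) / 2"
        by (simp add: m power_mult add_divide_distrib)
      then show ?thesis
        by (simp only:) (intro divide_right_mono add_mono even; simp)
    qed
    then show ?thesis by simp
  qed
  also have "\<dots> \<le> 1 / sqrt m"
    using assms by (intro divide_left_mono) (auto simp: l_def)
  finally show ?thesis .
qed

section \<open>Phase 2\<close>

text \<open>Quantifying over every possible choice of \<open>K'\<close> makes this an event of the
  graph alone, whatever the tie-breaking rule.\<close>

definition recovers :: "'a set \<Rightarrow> 'a set \<Rightarrow> nat \<Rightarrow> 'a set set \<Rightarrow> bool" where
  "recovers W J k' F \<longleftrightarrow> (\<forall>K'. K' \<subseteq> W \<longrightarrow> card K' = k' \<longrightarrow>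
     (\<forall>u\<in>K'. \<forall>v\<in>W - K'. deg F W v \<le> deg F W u) \<longrightarrow>
     {v \<in> W. real (deg F K' v) \<ge> 3 * real k' / 4} = J)"

lemma deg_Int_pairs: "S \<subseteq> W \<Longrightarrow> v \<in> W \<Longrightarrow> E \<subseteq> pairs V \<Longrightarrow> deg (E \<inter> pairs W) S v = deg E S v"
  unfolding deg_def by (rule arg_cong[where f=card]) (auto simp: pairs_def)

lemma phase2_eq:
  assumes "recovers W J k' (E \<inter> pairs W)" "selects_largest sel" "finite W" "k' \<le> card W" "E \<subseteq> pairs V"
  shows "phase2 sel E W k' = J"
proof -
  define K' where "K' = sel k' (deg E W) W"
  have K': "K' \<subseteq> W" "card K' = k'" "\<And>u v. u \<in> K' \<Longrightarrow> v \<in> W - K' \<Longrightarrow> deg E W v \<le> deg E W u"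
    using assms unfolding selects_largest_def K'_def by (auto simp: min_absorb1)
  have "{v \<in> W. real (deg (E \<inter> pairs W) K' v) \<ge> 3 * real k' / 4} = J"
    using assms(1) K' unfolding recovers_def
    using deg_Int_pairs[OF subset_refl _ assms(5), of _ W] by (metis (no_types, lifting) DiffD1 subsetD)
  moreover have "deg (E \<inter> pairs W) K' v = deg E K' v" if "v \<in> W" for v
    using deg_Int_pairs[OF K'(1) that assms(5)] .
  ultimately show ?thesis
    unfolding phase2_def Let_def K'_def[symmetric] by auto
qed

lemma deg_remove:
  assumes "finite W" "v \<in> W"
  shows "deg F W u = deg F (W - {v}) u + of_bool ({v, u} \<in> F)"
proof -
  have "{w \<in> W. {w, u} \<in> F} = {w \<in> W - {v}. {w, u} \<in> F} \<union> {w. w = v \<and> {w, u} \<in> F}"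
    using assms by auto
  then have "deg F W u = card ({w \<in> W - {v}. {w, u} \<in> F} \<union> {w. w = v \<and> {w, u} \<in> F})"
    by (simp add: deg_def)
  also have "\<dots> = card {w \<in> W - {v}. {w, u} \<in> F} + card {w. w = v \<and> {w, u} \<in> F}"
    using assms by (intro card_Un_disjoint) auto
  also have "{w. w = v \<and> {w, u} \<in> F} = (if {v, u} \<in> F then {v} else {})" by auto
  finally show ?thesis by (simp add: deg_def)
qed

lemma deg_mono: "finite T \<Longrightarrow> S \<subseteq> T \<Longrightarrow> deg F S v \<le> deg F T v"
  unfolding deg_def by (intro card_mono) auto

lemma deg_Un_le: "finite S \<Longrightarrow> finite T \<Longrightarrow> deg F (S \<union> T) v \<le> deg F S v + card T"
proof -
  assume fin: "finite S" "finite T"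
  have "deg F (S \<union> T) v \<le> card ({u \<in> S. {u, v} \<in> F} \<union> T)"
    unfolding deg_def using fin by (intro card_mono) auto
  also have "\<dots> \<le> deg F S v + card T"
    unfolding deg_def by (rule card_Un_le)
  finally show ?thesis .
qed

lemma deg_le_card: "finite S \<Longrightarrow> deg F S v \<le> card S"
  unfolding deg_def by (intro card_mono) auto

text \<open>Whether \<open>u\<close> is among the \<open>k'\<close> vertices of largest degree depends on the edge from \<open>u\<close> to \<open>v\<close>
  only if the degree of \<open>u\<close> without \<open>v\<close> takes one of two critical values, which is rare.\<close>

lemma recoversI:
  fixes W J :: "'a set"
  assumes W: "finite W" and J: "J \<subseteq> W" and k': "4 \<le> k'" "k' \<le> card J"
    and F: "pairs J \<subseteq> F"
    and dJ: "\<And>u v. u \<in> J \<Longrightarrow> v \<in> W - J \<Longrightarrow> deg F W v < deg F W u"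
    and mass: "\<And>v T. v \<in> W - J \<Longrightarrow> T \<le> card W \<Longrightarrow>
      real (card {u \<in> J. deg F (W - {v}) u = T}) \<le> k' / 50"
    and nb: "\<And>v T. v \<in> W - J \<Longrightarrow> T \<le> card W \<Longrightarrow> card {u \<in> J. T < deg F (W - {v}) u} \<le> k' \<Longrightarrow>
      real (deg F {u \<in> J. T < deg F (W - {v}) u} v) \<le> real (card {u \<in> J. T < deg F (W - {v}) u}) / 2 + k' / 8"
  shows "recovers W J k' F"
  unfolding recovers_def
proof (intro allI impI)
  fix K' assume K': "K' \<subseteq> W" "card K' = k'" and top: "\<forall>u\<in>K'. \<forall>v\<in>W - K'. deg F W v \<le> deg F W u"
  have fin: "finite J" "finite K'" using W J K' finite_subset by auto
  \<comment> \<open>Clique vertices have larger degrees than all others, and there are at least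
    \<open>k'\<close> of them to fill the selection.\<close>
  have K'J: "K' \<subseteq> J"
  proof (rule ccontr)
    assume "\<not> K' \<subseteq> J"
    then obtain v where v: "v \<in> K'" "v \<notin> J" by auto
    have "\<not> J \<subseteq> K'"
    proof
      assume "J \<subseteq> K'"
      then have "J \<subset> K'" using v by auto
      then have "card J < card K'" using fin by (intro psubset_card_mono)
      then show False using K' k' by simp
    qed
    then obtain u where "u \<in> J" "u \<notin> K'" by auto
    moreover have "v \<in> W - J" "u \<in> W - K'" using \<open>u \<in> J\<close> \<open>u \<notin> K'\<close> v K' J by auto
    ultimately show False using bspec[OF bspec[OF top v(1)], of u] dJ[of u v] by linarith
  qed
  \<comment> \<open>A vertex of \<open>K'\<close> is not its own neighbor; \<open>4 \<le> k'\<close>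
    absorbs this loss of one.\<close>
  have "3 * real k' / 4 \<le> deg F K' v" if "v \<in> J" for v
  proof -
    have "{u, v} \<in> F" if "u \<in> K' - {v}" for u
      using that \<open>v \<in> J\<close> K'J by (intro subsetD[OF F]) auto
    then have "K' - {v} \<subseteq> {u \<in> K'. {u, v} \<in> F}" by auto
    then have "card (K' - {v}) \<le> deg F K' v"
      unfolding deg_def using fin by (intro card_mono) auto
    moreover have "card K' - 1 \<le> card (K' - {v})"
      by (simp add: card_Diff_singleton_if)
    ultimately have "real k' - 1 \<le> deg F K' v" using K' by linarith
    then show ?thesis using k' by simp
  qed
  moreover have "deg F K' v < 3 * real k' / 4" if v: "v \<in> W - J" for v
  proof -
    \<comment> \<open>\<open>T\<close> is the least degree in \<open>K'\<close>. The set
      \<open>K'\<close> lies between \<open>A\<close> and \<open>A\<close> enlarged by the clique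
      vertices with \<open>d u\<close> equal to \<open>T\<close> or \<open>T - 1\<close>. Once
      \<open>T\<close> is fixed, these sets are defined without the edges at
      \<open>v\<close>.\<close>
    define T where "T = Min (deg F W ` K')"
    define d where "d = deg F (W - {v})"
    define A where "A = {u \<in> J. T < d u}"
    have ne: "K' \<noteq> {}" using K' k' by auto
    have "T \<in> deg F W ` K'"
      unfolding T_def using ne fin by (intro Min_in) auto
    then obtain w where w: "w \<in> K'" "deg F W w = T" by auto
    have T_le: "T \<le> deg F W u" if "u \<in> K'" for u
      unfolding T_def using that fin by (intro Min_le) auto
    have TW: "T \<le> card W" using w deg_le_card[OF W] by metis
    have dd: "deg F W u = d u + of_bool ({v, u} \<in> F)" for u
      unfolding d_def using v by (intro deg_remove W) auto
    have AK: "A \<subseteq> K'"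
    proof
      fix u assume u: "u \<in> A"
      then have "T < deg F W u" by (simp add: A_def dd)
      moreover have "deg F W u \<le> T" if "u \<notin> K'"
        using bspec[OF bspec[OF top w(1)], of u] that u J w(2) by (auto simp: A_def)
      ultimately show "u \<in> K'" by linarith
    qed
    have "K' \<subseteq> A \<union> ({u \<in> J. d u = T} \<union> {u \<in> J. d u + 1 = T})"
    proof
      fix u assume u: "u \<in> K'"
      then have "T \<le> d u + 1" using T_le[OF u] dd[of u] by (auto split: if_splits simp: of_bool_def)
      then show "u \<in> A \<union> ({u \<in> J. d u = T} \<union> {u \<in> J. d u + 1 = T})"
        using u K'J by (auto simp: A_def)
    qed
    then have "deg F K' v \<le> deg F (A \<union> ({u \<in> J. d u = T} \<union> {u \<in> J. d u + 1 = T})) v"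
      using fin by (intro deg_mono) (auto simp: A_def)
    also have "\<dots> \<le> deg F A v + card ({u \<in> J. d u = T} \<union> {u \<in> J. d u + 1 = T})"
      using fin by (intro deg_Un_le) (auto simp: A_def)
    also have "\<dots> \<le> deg F A v + (card {u \<in> J. d u = T} + card {u \<in> J. d u + 1 = T})"
      by (intro add_left_mono card_Un_le)
    finally have "real (deg F K' v) \<le> deg F A v + (card {u \<in> J. d u = T} + card {u \<in> J. d u + 1 = T})"
      by linarith
    moreover have "real (card {u \<in> J. d u = T}) \<le> k' / 50"
      unfolding d_def by (rule mass[OF v TW])
    moreover have "real (card {u \<in> J. d u + 1 = T}) \<le> k' / 50"
    proof (cases T)
      case (Suc T')
      then show ?thesis using mass[OF v, of T'] TW by (simp add: d_def)
    qed simp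
    moreover have cA: "card A \<le> k'" using AK K' fin card_mono by metis
    moreover have "real (deg F A v) \<le> card A / 2 + k' / 8"
      using nb[OF v TW] cA unfolding A_def d_def by simp
    \<comment> \<open>The total is at most k'/2 + k'/8 + 2 k'/50 = 0.665 k', below three quarters of
      k'.\<close>
    ultimately show ?thesis using k' by simp
  qed
  ultimately show "{v \<in> W. real (deg F K' v) \<ge> 3 * real k' / 4} = J"
    using J by (auto simp: subset_iff not_le[symmetric] simp del: not_le)
qed

lemma prob_random_subset_split:
  assumes "finite A" "finite B" "A \<inter> B = {}"
    and "\<And>X. X \<subseteq> A \<Longrightarrow> measure_pmf.prob (random_subset p B) {Y. Q (X \<union> Y)} \<le> b"
  shows "measure_pmf.prob (random_subset p (A \<union> B)) {R. Q R} \<le> b"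
proof -
  have "random_subset p (A \<union> B) = random_subset p A \<bind> (\<lambda>X. map_pmf (\<lambda>Y. X \<union> Y) (random_subset p B))"
    by (simp add: random_subset_Un[OF assms(1-3)] map_pmf_def)
  then show ?thesis
    using assms(4) by (auto intro!: prob_bind_pmf_le simp: vimage_def dest!: set_random_subset)
qed

text \<open>Estimates the failure of each hypothesis of \<open>recoversI\<close>. The critical
  degree there depends on the whole graph, so the statements about it are made uniform over all
  pairs of an outside vertex and a possible value \<open>T\<close>, at the price of a quadratic
  factor.\<close>

lemma recovers_prob:
  fixes W J :: "'a set"
  assumes W: "finite W" and J: "J \<subseteq> W" and k': "4 \<le> k'" "k' \<le> card J"
    and m: "card J + 1 < card W" and D: "card J / sqrt (real (card W) - card J - 1) \<le> k' / 100"
  shows "measure_pmf.prob (planted W J) {F. \<not> recovers W J k' F} \<le>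
    2 * card W * exp (- (real (card J))\<^sup>2 / (32 * real (card W))) +
    (card W * (card W + 1)) * (exp (- (real k')\<^sup>2 / (5000 * real (card J))) + exp (- real k' / 32))"
proof -
  define N where "N = card W"
  define \<kappa> where "\<kappa> = card J"
  define P where "P = pairs W - pairs J"
  define M where "M = random_subset (1/2) P"
  define F where "F R = pairs J \<union> R" for R
  \<comment> \<open>The mean degree is \<open>(N - 1) / 2\<close> outside the clique and larger by
    \<open>(\<kappa> - 1) / 2\<close> inside. As \<open>4 \<le> \<kappa>\<close>, both means are at
    distance at least \<open>\<kappa> / 8\<close> from \<open>thr\<close>.\<close>
  define thr where "thr = (real N - 1) / 2 + \<kappa> / 8"
  define D where "D v T R = {u \<in> J. deg (F R) (W - {v}) u = T}" for v T R
  define A where "A v T R = {u \<in> J. T < deg (F R) (W - {v}) u}" for v T R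
  have fin: "finite J" "finite P" using W J finite_subset by (auto simp: P_def finite_pairs)
  have N: "\<kappa> + 1 < N" "4 \<le> \<kappa>" using m k' by (auto simp: N_def \<kappa>_def)
  have cWJ: "card (W - J) = N - \<kappa>" using J fin by (simp add: card_Diff_subset N_def \<kappa>_def)
  have in_deg: "deg (F R) S u = card (S \<inter> J - {u}) + card (R \<inter> star (S - J) u)"
    if "R \<subseteq> P" "u \<in> J" "S \<subseteq> W" for R S u
    unfolding F_def using that W by (intro deg_planted_inside) (auto simp: P_def pairs_def finite_subset)
  have out_deg: "deg (F R) S v = card (R \<inter> star S v)" if "v \<in> W - J" for R S v
    unfolding F_def using that by (intro deg_planted_outside) auto
  have ex: "exp (-2 * (\<kappa> / 8)\<^sup>2 / x) \<le> exp (- (real \<kappa>)\<^sup>2 / (32 * real N))" if "0 < x" "x \<le> N" for x :: real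
    using that by (simp add: power_divide frac_le)
  have 1: "measure_pmf.prob M {R. \<exists>u\<in>J. real (deg (F R) W u) \<le> thr} \<le> N * exp (- (real \<kappa>)\<^sup>2 / (32 * real N))"
  proof -
    have "measure_pmf.prob M {R. \<exists>u\<in>J. real (deg (F R) W u) \<le> thr} \<le> card J * exp (- (real \<kappa>)\<^sup>2 / (32 * real N))"
    proof (rule prob_pmf_Bex_le[OF fin(1)])
      fix u assume u: "u \<in> J"
      have "measure_pmf.prob M {R. real (deg (F R) W u) \<le> thr}
          \<le> measure_pmf.prob M {R. real (card (R \<inter> star (W - J) u)) \<le> card (star (W - J) u) * (1/2) - \<kappa> / 8}"
        unfolding M_def
      proof (rule prob_pmf_mono)
        fix R assume "R \<in> set_pmf (random_subset (1/2) P)" and *: "real (deg (F R) W u) \<le> thr"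
        then have "deg (F R) W u = card (W \<inter> J - {u}) + card (R \<inter> star (W - J) u)"
          using u by (intro in_deg) (auto dest: set_random_subset)
        moreover have "card (W \<inter> J - {u}) = \<kappa> - 1"
          using u J fin by (simp add: Int_absorb1 \<kappa>_def)
        ultimately have "real (deg (F R) W u) = real \<kappa> - 1 + card (R \<inter> star (W - J) u)"
          using N by (simp add: of_nat_diff)
        then show "real (card (R \<inter> star (W - J) u)) \<le> card (star (W - J) u) * (1/2) - \<kappa> / 8"
          using * N by (simp add: thr_def cWJ of_nat_diff field_simps)
      qed
      also have "\<dots> \<le> exp (-2 * (\<kappa> / 8)\<^sup>2 / card (star (W - J) u))"
        unfolding M_def P_def using W u J
        by (intro Hoeffding_card_Int(2)) (auto simp: finite_pairs star_def)
      also have "\<dots> \<le> exp (- (real \<kappa>)\<^sup>2 / (32 * real N))"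
        using N by (intro ex) (auto simp: cWJ)
      finally show "measure_pmf.prob M {R. real (deg (F R) W u) \<le> thr} \<le> exp (- (real \<kappa>)\<^sup>2 / (32 * real N))" .
    qed
    also have "\<dots> \<le> N * exp (- (real \<kappa>)\<^sup>2 / (32 * real N))"
      using N by (intro mult_right_mono) (auto simp: \<kappa>_def)
    finally show ?thesis .
  qed
  have 2: "measure_pmf.prob M {R. \<exists>v\<in>W - J. real (deg (F R) W v) \<ge> thr} \<le> N * exp (- (real \<kappa>)\<^sup>2 / (32 * real N))"
  proof -
    have "measure_pmf.prob M {R. \<exists>v\<in>W - J. real (deg (F R) W v) \<ge> thr} \<le> card (W - J) * exp (- (real \<kappa>)\<^sup>2 / (32 * real N))"
    proof (rule prob_pmf_Bex_le)
      show "finite (W - J)" using W by simp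
      fix v assume v: "v \<in> W - J"
      have "measure_pmf.prob M {R. real (deg (F R) W v) \<ge> thr}
          \<le> measure_pmf.prob M {R. real (card (R \<inter> star (W - {v}) v)) \<ge> card (star (W - {v}) v) * (1/2) + \<kappa> / 8}"
        unfolding M_def
      proof (rule prob_pmf_mono)
        fix R assume "R \<in> set_pmf (random_subset (1/2) P)" and *: "real (deg (F R) W v) \<ge> thr"
        then have R: "R \<subseteq> P" by (auto dest: set_random_subset)
        then have "R \<inter> star W v = R \<inter> star (W - {v}) v" by (auto simp: star_def P_def pairs_def)
        then have "deg (F R) W v = card (R \<inter> star (W - {v}) v)" using out_deg[OF v] by simp
        moreover have "real (card (W - {v})) = real N - 1" using v W N by (simp add: N_def of_nat_diff)
        ultimately show "real (card (R \<inter> star (W - {v}) v)) \<ge> card (star (W - {v}) v) * (1/2) + \<kappa> / 8"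
          using * by (simp add: thr_def)
      qed
      also have "\<dots> \<le> exp (-2 * (\<kappa> / 8)\<^sup>2 / card (star (W - {v}) v))"
        unfolding M_def P_def using W v J
        by (intro Hoeffding_card_Int(1) star_subset_non_clique) (auto simp: finite_pairs)
      also have "\<dots> \<le> exp (- (real \<kappa>)\<^sup>2 / (32 * real N))"
        using N v W by (intro ex) (auto simp: N_def)
      finally show "measure_pmf.prob M {R. real (deg (F R) W v) \<ge> thr} \<le> exp (- (real \<kappa>)\<^sup>2 / (32 * real N))" .
    qed
    also have "\<dots> \<le> N * exp (- (real \<kappa>)\<^sup>2 / (32 * real N))"
      using N by (intro mult_right_mono) (auto simp: cWJ)
    finally show ?thesis .
  qed
  define I where "I = (W - J) \<times> {..N}"
  have finI: "finite I" using W by (simp add: I_def)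
  have cI: "card I \<le> N * (N + 1)" unfolding I_def card_cartesian_product cWJ by (intro mult_le_mono) auto
  have 3: "measure_pmf.prob M {R. \<exists>(v, T)\<in>I. real (card (D v T R)) > k' / 50} \<le> N * (N + 1) * exp (- (real k')\<^sup>2 / (5000 * real \<kappa>))"
  proof -
    have "measure_pmf.prob M {R. \<exists>i\<in>I. real (card (D (fst i) (snd i) R)) > k' / 50} \<le> card I * exp (- (real k')\<^sup>2 / (5000 * real \<kappa>))"
    proof (rule prob_pmf_Bex_le[OF finI])
      fix i assume i: "i \<in> I"
      define v T where "v = fst i" and "T = snd i"
      have v: "v \<in> W - J" using i by (auto simp: I_def v_def)
      define S where "S = W - J - {v}"
      define Ev where "Ev u R \<longleftrightarrow> deg (F R) (W - {v}) u = T" for u R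
      have cS: "card S = N - \<kappa> - 1" using v W by (simp add: S_def cWJ)
      have dS: "deg (F R) (W - {v}) u = \<kappa> - 1 + card (R \<inter> star S u)" if "u \<in> J" "R \<subseteq> P" for u R
      proof -
        have "(W - {v}) \<inter> J - {u} = J - {u}" using v J by auto
        moreover have "W - {v} - J = S" by (auto simp: S_def)
        ultimately show ?thesis using in_deg[OF that(2,1), of "W - {v}"] that fin by (simp add: \<kappa>_def)
      qed
      have starP: "star S u \<subseteq> P" if "u \<in> J" for u
        unfolding P_def using that J by (intro star_subset_non_clique) (auto simp: S_def)
      define \<mu> where "\<mu> = (\<Sum>u\<in>J. measure_pmf.prob M {R. Ev u R})"
      have "measure_pmf.prob M {R. Ev u R} \<le> 1 / sqrt (real N - \<kappa> - 1)" if u: "u \<in> J" for u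
      proof -
        \<comment> \<open>For \<open>T < \<kappa> - 1\<close> the left event is impossible, so the
          truncated subtraction does no harm to the inclusion.\<close>
        have "measure_pmf.prob M {R. Ev u R} \<le> measure_pmf.prob M {R. card (R \<inter> star S u) = T - (\<kappa> - 1)}"
          unfolding M_def by (rule prob_pmf_mono) (use u in \<open>auto simp: Ev_def dS dest: set_random_subset\<close>)
        also have "\<dots> = measure_pmf.prob (binomial_pmf (card S) (1/2)) {j. j = T - (\<kappa> - 1)}"
          unfolding M_def using fin starP[OF u] by (subst prob_card_Int_random_subset) auto
        also have "\<dots> = pmf (binomial_pmf (card S) (1/2)) (T - (\<kappa> - 1))"
          by (simp add: measure_pmf_single)
        also have "\<dots> \<le> 1 / sqrt (card S)" using N by (intro pmf_binomial_half_le) (simp add: cS)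
        also have "real (card S) = real N - \<kappa> - 1" using N by (simp add: cS of_nat_diff)
        finally show ?thesis .
      qed
      then have "\<mu> \<le> real \<kappa> * (1 / sqrt (real N - \<kappa> - 1))"
        unfolding \<mu>_def \<kappa>_def by (intro sum_bounded_above) auto
      also have "\<dots> = card J / sqrt (real (card W) - card J - 1)" by (simp add: N_def \<kappa>_def)
      also note D
      \<comment> \<open>Half of the allowance \<open>k' / 50\<close> goes to the mean and half to
        the Hoeffding deviation; the latter gives the constant 5000 = 100^2 / 2.\<close>
      finally have mu: "\<mu> \<le> k' / 100" .
      have "measure_pmf.prob M {R. real (card (D v T R)) > k' / 50} \<le>
          measure_pmf.prob M {R. real (card {u \<in> J. Ev u R}) \<ge> \<mu> + k' / 100}"
        by (rule prob_pmf_mono) (use mu in \<open>auto simp: D_def Ev_def\<close>)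
      also have "\<dots> \<le> exp (-2 * (k' / 100)\<^sup>2 / card J)"
        unfolding M_def \<mu>_def
      proof (rule Hoeffding_random_subset(1)[OF fin(2,1), where B="star S"])
        show "disjoint_family_on (star S) J" by (intro disjoint_star) (auto simp: S_def)
        show "Ev u R \<longleftrightarrow> Ev u (R \<inter> star S u)" if "u \<in> J" "R \<subseteq> P" for u R
          using dS[OF that] dS[OF that(1) le_infI1[OF that(2)], of "star S u"]
          by (simp add: Ev_def Int_assoc)
      qed (use starP in auto)
      also have "-2 * (k' / 100)\<^sup>2 / card J = - (real k')\<^sup>2 / (5000 * real \<kappa>)"
        by (simp add: \<kappa>_def power_divide)
      finally show "measure_pmf.prob M {R. real (card (D (fst i) (snd i) R)) > k' / 50} \<le> exp (- (real k')\<^sup>2 / (5000 * real \<kappa>))"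
        by (simp add: v_def T_def)
    qed
    also have "\<dots> \<le> (N * (N + 1)) * exp (- (real k')\<^sup>2 / (5000 * real \<kappa>))"
      using cI by (intro mult_right_mono of_nat_mono) auto
    finally show ?thesis by (simp add: case_prod_unfold)
  qed
  have 4: "measure_pmf.prob M {R. \<exists>(v, T)\<in>I. card (A v T R) \<le> k' \<and>
      real (deg (F R) (A v T R) v) > card (A v T R) / 2 + k' / 8} \<le> N * (N + 1) * exp (- real k' / 32)"
  proof -
    have "measure_pmf.prob M {R. \<exists>i\<in>I. card (A (fst i) (snd i) R) \<le> k' \<and>
      real (deg (F R) (A (fst i) (snd i) R) (fst i)) > card (A (fst i) (snd i) R) / 2 + k' / 8} \<le> card I * exp (- real k' / 32)"
    proof (rule prob_pmf_Bex_le[OF finI])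
      fix i assume i: "i \<in> I"
      define v T where "v = fst i" and "T = snd i"
      have v: "v \<in> W - J" using i by (auto simp: I_def v_def)
      have sJ: "star J v \<subseteq> P" unfolding P_def using v J by (intro star_subset_non_clique) auto
      \<comment> \<open>The edges between \<open>v\<close> and \<open>J\<close> are held back. The
        other edges already determine \<open>A v T\<close>, because degrees in
        \<open>W - {v}\<close> ignore \<open>v\<close>; the held-back edges then give
        \<open>v\<close> a binomial degree into a fixed set.\<close>
      then have P: "P = (P - star J v) \<union> star J v" by auto
      have "measure_pmf.prob (random_subset (1/2) ((P - star J v) \<union> star J v)) {R. card (A v T R) \<le> k' \<and>
          real (deg (F R) (A v T R) v) > card (A v T R) / 2 + k' / 8} \<le> exp (- real k' / 32)"
      proof (rule prob_random_subset_split)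
        fix X assume X: "X \<subseteq> P - star J v"
        define B where "B = A v T X"
        have BJ: "B \<subseteq> J" by (auto simp: B_def A_def)
        have AB: "A v T (X \<union> Y) = B" if "Y \<subseteq> star J v" for Y
        proof -
          have "deg (F (X \<union> Y)) (W - {v}) u = deg (F X) (W - {v}) u" if u: "u \<in> J" for u
          proof -
            have "{w, u} \<notin> Y" if "w \<in> W - {v}" for w
              using that u \<open>Y \<subseteq> star J v\<close> v by (auto simp: star_def doubleton_eq_iff)
            then show ?thesis unfolding deg_def F_def by (intro arg_cong[where f=card]) auto
          qed
          then show ?thesis by (auto simp: B_def A_def)
        qed
        have dB: "deg (F (X \<union> Y)) B v = card (Y \<inter> star B v)" if "Y \<subseteq> star J v" for Y
        proof -
          have "star B v \<subseteq> star J v" using BJ by (auto simp: star_def)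
          then have "(X \<union> Y) \<inter> star B v = Y \<inter> star B v" using X by auto
          then show ?thesis using out_deg[OF v] by simp
        qed
        have "measure_pmf.prob (random_subset (1/2) (star J v)) {Y. card (A v T (X \<union> Y)) \<le> k' \<and>
          real (deg (F (X \<union> Y)) (A v T (X \<union> Y)) v) > card (A v T (X \<union> Y)) / 2 + k' / 8} \<le>
          measure_pmf.prob (random_subset (1/2) (star J v)) {Y. card B \<le> k' \<and> real (card (Y \<inter> star B v)) > card B / 2 + k' / 8}"
          by (rule prob_pmf_mono) (auto dest!: set_random_subset simp: AB dB)
        also have "\<dots> \<le> exp (- real k' / 32)"
        proof (cases "0 < card B \<and> card B \<le> k'")
          case True
          have "measure_pmf.prob (random_subset (1/2) (star J v)) {Y. card B \<le> k' \<and> real (card (Y \<inter> star B v)) > card B / 2 + k' / 8}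
            \<le> measure_pmf.prob (random_subset (1/2) (star J v)) {Y. real (card (Y \<inter> star B v)) \<ge> card (star B v) * (1/2) + k' / 8}"
            by (rule prob_pmf_mono) auto
          also have "\<dots> \<le> exp (-2 * (k' / 8)\<^sup>2 / card (star B v))"
            using fin BJ by (intro Hoeffding_card_Int(1)) (auto simp: star_def)
          also have "\<dots> \<le> exp (- real k' / 32)"
          proof -
            \<comment> \<open>The restriction \<open>card B \<le> k'\<close> makes the exponent
              linear in \<open>k'\<close>.\<close>
            have "real k' / 32 \<le> 2 * (k' / 8)\<^sup>2 / card B"
              using True by (simp add: power2_eq_square field_simps mult_left_mono)
            then show ?thesis by simp
          qed
          finally show ?thesis .
        next
          case False
          have "finite B" using BJ fin finite_subset by auto
          then have e: "{Y. card B \<le> k' \<and> real (card (Y \<inter> star B v)) > card B / 2 + k' / 8} = {}"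
            using False k' by (auto simp: star_def)
          show ?thesis unfolding e by simp
        qed
        finally show "measure_pmf.prob (random_subset (1/2) (star J v)) {Y. card (A v T (X \<union> Y)) \<le> k' \<and>
          real (deg (F (X \<union> Y)) (A v T (X \<union> Y)) v) > card (A v T (X \<union> Y)) / 2 + k' / 8} \<le> exp (- real k' / 32)" .
      qed (use fin in auto)
      then show "measure_pmf.prob M {R. card (A (fst i) (snd i) R) \<le> k' \<and>
        real (deg (F R) (A (fst i) (snd i) R) (fst i)) > card (A (fst i) (snd i) R) / 2 + k' / 8} \<le> exp (- real k' / 32)"
        unfolding M_def v_def[symmetric] T_def[symmetric] P[symmetric] .
    qed
    also have "\<dots> \<le> (N * (N + 1)) * exp (- real k' / 32)"
      using cI by (intro mult_right_mono of_nat_mono) auto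
    finally show ?thesis by (simp add: case_prod_unfold)
  qed
  have "measure_pmf.prob (planted W J) {F. \<not> recovers W J k' F} = measure_pmf.prob M {R. \<not> recovers W J k' (F R)}"
    by (simp add: planted_def M_def P_def F_def vimage_def)
  also have "\<dots> \<le> measure_pmf.prob M {R. ((\<exists>u\<in>J. real (deg (F R) W u) \<le> thr) \<or>
      (\<exists>v\<in>W - J. real (deg (F R) W v) \<ge> thr)) \<or> ((\<exists>(v, T)\<in>I. real (card (D v T R)) > k' / 50) \<or>
      (\<exists>(v, T)\<in>I. card (A v T R) \<le> k' \<and> real (deg (F R) (A v T R) v) > card (A v T R) / 2 + k' / 8))}"
  proof (rule prob_pmf_mono, rule ccontr, erule notE)
    fix R
    assume "\<not> (((\<exists>u\<in>J. real (deg (F R) W u) \<le> thr) \<or>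
      (\<exists>v\<in>W - J. real (deg (F R) W v) \<ge> thr)) \<or> ((\<exists>(v, T)\<in>I. real (card (D v T R)) > k' / 50) \<or>
      (\<exists>(v, T)\<in>I. card (A v T R) \<le> k' \<and> real (deg (F R) (A v T R) v) > card (A v T R) / 2 + k' / 8)))"
    then have h: "\<And>u. u \<in> J \<Longrightarrow> real (deg (F R) W u) > thr" "\<And>v. v \<in> W - J \<Longrightarrow> real (deg (F R) W v) < thr"
      "\<And>v T. (v, T) \<in> I \<Longrightarrow> real (card (D v T R)) \<le> k' / 50"
      "\<And>v T. (v, T) \<in> I \<Longrightarrow> card (A v T R) \<le> k' \<Longrightarrow> real (deg (F R) (A v T R) v) \<le> card (A v T R) / 2 + k' / 8"
      by (auto simp: not_le not_less)
    show "recovers W J k' (F R)"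
    proof (rule recoversI[OF W J k'])
      show "deg (F R) W v < deg (F R) W u" if "u \<in> J" "v \<in> W - J" for u v
        using h(1)[OF that(1)] h(2)[OF that(2)] by linarith
      show "real (card {u \<in> J. deg (F R) (W - {v}) u = T}) \<le> k' / 50" if "v \<in> W - J" "T \<le> card W" for v T
        using h(3)[of v T] that by (simp add: I_def N_def D_def)
      show "real (deg (F R) {u \<in> J. T < deg (F R) (W - {v}) u} v) \<le> real (card {u \<in> J. T < deg (F R) (W - {v}) u}) / 2 + k' / 8"
        if "v \<in> W - J" "T \<le> card W" "card {u \<in> J. T < deg (F R) (W - {v}) u} \<le> k'" for v T
        using h(4)[of v T] that by (simp add: I_def N_def A_def)
    qed (auto simp: F_def)
  qed
  also have "\<dots> \<le> (N * exp (- (real \<kappa>)\<^sup>2 / (32 * real N)) + N * exp (- (real \<kappa>)\<^sup>2 / (32 * real N))) +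
      (N * (N + 1) * exp (- (real k')\<^sup>2 / (5000 * real \<kappa>)) + N * (N + 1) * exp (- real k' / 32))"
    by (intro order.trans[OF prob_pmf_disj] add_mono 1 2 3 4)
  finally show ?thesis by (simp add: N_def \<kappa>_def algebra_simps)
qed

section \<open>Phase 3\<close>

text \<open>The first clause keeps the degrees of outsiders into the clique low; the second limits
  how many outsiders Phase 3 can admit. Both concern the original graph, so no conditioning on what
  the earlier phases inspected is involved.\<close>

definition expands :: "'a set \<Rightarrow> 'a set \<Rightarrow> nat \<Rightarrow> nat \<Rightarrow> 'a set set \<Rightarrow> bool" where
  "expands V K s l E \<longleftrightarrow> (\<forall>v\<in>V - K. real (deg E K v) \<le> 3 * real (card K) / 4) \<and>
     (\<forall>L\<subseteq>K. s \<le> card L \<longrightarrow> card {v \<in> V - K. \<forall>u\<in>L. {u, v} \<in> E} < l)"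

text \<open>An outsider in the final graph has fewer than 3/4 + 1/8 = 7/8 of \<open>card K\<close>
  neighbors, while a clique vertex has at least \<open>card K - 1\<close>. The comparison 7/8 x < x
  - 1 is where \<open>8 < card K\<close> enters.\<close>

lemma phase3_eq:
  assumes V: "finite V" "K \<subseteq> V" and ex: "expands V K s l E" and L: "L \<subseteq> K" "s \<le> card L"
    and sel: "selects_largest sel" and E: "pairs K \<subseteq> E" "E \<subseteq> pairs V"
    and l: "8 * l \<le> card K" and k: "8 < card K"
  shows "phase3 sel E V L (card K) = K"
proof -
  define V' where "V' = L \<union> {v \<in> V. \<forall>u\<in>L. {u, v} \<in> E}"
  define X where "X = sel (card K) (deg E V') V'"
  have fK: "finite K" using V finite_subset by auto
  have fV': "finite V'" using V L fK finite_subset[of L K] by (auto simp: V'_def)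
  have KV': "K \<subseteq> V'"
  proof
    fix v assume v: "v \<in> K"
    show "v \<in> V'"
    proof (cases "v \<in> L")
      case False
      have "{u, v} \<in> E" if "u \<in> L" for u
        using that v L False by (intro subsetD[OF E(1)]) auto
      then show ?thesis using v V by (auto simp: V'_def)
    qed (simp add: V'_def)
  qed
  have cV': "card K \<le> card V'" using fV' KV' by (rule card_mono)
  have X: "X \<subseteq> V'" "card X = card K" "\<And>u v. u \<in> X \<Longrightarrow> v \<in> V' - X \<Longrightarrow> deg E V' v \<le> deg E V' u"
    using sel fV' cV' unfolding selects_largest_def X_def by (auto simp: min_absorb1)
  have lo: "real (card K) - 1 \<le> deg E V' u" if "u \<in> K" for u
  proof -
    have "{w, u} \<in> E" if "w \<in> K - {u}" for w
      using that \<open>u \<in> K\<close> by (intro subsetD[OF E(1)]) auto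
    then have "card (K - {u}) \<le> deg E V' u"
      unfolding deg_def using fV' KV' by (intro card_mono) auto
    then show ?thesis using that fK by simp
  qed
  have hi: "deg E V' v < real (card K) - 1" if v: "v \<in> V' - K" for v
  proof -
    have "V' - K \<subseteq> {v \<in> V - K. \<forall>u\<in>L. {u, v} \<in> E}" using L by (auto simp: V'_def)
    then have "card (V' - K) \<le> card {v \<in> V - K. \<forall>u\<in>L. {u, v} \<in> E}" using V by (intro card_mono) auto
    also have "\<dots> < l" using ex L by (auto simp: expands_def)
    finally have 1: "card (V' - K) < l" .
    have "V' = K \<union> (V' - K)" using KV' by auto
    then have "deg E V' v \<le> deg E K v + card (V' - K)"
      using deg_Un_le[of K "V' - K" E v] fK fV' by simp
    then have "real (deg E V' v) \<le> deg E K v + card (V' - K)" by linarith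
    moreover have "v \<in> V - K" using v L V by (auto simp: V'_def)
    then have "real (deg E K v) \<le> 3 * real (card K) / 4" using ex by (auto simp: expands_def)
    moreover have "8 * real l \<le> card K" using l by linarith
    ultimately show ?thesis using 1 k by linarith
  qed
  have "X \<subseteq> K"
  proof (rule ccontr)
    assume "\<not> X \<subseteq> K"
    then obtain v where v: "v \<in> X" "v \<notin> K" by auto
    have "\<not> K \<subseteq> X"
    proof
      assume "K \<subseteq> X"
      then have "K \<subset> X" using v by auto
      then have "card K < card X" using X(1) fV' finite_subset by (metis psubset_card_mono)
      then show False using X by simp
    qed
    then obtain u where u: "u \<in> K" "u \<notin> X" by auto
    have "deg E V' u \<le> deg E V' v" using X(3)[of v u] u v KV' by auto
    then show False using lo[OF u(1)] hi[of v] v X(1) by auto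
  qed
  then have "X = K" using X(2) fK by (simp add: card_subset_eq)
  then show ?thesis by (simp add: phase3_def V'_def[symmetric] X_def)
qed

lemma prob_all_edges:
  assumes "finite P" "X \<subseteq> P"
  shows "measure_pmf.prob (random_subset (1/2) P) {R. X \<subseteq> R} = (1/2) ^ card X"
proof -
  have fX: "finite X" using assms finite_subset by auto
  have "measure_pmf.prob (random_subset (1/2) P) {R. X \<subseteq> R} =
      measure_pmf.prob (random_subset (1/2) P) {R. card (R \<inter> X) = card X}"
  proof (rule arg_cong2[where f=measure], rule refl, rule Collect_cong)
    fix R show "X \<subseteq> R \<longleftrightarrow> card (R \<inter> X) = card X"
      using fX by (metis Int_absorb1 Int_lower2 card_subset_eq inf.absorb_iff2)
  qed
  also have "\<dots> = pmf (binomial_pmf (card X) (1/2)) (card X)"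
    using assms by (subst prob_card_Int_random_subset) (auto simp: measure_pmf_single)
  finally show ?thesis by simp
qed

text \<open>There are at most \<open>2 ^ card K\<close> choices of \<open>L\<close> and
  \<open>card V ^ l\<close> choices of \<open>l\<close> outsiders, and disjoint stars make the
  presence of all edges between them as unlikely as \<open>(1/2) ^ (card L * l)\<close>. With
  \<open>l\<close> proportional to \<open>card K\<close>, this wins once \<open>s\<close> is
  somewhat larger than log n.\<close>

lemma expands_prob:
  assumes V: "finite V" "K \<subseteq> V"
  shows "measure_pmf.prob (planted V K) {E. \<not> expands V K s l E} \<le>
    card V * exp (- real (card K) / 8) + 2 ^ card K * real (card V) ^ l * (1/2) ^ (s * l)"
proof -
  define k where "k = card K"
  define P where "P = pairs V - pairs K"
  define M where "M = random_subset (1/2) P"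
  define F where "F R = pairs K \<union> R" for R
  have fin: "finite K" "finite P" using V finite_subset by (auto simp: P_def finite_pairs)
  have 1: "measure_pmf.prob M {R. \<exists>v\<in>V - K. real (deg (F R) K v) > 3 * real k / 4} \<le> card V * exp (- real k / 8)"
  proof -
    have "measure_pmf.prob M {R. \<exists>v\<in>V - K. real (deg (F R) K v) > 3 * real k / 4} \<le> card (V - K) * exp (- real k / 8)"
    proof (rule prob_pmf_Bex_le)
      fix v assume v: "v \<in> V - K"
      have "measure_pmf.prob M {R. real (deg (F R) K v) > 3 * real k / 4}
          \<le> measure_pmf.prob M {R. real (card (R \<inter> star K v)) \<ge> card (star K v) * (1/2) + k / 4}"
        by (rule prob_pmf_mono) (use v in \<open>auto simp: F_def deg_planted_outside k_def\<close>)
      also have "\<dots> \<le> exp (-2 * (k / 4)\<^sup>2 / card (star K v))"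
        unfolding M_def using fin v V
        by (intro Hoeffding_card_Int(1)) (auto simp: P_def star_def)
      also have "-2 * (k / 4)\<^sup>2 / card (star K v) = - real k / 8"
        by (simp add: k_def power2_eq_square)
      finally show "measure_pmf.prob M {R. real (deg (F R) K v) > 3 * real k / 4} \<le> exp (- real k / 8)" .
    qed (use V in auto)
    also have "\<dots> \<le> card V * exp (- real k / 8)"
      using V by (intro mult_right_mono) (auto intro: card_mono)
    finally show ?thesis .
  qed
  define I where "I = Pow K \<times> {B. B \<subseteq> V - K \<and> card B = l}"
  have finI: "finite I" using V fin by (auto simp: I_def)
  have "card I = 2 ^ k * (card (V - K) choose l)"
    using V fin by (simp add: I_def card_cartesian_product card_Pow n_subsets k_def)
  also have "\<dots> \<le> 2 ^ k * card V ^ l"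
  proof (intro mult_left_mono)
    have "card (V - K) choose l \<le> card (V - K) ^ l"
      by (cases "l \<le> card (V - K)") (auto intro: binomial_le_pow simp: binomial_eq_0)
    also have "\<dots> \<le> card V ^ l" using V by (intro power_mono card_mono) auto
    finally show "card (V - K) choose l \<le> card V ^ l" .
  qed auto
  finally have cI: "card I \<le> 2 ^ k * card V ^ l" .
  have 2: "measure_pmf.prob M {R. \<exists>(L, B)\<in>I. s \<le> card L \<and> (\<Union>v\<in>B. star L v) \<subseteq> R}
      \<le> 2 ^ k * real (card V) ^ l * (1/2) ^ (s * l)"
  proof -
    have "measure_pmf.prob M {R. \<exists>i\<in>I. s \<le> card (fst i) \<and> (\<Union>v\<in>snd i. star (fst i) v) \<subseteq> R} \<le> card I * (1/2) ^ (s * l)"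
    proof (rule prob_pmf_Bex_le[OF finI])
      fix i assume i: "i \<in> I"
      define L B where "L = fst i" and "B = snd i"
      have LB: "L \<subseteq> K" "B \<subseteq> V - K" "card B = l" using i by (auto simp: I_def L_def B_def)
      have fLB: "finite L" "finite B" using LB fin V finite_subset by (auto intro: finite_subset[of B "V - K"])
      have sub: "(\<Union>v\<in>B. star L v) \<subseteq> P"
      proof (intro UN_least)
        fix v assume "v \<in> B"
        then have "v \<in> V" "v \<notin> K" "v \<notin> L" "L \<subseteq> V" using LB V by auto
        then show "star L v \<subseteq> P" unfolding P_def by (intro star_subset_non_clique) auto
      qed
      have "card (\<Union>v\<in>B. star L v) = (\<Sum>v\<in>B. card (star L v))"
        using fLB LB disjoint_star[of B L]
        by (intro card_UN_disjoint) (auto simp: disjoint_family_on_def)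
      then have c: "card (\<Union>v\<in>B. star L v) = card L * l" using LB by simp
      show "measure_pmf.prob M {R. s \<le> card (fst i) \<and> (\<Union>v\<in>snd i. star (fst i) v) \<subseteq> R} \<le> (1/2) ^ (s * l)"
        unfolding L_def[symmetric] B_def[symmetric]
      proof (cases "s \<le> card L")
        case True
        have "measure_pmf.prob M {R. s \<le> card L \<and> (\<Union>v\<in>B. star L v) \<subseteq> R} = (1/2) ^ (card L * l)"
          using prob_all_edges[OF fin(2) sub] True by (simp add: M_def c)
        also have "\<dots> \<le> (1/2) ^ (s * l)" using True by (intro power_decreasing) auto
        finally show "measure_pmf.prob M {R. s \<le> card L \<and> (\<Union>v\<in>B. star L v) \<subseteq> R} \<le> (1/2) ^ (s * l)" .
      qed simp
    qed
    also have "\<dots> \<le> real (2 ^ k * card V ^ l) * (1/2) ^ (s * l)"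
      using cI by (intro mult_right_mono of_nat_mono) auto
    finally show ?thesis by (simp add: case_prod_unfold)
  qed
  have "measure_pmf.prob (planted V K) {E. \<not> expands V K s l E} = measure_pmf.prob M {R. \<not> expands V K s l (F R)}"
    by (simp add: planted_def M_def P_def F_def vimage_def)
  also have "\<dots> \<le> measure_pmf.prob M {R. (\<exists>v\<in>V - K. real (deg (F R) K v) > 3 * real k / 4) \<or>
      (\<exists>(L, B)\<in>I. s \<le> card L \<and> (\<Union>v\<in>B. star L v) \<subseteq> R)}"
  proof (rule prob_pmf_mono)
    fix R assume "\<not> expands V K s l (F R)"
    then consider v where "v \<in> V - K" "real (deg (F R) K v) > 3 * real k / 4"
      | L where "L \<subseteq> K" "s \<le> card L" "l \<le> card {v \<in> V - K. \<forall>u\<in>L. {u, v} \<in> F R}"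
      by (auto simp: expands_def k_def not_le not_less)
    then show "(\<exists>v\<in>V - K. real (deg (F R) K v) > 3 * real k / 4) \<or>
      (\<exists>(L, B)\<in>I. s \<le> card L \<and> (\<Union>v\<in>B. star L v) \<subseteq> R)"
    proof cases
      case 2
      from obtain_subset_with_card_n[OF 2(3)]
      obtain B where B: "B \<subseteq> {v \<in> V - K. \<forall>u\<in>L. {u, v} \<in> F R}" "card B = l" by auto
      have "star L v \<subseteq> R" if "v \<in> B" for v
        using that B 2 by (force simp: star_def F_def)
      then have "(L, B) \<in> I \<and> s \<le> card L \<and> (\<Union>v\<in>B. star L v) \<subseteq> R"
        using B 2 by (auto simp: I_def)
      then show ?thesis by blast
    qed auto
  qed
  also have "\<dots> \<le> card V * exp (- real k / 8) + 2 ^ k * real (card V) ^ l * (1/2) ^ (s * l)"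
    by (intro order.trans[OF prob_pmf_disj] add_mono 1 2)
  finally show ?thesis by (simp add: k_def)
qed

section \<open>Phase 1\<close>

lemma fresh_chain_Suc: "fresh_chain \<alpha> \<beta> K V (Suc i) = fresh_chain \<alpha> \<beta> K V i \<bind> (\<lambda>W. step_pmf \<alpha> \<beta> W (K \<inter> W))"
  by (simp add: step_pmf_def)

lemma set_step_pmf: "W' \<in> set_pmf (step_pmf \<alpha> \<beta> W J) \<Longrightarrow> W' \<subseteq> W"
  using survivors_subset by (fastforce simp: step_pmf_def)

text \<open>After the first step the ratio \<open>|K \<inter> W| / sqrt |W|\<close> exceeds \<open>c\<close>, so from then on the clique
  shrinks by a factor \<open>\<rho>\<^sub>2 > rho \<alpha> \<beta> c\<close> per step; this makes up for the loss in the first step.\<close>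

lemma phase1_constants:
  fixes \<alpha> \<beta> c :: real
  assumes \<alpha>: "0 < \<alpha>" "\<alpha> < 1" and r: "rho \<alpha> \<beta> c > sqrt (tau \<alpha> \<beta>)" and c: "0 < c"
  obtains b \<rho>1 \<rho>2 cs where "tau \<alpha> \<beta> < b" "0 < cs" "cs < c" "1 < \<rho>1 / sqrt b" "0 < \<rho>1" "\<rho>1 \<le> \<rho>2"
    "\<rho>1 < rho \<alpha> \<beta> cs" "\<rho>2 < rho \<alpha> \<beta> (\<rho>1 / sqrt b * cs)" "rho \<alpha> \<beta> c < \<rho>2" "\<rho>1 < 1"
proof -
  have t: "0 < tau \<alpha> \<beta>" using \<alpha> tau_pos by auto
  obtain \<rho>1 where \<rho>1: "sqrt (tau \<alpha> \<beta>) < \<rho>1" "\<rho>1 < rho \<alpha> \<beta> c" using dense[OF r] by auto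
  have \<rho>1_pos: "0 < \<rho>1" using \<rho>1 t by (meson less_trans real_sqrt_gt_zero)
  have "tau \<alpha> \<beta> < \<rho>1\<^sup>2" using \<rho>1 t \<rho>1_pos by (metis real_sqrt_less_iff real_sqrt_unique less_imp_le)
  then obtain b where b: "tau \<alpha> \<beta> < b" "b < \<rho>1\<^sup>2" using dense by auto
  \<comment> \<open>The clique keeps at least a fraction \<open>\<rho>1\<close>, and the square root
    of the vertex number shrinks at least by the factor \<open>sqrt b\<close>; their ratio thus
    grows at least by \<open>q\<close> per step.\<close>
  define q where "q = \<rho>1 / sqrt b"
  have "sqrt b < \<rho>1" using b \<rho>1_pos t by (intro real_less_lsqrt) auto
  then have q: "1 < q" using b t by (simp add: q_def)
  have "(rho \<alpha> \<beta> \<longlongrightarrow> rho \<alpha> \<beta> c) (at_left c)"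
    using isCont_rho[of c \<alpha> \<beta>] by (simp add: isCont_def filterlim_at_split)
  then have e1: "eventually (\<lambda>x. \<rho>1 < rho \<alpha> \<beta> x) (at_left c)"
    using \<rho>1 by (intro order_tendstoD)
  \<comment> \<open>\<open>cs\<close> is below c, since rounding may put the clique size below
    \<open>c * sqrt n\<close>, yet above \<open>c / q\<close>, so that a single step lifts the ratio
    beyond c.\<close>
  have "c / q < c" using q c by (simp add: divide_less_eq)
  then have e2: "eventually (\<lambda>x. x \<in> {c / q<..<c}) (at_left c)"
    by (rule eventually_at_left_real)
  from eventually_happens[OF eventually_conj[OF e1 e2]]
  obtain cs where cs: "\<rho>1 < rho \<alpha> \<beta> cs" "c / q < cs" "cs < c"
    by (auto simp: trivial_limit_at_left_real)
  have "0 < c / q" using c q by simp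
  then have "0 < cs" using cs by linarith
  have "c < q * cs" using cs q by (simp add: field_simps)
  then have "rho \<alpha> \<beta> c < rho \<alpha> \<beta> (q * cs)" using \<alpha> rho_strict_mono by auto
  then obtain \<rho>2 where "rho \<alpha> \<beta> c < \<rho>2" "\<rho>2 < rho \<alpha> \<beta> (q * cs)" using dense by auto
  moreover have "\<rho>1 < 1" using \<rho>1 rho_less_1[OF \<alpha>, of \<beta> c] by linarith
  ultimately show ?thesis
    using that[of b cs \<rho>1 \<rho>2] b cs \<open>0 < cs\<close> \<rho>1 \<rho>1_pos q by (auto simp: q_def)
qed

text \<open>The size hypotheses refer to the final time so that the one-step lemmas apply at all
  earlier times: the vertex set stays above \<open>a ^ t * card V\<close>, and the clique never
  grows. The growing ratio in the conclusion is what separates the degrees in Phase 2.\<close>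

lemma phase1_concentration:
  fixes \<alpha> \<beta> c :: real
  assumes \<alpha>: "0 < \<alpha>" "\<alpha> < 1" and \<beta>: "0 < \<beta>" and r: "rho \<alpha> \<beta> c > sqrt (tau \<alpha> \<beta>)" and c: "0 < c"
  obtains q a r1 cs \<delta> \<gamma> :: real and N0 t0 :: nat
  where "1 < q" "0 < a" "a < 1" "0 < r1" "r1 < 1" "0 < cs" "cs < c" "0 < \<delta>" "0 < \<gamma>"
    "\<And>(V :: 'a set) K t. finite V \<Longrightarrow> K \<subseteq> V \<Longrightarrow> t0 \<le> t \<Longrightarrow> cs * sqrt (card V) \<le> card K \<Longrightarrow>
      N0 \<le> a ^ t * card V \<Longrightarrow> card K \<le> \<delta> * (a ^ t * card V) \<Longrightarrow>
      measure_pmf.prob (fresh_chain \<alpha> \<beta> K V t) {W. \<not> (rho \<alpha> \<beta> c ^ t * card K \<le> card (K \<inter> W) \<and>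
        cs * q ^ t * sqrt (card W) \<le> card (K \<inter> W) \<and> a ^ t * card V \<le> card W)}
      \<le> t * (4 * exp (- \<gamma> * (a ^ t * card V)) + 5 * exp (- \<gamma> * (r1 ^ t * card K)))"
proof -
  obtain b \<rho>1 \<rho>2 cs where k: "tau \<alpha> \<beta> < b" "0 < cs" "cs < c" "1 < \<rho>1 / sqrt b" "0 < \<rho>1" "\<rho>1 \<le> \<rho>2"
    "\<rho>1 < rho \<alpha> \<beta> cs" "\<rho>2 < rho \<alpha> \<beta> (\<rho>1 / sqrt b * cs)" "rho \<alpha> \<beta> c < \<rho>2" "\<rho>1 < 1"
    using phase1_constants[OF \<alpha> r c] by metis
  define q where "q = \<rho>1 / sqrt b"
  \<comment> \<open>Any positive value below \<open>tau \<alpha> \<beta>\<close> would do: it limits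
    how fast the vertex set shrinks and does not enter the ratio \<open>q\<close>.\<close>
  define a where "a = tau \<alpha> \<beta> / 2"
  define \<rho> where "\<rho> = rho \<alpha> \<beta> c"
  have \<rho>: "0 < \<rho>" using rho_pos \<alpha> by (simp add: \<rho>_def)
  have t: "0 < tau \<alpha> \<beta>" "tau \<alpha> \<beta> < 1" using \<alpha> tau_pos tau_less_1 by auto
  have a: "0 < a" "a < 1" "a < tau \<alpha> \<beta>" using t by (auto simp: a_def)
  have b: "0 < b" using t k by linarith
  have q: "1 < q" using k by (simp add: q_def)
  obtain \<delta>1 \<gamma>1 :: real and N1 where d1: "0 < \<delta>1" "0 < \<gamma>1" and s1: "\<forall>W J :: 'a set. finite W \<longrightarrow> J \<subseteq> W \<longrightarrow> N1 \<le> card W \<longrightarrow>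
      card J \<le> \<delta>1 * card W \<longrightarrow>
    measure_pmf.prob (step_pmf \<alpha> \<beta> W J) {W'. \<not> (a * card W \<le> card W' \<and> card W' \<le> b * card W)} \<le> 4 * exp (- \<gamma>1 * card W)"
    using step_non_clique[OF \<alpha> a(3) k(1)] by (elim exE conjE) (rule that; assumption)
  obtain \<delta>2 \<gamma>2 :: real and N2 where d2: "0 < \<delta>2" "0 < \<gamma>2" and s2: "\<forall>W J :: 'a set. finite W \<longrightarrow> J \<subseteq> W \<longrightarrow> N2 \<le> card W \<longrightarrow>
      cs * sqrt (card W) \<le> card J \<longrightarrow> card J \<le> \<delta>2 * card W \<longrightarrow>
    measure_pmf.prob (step_pmf \<alpha> \<beta> W J) {W'. card (J \<inter> W') < \<rho>1 * card J} \<le> 5 * exp (- \<gamma>2 * card J)"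
    using step_clique[OF \<alpha> \<beta> k(2,7)] by (elim exE conjE) (rule that; assumption)
  have qcs: "0 < \<rho>1 / sqrt b * cs" using k b by simp
  obtain \<delta>3 \<gamma>3 :: real and N3 where d3: "0 < \<delta>3" "0 < \<gamma>3" and s3: "\<forall>W J :: 'a set. finite W \<longrightarrow> J \<subseteq> W \<longrightarrow> N3 \<le> card W \<longrightarrow>
      q * cs * sqrt (card W) \<le> card J \<longrightarrow> card J \<le> \<delta>3 * card W \<longrightarrow>
    measure_pmf.prob (step_pmf \<alpha> \<beta> W J) {W'. card (J \<inter> W') < \<rho>2 * card J} \<le> 5 * exp (- \<gamma>3 * card J)"
    using step_clique[OF \<alpha> \<beta> qcs k(8), folded q_def] by (elim exE conjE) (rule that; assumption)
  define \<delta> where "\<delta> = min \<delta>1 (min \<delta>2 \<delta>3)"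
  define \<gamma> where "\<gamma> = min \<gamma>1 (min \<gamma>2 \<gamma>3)"
  define N0 where "N0 = max N1 (max N2 N3)"
  have pos: "0 < \<delta>" "0 < \<gamma>" using d1 d2 d3 by (auto simp: \<delta>_def \<gamma>_def)
  define L where "L i k = (if i = 0 then k else \<rho>1 * \<rho>2 ^ (i - 1) * k)" for i and k :: real
  have "1 < \<rho>2 / \<rho>" using k(9) \<rho> by (simp add: \<rho>_def)
  \<comment> \<open>After \<open>t1\<close> further steps the surplus
    \<open>\<rho>2 / \<rho>\<close> per step has repaid the deficit \<open>\<rho> / \<rho>1\<close>
    of the first step.\<close>
  then obtain t1 where t1: "\<rho> / \<rho>1 < (\<rho>2 / \<rho>) ^ t1" using real_arch_pow by blast
  define t0 where "t0 = Suc t1"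
  have L_rho: "\<rho> ^ t * k' \<le> L t k'" if "t0 \<le> t" "0 \<le> k'" for t k'
  proof -
    have "t = Suc (t - 1)" "t1 \<le> t - 1" using that by (auto simp: t0_def)
    then obtain u where u: "t = Suc u" "t1 \<le> u" by blast
    have "(\<rho>2 / \<rho>) ^ t1 \<le> (\<rho>2 / \<rho>) ^ u" using \<open>1 < \<rho>2 / \<rho>\<close> u by (intro power_increasing) auto
    then have "\<rho> / \<rho>1 < \<rho>2 ^ u / \<rho> ^ u" using t1 by (simp add: power_divide)
    then have "\<rho> ^ t < \<rho>1 * \<rho>2 ^ u" using \<rho> k(5) u by (simp add: field_simps)
    then show ?thesis using that u by (simp add: L_def mult_right_mono)
  qed
  have L_r1: "\<rho>1 ^ i * k' \<le> L i k'" if "0 \<le> k'" for i k'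
  proof (cases i)
    case (Suc u)
    have "\<rho>1 ^ u \<le> \<rho>2 ^ u" using k by (intro power_mono) auto
    then show ?thesis using that k Suc by (simp add: L_def mult_right_mono mult_left_mono)
  qed (simp add: L_def)
  show ?thesis
  proof (rule that[of q a \<rho>1 cs \<delta> \<gamma> t0 N0, OF q a(1,2) k(5,10,2,3) pos])
    fix V K :: "'a set" and t
    assume V: "finite V" and K: "K \<subseteq> V" and t: "t0 \<le> t" and csk: "cs * sqrt (card V) \<le> card K"
      and N0: "N0 \<le> a ^ t * card V" and kd: "card K \<le> \<delta> * (a ^ t * card V)"
    define n where "n = real (card V)"
    define k' where "k' = real (card K)"
    define \<epsilon> where "\<epsilon> = 4 * exp (- \<gamma> * (a ^ t * n)) + 5 * exp (- \<gamma> * (\<rho>1 ^ t * k'))"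
    define Inv where "Inv i W \<longleftrightarrow> a ^ i * n \<le> card W \<and> card W \<le> b ^ i * n \<and> L i k' \<le> card (K \<inter> W)" for i W
    have \<epsilon>: "0 \<le> \<epsilon>" by (simp add: \<epsilon>_def)
    have k'0: "0 \<le> k'" "0 \<le> n" by (auto simp: k'_def n_def)
    have fK: "finite K" using K V finite_subset by auto
    \<comment> \<open>The cruder lower bound \<open>\<rho>1 ^ i * k'\<close> on the clique is enough
      here, because \<open>q * sqrt b = \<rho>1\<close>.\<close>
    have ratio: "cs * q ^ i * sqrt (card W) \<le> card (K \<inter> W)" if "Inv i W" for i W
    proof -
      have "cs * q ^ i * sqrt (card W) \<le> cs * q ^ i * sqrt (b ^ i * n)"
        using that k q by (intro mult_left_mono) (auto simp: Inv_def)
      also have "\<dots> = (q * sqrt b) ^ i * (cs * sqrt n)"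
        by (simp add: real_sqrt_mult real_sqrt_power power_mult_distrib)
      also have "q * sqrt b = \<rho>1" using b by (simp add: q_def)
      also have "\<rho>1 ^ i * (cs * sqrt n) \<le> \<rho>1 ^ i * k'"
        using csk k by (intro mult_left_mono) (auto simp: n_def k'_def)
      also have "\<dots> \<le> L i k'" by (rule L_r1[OF k'0(1)])
      also have "\<dots> \<le> card (K \<inter> W)" using that by (simp add: Inv_def)
      finally show ?thesis .
    qed
    have step: "measure_pmf.prob (step_pmf \<alpha> \<beta> W (K \<inter> W)) {W'. \<not> Inv (Suc i) W'} \<le> \<epsilon>"
      if inv: "Inv i W" and i: "i < t" and W: "W \<subseteq> V" for i W
    proof -
      define J where "J = K \<inter> W"
      have fW: "finite W" using W V finite_subset by auto
      have at: "a ^ t \<le> a ^ i" using a i by (intro power_decreasing) auto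
      have aW: "a ^ t * n \<le> card W"
        using mult_right_mono[OF at k'0(2)] inv by (simp add: Inv_def)
      have N: "N1 \<le> card W" "N2 \<le> card W" "N3 \<le> card W"
        using N0 aW unfolding n_def N0_def by linarith+
      have "card J \<le> card K" using fK by (intro card_mono) (auto simp: J_def)
      then have "card J \<le> \<delta> * (a ^ t * n)" using kd by (simp add: n_def)
      also have "\<dots> \<le> \<delta> * card W" using aW pos by (intro mult_left_mono) auto
      finally have Jd: "card J \<le> \<delta> * card W" .
      have Jd': "card J \<le> \<delta>1 * card W" "card J \<le> \<delta>2 * card W" "card J \<le> \<delta>3 * card W"
        by (rule order.trans[OF Jd], rule mult_right_mono, auto simp: \<delta>_def)+
      have "\<rho>1 ^ t \<le> \<rho>1 ^ i" using k i by (intro power_decreasing) auto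
      then have "\<rho>1 ^ t * k' \<le> \<rho>1 ^ i * k'" using k'0(1) by (rule mult_right_mono)
      also have "\<dots> \<le> L i k'" by (rule L_r1[OF k'0(1)])
      also have "\<dots> \<le> card J" using inv by (simp add: Inv_def J_def)
      finally have rJ: "\<rho>1 ^ t * k' \<le> card J" .
      have ex: "exp (- g * card J) \<le> exp (- \<gamma> * (\<rho>1 ^ t * k'))" if "\<gamma> \<le> g" for g
        using mult_mono[OF that rJ] that pos k'0 k by simp
      have 1: "measure_pmf.prob (step_pmf \<alpha> \<beta> W J) {W'. \<not> (a * card W \<le> card W' \<and> card W' \<le> b * card W)}
        \<le> 4 * exp (- \<gamma> * (a ^ t * n))"
      proof -
        have "\<gamma> * (a ^ t * n) \<le> \<gamma>1 * card W"
          using pos d1 aW k'0 a by (intro mult_mono) (auto simp: \<gamma>_def)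
        then have "4 * exp (- \<gamma>1 * card W) \<le> 4 * exp (- \<gamma> * (a ^ t * n))" by simp
        moreover have "J \<subseteq> W" by (simp add: J_def)
        note s1[rule_format, OF fW this N(1) Jd'(1)]
        ultimately show ?thesis by linarith
      qed
      have 2: "measure_pmf.prob (step_pmf \<alpha> \<beta> W J) {W'. card (J \<inter> W') < L (Suc i) k'}
        \<le> 5 * exp (- \<gamma> * (\<rho>1 ^ t * k'))"
      proof (cases i)
        case 0
        have "measure_pmf.prob (step_pmf \<alpha> \<beta> W J) {W'. card (J \<inter> W') < L (Suc i) k'}
          \<le> measure_pmf.prob (step_pmf \<alpha> \<beta> W J) {W'. card (J \<inter> W') < \<rho>1 * card J}"
        proof (rule prob_pmf_mono)
          fix W' assume "card (J \<inter> W') < L (Suc i) k'"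
          moreover have "\<rho>1 * k' \<le> \<rho>1 * card J" using inv k 0 by (intro mult_left_mono) (auto simp: Inv_def L_def J_def)
          ultimately show "card (J \<inter> W') < \<rho>1 * card J" using 0 by (simp add: L_def)
        qed
        also have "\<dots> \<le> 5 * exp (- \<gamma>2 * card J)"
          using ratio[OF inv] 0 by (intro s2[rule_format] fW N Jd') (auto simp: J_def)
        also have "\<dots> \<le> 5 * exp (- \<gamma> * (\<rho>1 ^ t * k'))" using ex[of \<gamma>2] by (simp add: \<gamma>_def)
        finally show ?thesis .
      next
        case (Suc u)
        have "measure_pmf.prob (step_pmf \<alpha> \<beta> W J) {W'. card (J \<inter> W') < L (Suc i) k'}
          \<le> measure_pmf.prob (step_pmf \<alpha> \<beta> W J) {W'. card (J \<inter> W') < \<rho>2 * card J}"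
        proof (rule prob_pmf_mono)
          fix W' assume "card (J \<inter> W') < L (Suc i) k'"
          moreover have "\<rho>2 * L i k' \<le> \<rho>2 * card J" using inv k by (intro mult_left_mono) (auto simp: Inv_def J_def)
          ultimately show "card (J \<inter> W') < \<rho>2 * card J" using Suc by (simp add: L_def mult_ac)
        qed
        also have "\<dots> \<le> 5 * exp (- \<gamma>3 * card J)"
        proof (intro s3[rule_format] fW N Jd')
          \<comment> \<open>From the second step on the ratio is at least \<open>q * cs\<close>,
            which permits the larger factor \<open>\<rho>2\<close>.\<close>
          have "q ^ 1 \<le> q ^ i" using q Suc by (intro power_increasing) auto
          then have "q * cs * sqrt (card W) \<le> cs * q ^ i * sqrt (card W)"
            using k(2) by (intro mult_right_mono) auto
          also note ratio[OF inv]
          finally show "q * cs * sqrt (card W) \<le> card J" by (simp add: J_def)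
        qed (simp add: J_def)
        also have "\<dots> \<le> 5 * exp (- \<gamma> * (\<rho>1 ^ t * k'))" using ex[of \<gamma>3] by (simp add: \<gamma>_def)
        finally show ?thesis .
      qed
      have "measure_pmf.prob (step_pmf \<alpha> \<beta> W J) {W'. \<not> Inv (Suc i) W'} \<le>
        measure_pmf.prob (step_pmf \<alpha> \<beta> W J) {W'. \<not> (a * card W \<le> card W' \<and> card W' \<le> b * card W) \<or>
          card (J \<inter> W') < L (Suc i) k'}"
      proof (rule prob_pmf_mono, rule ccontr)
        fix W' assume W': "W' \<in> set_pmf (step_pmf \<alpha> \<beta> W J)" and n: "\<not> Inv (Suc i) W'"
          and "\<not> (\<not> (a * card W \<le> card W' \<and> card W' \<le> b * card W) \<or> card (J \<inter> W') < L (Suc i) k')"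
        then have h: "a * card W \<le> card W'" "card W' \<le> b * card W" "L (Suc i) k' \<le> card (J \<inter> W')" by auto
        have "J \<inter> W' = K \<inter> W'" using set_step_pmf[OF W'] by (auto simp: J_def)
        moreover have "a * (a ^ i * n) \<le> a * card W" "b * card W \<le> b * (b ^ i * n)"
          using inv a b by (auto simp: Inv_def)
        ultimately have "Inv (Suc i) W'"
          using h by (simp add: Inv_def mult.assoc)
        with n show False ..
      qed
      also have "\<dots> \<le> \<epsilon>"
        unfolding \<epsilon>_def by (intro order.trans[OF prob_pmf_disj] add_mono 1 2)
      finally show ?thesis by (simp add: J_def)
    qed
    have main: "i \<le> t \<Longrightarrow> measure_pmf.prob (fresh_chain \<alpha> \<beta> K V i) {W. \<not> Inv i W} \<le> i * \<epsilon>" for i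
    proof (induction i)
      case 0
      have "Inv 0 V" using K by (simp add: Inv_def n_def L_def k'_def Int_absorb2)
      then show ?case by simp
    next
      case (Suc i)
      have "measure_pmf.prob (fresh_chain \<alpha> \<beta> K V (Suc i)) {W. \<not> Inv (Suc i) W}
        \<le> measure_pmf.prob (fresh_chain \<alpha> \<beta> K V i) {W. \<not> Inv i W} + \<epsilon>"
        unfolding fresh_chain_Suc
        by (intro prob_bind_pmf_le_except \<epsilon> step) (use Suc in \<open>auto dest!: set_fresh_chain\<close>)
      also have "\<dots> \<le> i * \<epsilon> + \<epsilon>" using Suc by simp
      finally show ?case by (simp add: algebra_simps)
    qed
    have "measure_pmf.prob (fresh_chain \<alpha> \<beta> K V t) {W. \<not> (rho \<alpha> \<beta> c ^ t * card K \<le> card (K \<inter> W) \<and>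
        cs * q ^ t * sqrt (card W) \<le> card (K \<inter> W) \<and> a ^ t * card V \<le> card W)}
      \<le> measure_pmf.prob (fresh_chain \<alpha> \<beta> K V t) {W. \<not> Inv t W}"
    proof (rule prob_pmf_mono, erule contrapos_nn)
      fix W assume inv: "Inv t W"
      have "rho \<alpha> \<beta> c ^ t * card K \<le> card (K \<inter> W)"
        using L_rho[OF t k'0(1)] inv by (simp add: Inv_def \<rho>_def k'_def)
      then show "rho \<alpha> \<beta> c ^ t * card K \<le> card (K \<inter> W) \<and>
        cs * q ^ t * sqrt (card W) \<le> card (K \<inter> W) \<and> a ^ t * card V \<le> card W"
        using ratio[OF inv] inv by (simp add: Inv_def n_def)
    qed
    also have "\<dots> \<le> t * \<epsilon>" using main[of t] by simp
    finally show "measure_pmf.prob (fresh_chain \<alpha> \<beta> K V t) {W. \<not> (rho \<alpha> \<beta> c ^ t * card K \<le> card (K \<inter> W) \<and>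
        cs * q ^ t * sqrt (card W) \<le> card (K \<inter> W) \<and> a ^ t * card V \<le> card W)}
      \<le> t * (4 * exp (- \<gamma> * (a ^ t * card V)) + 5 * exp (- \<gamma> * (\<rho>1 ^ t * card K)))"
      by (simp add: \<epsilon>_def n_def k'_def)
  qed
qed

section \<open>Assembling the three phases\<close>

text \<open>The bounds \<open>b1\<close>, \<open>b2\<close>, \<open>b3\<close> belong to Phases 3, 1
  and 2. Phase 2 returns all of \<open>K \<inter> W\<close>, possibly many more than
  \<open>k'\<close> vertices; having at least \<open>k'\<close> of them is what
  \<open>expands\<close> requires.\<close>

lemma find_clique_failure:
  fixes \<alpha> \<beta> c :: real
  assumes sel: "selects_largest sel" and K: "K \<subseteq> {..<n}" "card K = k" "8 < k"
    and k': "k' = nat \<lfloor>rho \<alpha> \<beta> c ^ t * real k\<rfloor>"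
    and b1: "measure_pmf.prob (planted {..<n} K) {E. \<not> expands {..<n} K k' (k div 8) E} \<le> b1"
    and b2: "measure_pmf.prob (fresh_chain \<alpha> \<beta> K {..<n} t) {W. \<not> G W} \<le> b2"
    and G: "\<And>W. W \<subseteq> {..<n} \<Longrightarrow> G W \<Longrightarrow> k' \<le> card (K \<inter> W)"
    and b3: "\<And>W. W \<subseteq> {..<n} \<Longrightarrow> G W \<Longrightarrow>
      measure_pmf.prob (planted W (K \<inter> W)) {F. \<not> recovers W (K \<inter> W) k' F} \<le> b3" "0 \<le> b3"
  shows "measure_pmf.prob (planted {..<n} K \<bind> find_clique sel \<alpha> \<beta> c t n k) {X. X \<noteq> K} \<le> b1 + (b2 + b3)"
proof -
  let ?V = "{..<n}"
  \<comment> \<open>One run with its graph and its final vertex set. \<open>Y1\<close> and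
    \<open>Y2\<close> identify the two marginals on which the failure events live.\<close>
  define Y where "Y = do {E \<leftarrow> planted ?V K; W \<leftarrow> phase1 \<alpha> \<beta> E ?V t; return_pmf (E, W)}"
  define out where "out = (\<lambda>(E, W). phase3 sel E ?V (phase2 sel E W k') k)"
  define good where "good = (\<lambda>(W, F). k' \<le> card (K \<inter> W) \<and> recovers W (K \<inter> W) k' F)"
  have eq: "planted ?V K \<bind> find_clique sel \<alpha> \<beta> c t n k = map_pmf out Y"
    by (simp add: Y_def out_def find_clique_def[abs_def] k' map_pmf_def bind_assoc_pmf bind_return_pmf Let_def)
  have Y1: "map_pmf fst Y = planted ?V K"
    by (simp add: Y_def map_pmf_def bind_assoc_pmf bind_return_pmf bind_return_pmf')
  have Y2: "map_pmf (\<lambda>(E, W). (W, E \<inter> pairs W)) Y =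
      do {W \<leftarrow> fresh_chain \<alpha> \<beta> K ?V t; map_pmf (Pair W) (planted W (K \<inter> W))}"
    unfolding phase1_fresh[OF finite_lessThan K(1), symmetric]
    by (simp add: Y_def map_pmf_def bind_assoc_pmf bind_return_pmf)
  have "measure_pmf.prob (map_pmf out Y) {X. X \<noteq> K} = measure_pmf.prob Y {x. out x \<noteq> K}"
    by (simp add: vimage_def)
  also have "\<dots> \<le> measure_pmf.prob Y {x. \<not> expands ?V K k' (k div 8) (fst x) \<or> \<not> good ((\<lambda>(E, W). (W, E \<inter> pairs W)) x)}"
  proof (rule prob_pmf_mono, rule ccontr)
    fix x assume x: "x \<in> set_pmf Y" and ne: "out x \<noteq> K"
      and "\<not> (\<not> expands ?V K k' (k div 8) (fst x) \<or> \<not> good ((\<lambda>(E, W). (W, E \<inter> pairs W)) x))"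
    moreover obtain E W where EW: "x = (E, W)" by (cases x)
    ultimately have h: "expands ?V K k' (k div 8) E" "k' \<le> card (K \<inter> W)" "recovers W (K \<inter> W) k' (E \<inter> pairs W)"
      by (auto simp: good_def)
    have E: "E \<in> set_pmf (planted ?V K)" "W \<subseteq> ?V"
      using x by (auto simp: Y_def EW dest!: set_phase1)
    have E': "pairs K \<subseteq> E" "E \<subseteq> pairs ?V"
      using E(1) set_planted[OF E(1) K(1)] by (auto simp: planted_def)
    have fW: "finite W" using E(2) finite_subset by auto
    have "card (K \<inter> W) \<le> card W" using fW by (intro card_mono) auto
    then have "phase2 sel E W k' = K \<inter> W"
      using h sel fW E' by (intro phase2_eq[where V="?V"]) auto
    moreover have "phase3 sel E ?V (K \<inter> W) (card K) = K"
      using h E' sel K by (intro phase3_eq[where s=k' and l="k div 8"]) auto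
    ultimately show False using ne K by (simp add: out_def EW)
  qed
  also have "\<dots> \<le> b1 + (b2 + b3)"
  proof (rule order.trans[OF prob_pmf_disj add_mono])
    have "measure_pmf.prob Y {x. \<not> expands ?V K k' (k div 8) (fst x)} =
        measure_pmf.prob (map_pmf fst Y) {E. \<not> expands ?V K k' (k div 8) E}"
      by (simp add: vimage_def)
    then show "measure_pmf.prob Y {x. \<not> expands ?V K k' (k div 8) (fst x)} \<le> b1"
      using b1 Y1 by simp
    have "measure_pmf.prob Y {x. \<not> good ((\<lambda>(E, W). (W, E \<inter> pairs W)) x)} =
        measure_pmf.prob (map_pmf (\<lambda>(E, W). (W, E \<inter> pairs W)) Y) {y. \<not> good y}"
      by (simp add: vimage_def)
    also have "\<dots> \<le> measure_pmf.prob (fresh_chain \<alpha> \<beta> K ?V t) {W. \<not> G W} + b3"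
      unfolding Y2
    proof (rule prob_bind_pmf_le_except[OF _ b3(2)])
      fix W assume W: "W \<in> set_pmf (fresh_chain \<alpha> \<beta> K ?V t)" "\<not> \<not> G W"
      then have "W \<subseteq> ?V" "G W" using set_fresh_chain[OF W(1)] by auto
      then show "measure_pmf.prob (map_pmf (Pair W) (planted W (K \<inter> W))) {y. \<not> good y} \<le> b3"
        using b3(1) G by (simp add: vimage_def good_def)
    qed
    also have "\<dots> \<le> b2 + b3" using b2 by simp
    finally show "measure_pmf.prob Y {x. \<not> good ((\<lambda>(E, W). (W, E \<inter> pairs W)) x)} \<le> b2 + b3" .
  qed
  finally show ?thesis unfolding eq .
qed

text \<open>A failure bound valid for every position of the clique survives averaging over a random
  one.\<close>

lemma clique_experiment_success:
  assumes k: "k \<le> n"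
    and b: "\<And>K. K \<subseteq> {..<n} \<Longrightarrow> card K = k \<Longrightarrow>
      measure_pmf.prob (planted {..<n} K \<bind> find_clique sel \<alpha> \<beta> c t n k) {X. X \<noteq> K} \<le> b"
  shows "measure_pmf.prob (clique_experiment sel \<alpha> \<beta> c t n k) {(K, Kstar). Kstar = K} \<ge> 1 - b"
proof -
  let ?A = "{K. K \<subseteq> {..<n} \<and> card K = k}"
  have "finite ?A" by (rule finite_subset[of _ "Pow {..<n}"]) auto
  moreover have "?A \<noteq> {}" using obtain_subset_with_card_n[of k "{..<n}"] k by auto
  ultimately have A: "set_pmf (pmf_of_set ?A) = ?A" by (rule set_pmf_of_set[rotated])
  have "clique_experiment sel \<alpha> \<beta> c t n k =
      pmf_of_set ?A \<bind> (\<lambda>K. map_pmf (Pair K) (planted {..<n} K \<bind> find_clique sel \<alpha> \<beta> c t n k))"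
    by (simp add: clique_experiment_def hidden_clique_pmf_def planted_def map_pmf_def bind_assoc_pmf bind_return_pmf)
  then have "measure_pmf.prob (clique_experiment sel \<alpha> \<beta> c t n k) {(K, Kstar). Kstar \<noteq> K} \<le> b"
    using b A by (auto intro!: prob_bind_pmf_le simp: vimage_def)
  moreover have "{(K, Kstar). Kstar = K} = - {(K, Kstar). Kstar \<noteq> (K :: nat set)}" by auto
  then have "measure_pmf.prob (clique_experiment sel \<alpha> \<beta> c t n k) {(K, Kstar). Kstar = K} =
      1 - measure_pmf.prob (clique_experiment sel \<alpha> \<beta> c t n k) {(K, Kstar). Kstar \<noteq> K}"
    using measure_pmf.prob_compl[of "{(K, Kstar). Kstar \<noteq> K}" "clique_experiment sel \<alpha> \<beta> c t n k"]
    by (simp add: Compl_eq_Diff_UNIV)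
  ultimately show ?thesis by simp
qed

text \<open>Turns logarithmically many steps into a polynomial loss: \<open>s\<close> is chosen to
  make \<open>m powr (s * ln x)\<close> equal to \<open>x powr (- e)\<close>.\<close>

lemma power_ge_powr:
  fixes m s x :: real
  assumes "0 < m" "m < 1" "real t \<le> s * ln x" "0 < x" "s = - e / ln m"
  shows "x powr (- e) \<le> m ^ t"
proof -
  have "x powr (- e) = m powr (s * ln x)"
    using assms by (simp add: powr_def ln_less_zero less_imp_neq)
  also have "\<dots> \<le> m powr t" using assms by (intro powr_mono') auto
  finally show ?thesis using assms by (simp add: powr_realpow)
qed

text \<open>With l = k div 8 one has k \<le> 16 l. Using 1/2 \<le> ln 2 \<le> 1, the exponent is at
  most l (16 + ln n - k'/2), hence at most -l and so at most -k/16.\<close>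

lemma expands_failure_small:
  assumes k': "17 + ln (real n) \<le> real k' / 2" and k: "8 < k" and n: "0 < n"
  shows "2 ^ k * real n ^ (k div 8) * (1/2) ^ (k' * (k div 8)) \<le> exp (- real k / 16)"
proof -
  define l where "l = real (k div 8)"
  have l: "real k \<le> 16 * l" 
  proof -
    have "k \<le> 16 * (k div 8)" using k by presburger
    then show ?thesis unfolding l_def by linarith
  qed
  have l0: "0 \<le> l" by (simp add: l_def)
  have ln2: "1/2 \<le> ln (2::real)" "ln (2::real) \<le> 1"
    using ln_2_less_1 ln2_ge_two_thirds by auto
  have "2 ^ k * real n ^ (k div 8) * (1/2) ^ (k' * (k div 8)) =
      exp (k * ln 2 + l * ln n - k' * l * ln 2)"
    using n by (simp add: exp_add exp_diff l_def exp_of_nat_mult power_one_over power_mult divide_simps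
        flip: of_nat_mult)
  also have "\<dots> \<le> exp (- real k / 16)"
  proof (subst exp_le_cancel_iff)
    have "k * ln 2 \<le> 16 * l" using l ln2 by (intro order.trans[OF mult_left_mono[of "ln 2" 1]]) auto
    moreover have "k' * l * (1/2) \<le> k' * l * ln 2" using ln2 l0 by (intro mult_left_mono) auto
    moreover have "(17 + ln n) * l \<le> k' / 2 * l" using k' l0 by (rule mult_right_mono)
    ultimately have "k * ln 2 + l * ln n - k' * l * ln 2 \<le> - l" by (simp add: algebra_simps)
    then show "k * ln 2 + l * ln n - k' * l * ln 2 \<le> - real k / 16" using l by simp
  qed
  finally show ?thesis .
qed

theorem theorem1:
  fixes c :: real
  assumes "c > c_zero"
  shows "\<exists>\<alpha> \<beta> \<epsilon>4 \<epsilon>0 :: real. \<exists>f :: nat \<Rightarrow> real.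
    0 < \<alpha> \<and> \<alpha> < 1 \<and> 0 < \<beta> \<and> rho \<alpha> \<beta> c > sqrt (tau \<alpha> \<beta>) \<and> 0 < \<epsilon>4 \<and> 0 < \<epsilon>0 \<and>
    f \<in> \<Theta>(\<lambda>n. real n powr \<epsilon>0) \<and> (\<forall>n. 0 \<le> f n) \<and>
    (\<forall>\<^sub>F n in sequentially. \<forall>k sel.
       \<bar>real k - c * sqrt (real n)\<bar> < 1 \<longrightarrow> selects_largest sel \<longrightarrow>
       measure_pmf.prob (clique_experiment sel \<alpha> \<beta> c (num_iterations \<alpha> \<beta> c \<epsilon>4 n) n k)
         {(K, Kstar). Kstar = K} \<ge> 1 - exp (- f n))"
proof -
  obtain \<alpha> \<beta> where \<alpha>: "0 < \<alpha>" "\<alpha> < 1" and \<beta>: "0 < \<beta>" and r: "rho \<alpha> \<beta> c > sqrt (tau \<alpha> \<beta>)" and c: "0 < c"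
    using parameters_exist[OF assms] by metis
  obtain q a r1 cs \<delta> \<gamma> :: real and N0 t0 :: nat
    where q: "1 < q" and a: "0 < a" "a < 1" and r1: "0 < r1" "r1 < 1" and cs: "0 < cs" "cs < c"
      and \<delta>: "0 < \<delta>" and \<gamma>: "0 < \<gamma>" and phase1:
    "\<And>(V :: nat set) K t. finite V \<Longrightarrow> K \<subseteq> V \<Longrightarrow> t0 \<le> t \<Longrightarrow> cs * sqrt (card V) \<le> card K \<Longrightarrow>
      N0 \<le> a ^ t * card V \<Longrightarrow> card K \<le> \<delta> * (a ^ t * card V) \<Longrightarrow>
      measure_pmf.prob (fresh_chain \<alpha> \<beta> K V t) {W. \<not> (rho \<alpha> \<beta> c ^ t * card K \<le> card (K \<inter> W) \<and>
        cs * q ^ t * sqrt (card W) \<le> card (K \<inter> W) \<and> a ^ t * card V \<le> card W)}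
      \<le> t * (4 * exp (- \<gamma> * (a ^ t * card V)) + 5 * exp (- \<gamma> * (r1 ^ t * card K)))"
    by (rule phase1_concentration[OF \<alpha> \<beta> r c]) blast
  define \<rho> where "\<rho> = rho \<alpha> \<beta> c"
  have \<rho>: "0 < \<rho>" "\<rho> < 1" using rho_pos rho_less_1 \<alpha> by (auto simp: \<rho>_def)
  \<comment> \<open>The smallest of the factors whose t-th powers enter the estimates;
    \<open>s\<close> is then fixed so that \<open>m powr (s * ln n)\<close> is n^(-1/20).\<close>
  define m where "m = min a (min r1 \<rho>)"
  have m: "0 < m" "m < 1" "m \<le> a" "m \<le> r1" "m \<le> \<rho>" using a r1 \<rho> by (auto simp: m_def)
  define s where "s = - (1/20) / ln m"
  have s: "0 < s" using m by (simp add: s_def divide_neg_neg)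
  define \<Lambda> where "\<Lambda> = ln (\<rho>\<^sup>2 / tau \<alpha> \<beta>)"
  have "tau \<alpha> \<beta> < \<rho>\<^sup>2"
    using power_strict_mono[OF r, of 2] tau_pos[of \<alpha> \<beta>] \<alpha> by (simp add: \<rho>_def)
  then have \<Lambda>: "0 < \<Lambda>" using tau_pos[of \<alpha> \<beta>] \<alpha> unfolding \<Lambda>_def by (intro ln_gt_zero) (simp add: less_divide_eq)
  \<comment> \<open>Cancels the denominator in \<open>num_iterations\<close>, which leaves the floor
    of \<open>s * ln n\<close>.\<close>
  define \<epsilon>4 where "\<epsilon>4 = s * \<Lambda>"
  \<comment> \<open>The ratio gained in Phase 1 is of order at least n^(s ln q). The cap 1/20 keeps
    \<open>2 * \<eta>\<close> at most 1/10, below the exponents of all other tail bounds.\<close>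
  define \<eta> where "\<eta> = min (s * ln q) (1/20)"
  have \<eta>: "0 < \<eta>" "\<eta> \<le> s * ln q" "\<eta> \<le> 1/20" using s q by (auto simp: \<eta>_def)
  \<comment> \<open>One entry per tail bound: vertex count and clique size in Phase 1; degree
    separation, level sets and neighborhoods in Phase 2; the degree and counting terms of Phase
    3.\<close>
  define C where "C = Min {\<gamma>, \<gamma> * cs, cs\<^sup>2 / (32 * q\<^sup>2), cs\<^sup>2 / (20000 * (c + 1)), cs / 64, cs / 8, cs / 16}"
  have C: "0 < C" using \<gamma> cs q c by (simp add: C_def)
  have C_le: "C \<le> \<gamma>" "C \<le> \<gamma> * cs" "C \<le> cs\<^sup>2 / (32 * q\<^sup>2)" "C \<le> cs\<^sup>2 / (20000 * (c + 1))"
    "C \<le> cs / 64" "C \<le> cs / 8" "C \<le> cs / 16"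
    unfolding C_def by (rule Min_le; simp)+
  have it: "num_iterations \<alpha> \<beta> c \<epsilon>4 n = nat \<lfloor>s * ln n\<rfloor>" for n
    using \<Lambda> by (simp add: num_iterations_def \<rho>_def[symmetric] log_def \<epsilon>4_def \<Lambda>_def[symmetric])
  have ev: "\<forall>\<^sub>F n in sequentially. real t0 + 1 \<le> s * ln (real n)"
    "\<forall>\<^sub>F n in sequentially. real N0 \<le> real n powr (19/20)"
    "\<forall>\<^sub>F n in sequentially. (c + 1) * real n powr (1/2) \<le> \<delta> * real n powr (19/20)"
    "\<forall>\<^sub>F n in sequentially. 8 < c * real n powr (1/2) - 1"
    "\<forall>\<^sub>F n in sequentially. c * real n powr (1/2) + 1 \<le> real n"
    "\<forall>\<^sub>F n in sequentially. (cs/2) * real n powr (9/20) \<le> cs * real n powr (9/20) - 1"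
    "\<forall>\<^sub>F n in sequentially. 4 \<le> (cs/2) * real n powr (9/20)"
    "\<forall>\<^sub>F n in sequentially. (c + 1) * real n powr (1/2) + 1 < real n powr (19/20) / 2"
    "\<forall>\<^sub>F n in sequentially. (c + 1) * real n powr (1/2) / sqrt (real n powr (19/20) / 2) \<le> (cs/200) * real n powr (9/20)"
    "\<forall>\<^sub>F n in sequentially. 17 + ln (real n) \<le> (cs/4) * real n powr (9/20)"
    "\<forall>\<^sub>F n in sequentially. s * ln (real n) \<le> real n"
    using s c cs \<delta> by real_asymp+
  have ev2: "\<forall>\<^sub>F n in sequentially. cs * real n powr (1/2) \<le> c * real n powr (1/2) - 1"
  proof -
    have "\<forall>\<^sub>F n in sequentially. 1 \<le> (c - cs) * real n powr (1/2)" using cs by real_asymp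
    then show ?thesis by eventually_elim (simp add: algebra_simps)
  qed
  \<comment> \<open>Lowering the exponent from \<open>2 * \<eta>\<close> to \<open>\<eta>\<close>
    absorbs \<open>C\<close> and the polynomial factor.\<close>
  have ev3: "\<forall>\<^sub>F n in sequentially. 20 * real n ^ 2 * exp (- C * real n powr (2 * \<eta>)) \<le> exp (- (real n powr \<eta>))"
    using C \<eta> by real_asymp
  have main: "\<forall>\<^sub>F n in sequentially. \<forall>k sel.
       \<bar>real k - c * sqrt (real n)\<bar> < 1 \<longrightarrow> selects_largest sel \<longrightarrow>
       measure_pmf.prob (clique_experiment sel \<alpha> \<beta> c (num_iterations \<alpha> \<beta> c \<epsilon>4 n) n k)
         {(K, Kstar). Kstar = K} \<ge> 1 - exp (- (real n powr \<eta>))"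
    using ev ev2 ev3 eventually_gt_at_top[of 0]
  proof eventually_elim
    case (elim n)
    note F = elim
    define t where "t = num_iterations \<alpha> \<beta> c \<epsilon>4 n"
    define X where "X = real n powr (2 * \<eta>)"
    define e where "e = exp (- C * X)"
    have n: "1 \<le> real n" using F by simp
    have t: "real t \<le> s * ln n" "s * ln n - 1 \<le> real t" "t0 \<le> t"
      using F(1) n s unfolding t_def it by (linarith | simp)+
    have tn: "real t \<le> n" using t F(11) by linarith
    have X_le: "X \<le> real n powr p" if "1/10 \<le> p" for p
      unfolding X_def using n \<eta> that by (intro powr_mono) auto
    have X0: "0 \<le> X" "0 \<le> e" by (auto simp: X_def e_def)
    have e: "exp (- y) \<le> e" if "C * X \<le> y" for y using that by (simp add: e_def)
    have mt: "real n powr (- (1/20)) \<le> m ^ t"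
      using m t(1) n by (intro power_ge_powr) (auto simp: s_def)
    have pw: "real n powr (- (1/20)) \<le> x ^ t" if "m \<le> x" for x
      using mt power_mono[OF that, of t] m by linarith
    \<comment> \<open>The floor may lose one iteration, which costs one factor \<open>q\<close>;
      hence \<open>q\<^sup>2\<close> in the definition of \<open>C\<close>.\<close>
    have qt: "real n powr \<eta> \<le> q * q ^ t"
    proof -
      have "real n powr \<eta> \<le> real n powr (s * ln q)" using n \<eta> by (intro powr_mono) auto
      also have "\<dots> = q powr (s * ln n)" using n q by (simp add: powr_def mult_ac)
      also have "\<dots> \<le> q powr (1 + real t)" using t q by (intro powr_mono) auto
      also have "\<dots> = q * q ^ t" using q by (simp add: powr_add powr_realpow)
      finally show ?thesis .
    qed
    have at: "real n powr (19/20) \<le> a ^ t * n"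
    proof -
      have "real n powr (19/20) = real n powr (- (1/20)) * real n powr 1" by (subst powr_add[symmetric]) simp
      then show ?thesis using pw[OF m(3)] n by (simp add: mult_right_mono)
    qed
    show ?case
    proof (intro allI impI)
      fix k :: nat and sel :: "nat \<Rightarrow> (nat \<Rightarrow> nat) \<Rightarrow> nat set \<Rightarrow> nat set"
      assume k: "\<bar>real k - c * sqrt (real n)\<bar> < 1" and sel: "selects_largest sel"
      have sq: "sqrt (real n) = real n powr (1/2)" by (simp add: powr_half_sqrt)
      have "1 \<le> real n powr (1/2)" using n by (simp add: ge_one_powr_ge_zero)
      then have k_hi: "real k \<le> (c + 1) * real n powr (1/2)" using k sq by (simp add: algebra_simps)
      have k_lo: "cs * real n powr (1/2) \<le> real k" using k sq F(12) by simp
      have "8 < real k" "real k \<le> real n" using k[unfolded sq] F(4,5) by linarith+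
      then have k8: "8 < k" and kn: "k \<le> n" by simp_all
      have xk: "cs * real n powr (9/20) \<le> x ^ t * k" if "m \<le> x" for x
      proof -
        have "cs * real n powr (9/20) = real n powr (- (1/20)) * (cs * real n powr (1/2))"
          by (simp flip: powr_add)
        also have "\<dots> \<le> x ^ t * k" using pw[OF that] k_lo cs m that by (intro mult_mono) auto
        finally show ?thesis .
      qed
      define k' where "k' = nat \<lfloor>rho \<alpha> \<beta> c ^ t * real k\<rfloor>"
      have rk0: "0 \<le> \<rho> ^ t * k" using \<rho> by simp
      have k'_hi: "real k' \<le> \<rho> ^ t * k" using rk0 by (simp add: k'_def \<rho>_def)
      have "\<rho> ^ t * k - 1 \<le> real k'" using rk0 unfolding k'_def \<rho>_def by linarith
      then have k'_lo: "(cs/2) * real n powr (9/20) \<le> real k'" using xk[OF m(5)] F(6) by linarith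
      have k'4: "4 \<le> k'" using k'_lo F(7) by linarith
      show "1 - exp (- (real n powr \<eta>)) \<le> measure_pmf.prob
          (clique_experiment sel \<alpha> \<beta> c (num_iterations \<alpha> \<beta> c \<epsilon>4 n) n k) {(K, Kstar). Kstar = K}"
        unfolding t_def[symmetric]
      proof (rule clique_experiment_success[OF kn])
        fix K assume K: "K \<subseteq> {..<n}" "card K = k"
        define G where "G W \<longleftrightarrow> rho \<alpha> \<beta> c ^ t * card K \<le> card (K \<inter> W) \<and>
          cs * q ^ t * sqrt (card W) \<le> card (K \<inter> W) \<and> a ^ t * card {..<n} \<le> card W" for W
        have "measure_pmf.prob (planted {..<n} K \<bind> find_clique sel \<alpha> \<beta> c t n k) {X. X \<noteq> K}
          \<le> (n * e + e) + (n * (9 * e) + (2 * n * e + (n * (n + 1)) * (e + e)))"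
        proof (rule find_clique_failure[OF sel K k8 k'_def, where G=G])
          have "measure_pmf.prob (planted {..<n} K) {E. \<not> expands {..<n} K k' (k div 8) E}
            \<le> n * exp (- real k / 8) + 2 ^ k * real n ^ (k div 8) * (1/2) ^ (k' * (k div 8))"
            using expands_prob[of "{..<n}" K k' "k div 8"] K by simp
          also have "\<dots> \<le> n * e + e"
          proof (intro add_mono mult_left_mono)
            have "C * X \<le> cs / 8 * real n powr (1/2)" "C * X \<le> cs / 16 * real n powr (1/2)"
              using C C_le X0 by (intro mult_mono X_le; simp)+
            then have *: "C * X \<le> real k / 8" "C * X \<le> real k / 16" using k_lo by linarith+
            then show "exp (- real k / 8) \<le> e" using e[of "real k / 8"] by simp
            have "2 ^ k * real n ^ (k div 8) * (1/2) ^ (k' * (k div 8)) \<le> exp (- real k / 16)"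
              using F(10) k'_lo k8 n by (intro expands_failure_small) auto
            also have "\<dots> \<le> e" using e[of "real k / 16"] * by simp
            finally show "2 ^ k * real n ^ (k div 8) * (1/2) ^ (k' * (k div 8)) \<le> e" .
          qed simp
          finally show "measure_pmf.prob (planted {..<n} K) {E. \<not> expands {..<n} K k' (k div 8) E} \<le> n * e + e" .
        next
          have "measure_pmf.prob (fresh_chain \<alpha> \<beta> K {..<n} t) {W. \<not> G W}
            \<le> t * (4 * exp (- \<gamma> * (a ^ t * card {..<n})) + 5 * exp (- \<gamma> * (r1 ^ t * card K)))"
            unfolding G_def
          proof (rule phase1[OF finite_lessThan K(1) t(3)])
            show "cs * sqrt (card {..<n}) \<le> card K" using k_lo K sq by simp
            show "N0 \<le> a ^ t * card {..<n}" using F(2) at by simp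
            have "\<delta> * real n powr (19/20) \<le> \<delta> * (a ^ t * n)" using at \<delta> by simp
            then show "card K \<le> \<delta> * (a ^ t * card {..<n})" using F(3) k_hi K by simp
          qed
          also have "\<dots> \<le> n * (4 * e + 5 * e)"
          proof (intro mult_mono add_mono)
            have "C * X \<le> \<gamma> * (a ^ t * n)"
              using C_le \<gamma> X0 by (intro mult_mono order.trans[OF X_le at]) auto
            then show "exp (- \<gamma> * (a ^ t * card {..<n})) \<le> e" using e by simp
            have "C * X \<le> (\<gamma> * cs) * real n powr (9/20)"
              using C_le \<gamma> cs X0 by (intro mult_mono X_le) auto
            also have "\<dots> \<le> \<gamma> * (r1 ^ t * k)" using xk[OF m(4)] \<gamma> by (simp add: mult.assoc)
            finally show "exp (- \<gamma> * (r1 ^ t * card K)) \<le> e" using e K by simp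
          qed (use tn X0 in auto)
          finally show "measure_pmf.prob (fresh_chain \<alpha> \<beta> K {..<n} t) {W. \<not> G W} \<le> n * (9 * e)" by simp
        next
          fix W assume W: "W \<subseteq> {..<n}" and G: "G W"
          have "real k' \<le> card (K \<inter> W)" using G k'_hi K by (simp add: G_def \<rho>_def)
          then show k'_J: "k' \<le> card (K \<inter> W)" by simp
          define N where "N = real (card W)"
          define \<kappa> where "\<kappa> = real (card (K \<inter> W))"
          have fW: "finite W" "finite K" using W K finite_subset by auto
          have Nn: "N \<le> n" unfolding N_def using card_mono[OF finite_lessThan W] by simp
          have N_lo: "real n powr (19/20) \<le> N" using at G by (simp add: G_def N_def)
          have "card (K \<inter> W) \<le> card K" using fW by (intro card_mono) auto
          then have \<kappa>_hi: "\<kappa> \<le> (c + 1) * real n powr (1/2)" using k_hi K by (simp add: \<kappa>_def)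
          have n19: "0 < real n powr (19/20)" using n by simp
          have N0: "0 < N" using N_lo n19 by linarith
          have \<kappa>0: "4 \<le> \<kappa>" using k'4 k'_J by (simp add: \<kappa>_def)
          have lt: "\<kappa> + 1 < N" and half: "real n powr (19/20) / 2 \<le> N - \<kappa> - 1"
            using F(8) \<kappa>_hi N_lo n19 by linarith+
          have "measure_pmf.prob (planted W (K \<inter> W)) {F. \<not> recovers W (K \<inter> W) k' F} \<le>
            2 * card W * exp (- (real (card (K \<inter> W)))\<^sup>2 / (32 * real (card W))) +
            (card W * (card W + 1)) * (exp (- (real k')\<^sup>2 / (5000 * real (card (K \<inter> W)))) + exp (- real k' / 32))"
          proof (rule recovers_prob[OF fW(1) _ k'4 k'_J])
            show "card (K \<inter> W) + 1 < card W" using lt unfolding \<kappa>_def N_def by linarith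
            \<comment> \<open>The quotient is at most of order n^(1/2 - 19/40) = n^(1/40), whereas
              \<open>k'\<close> has order at least n^(9/20).\<close>
            have "\<kappa> / sqrt (N - \<kappa> - 1) \<le> ((c + 1) * real n powr (1/2)) / sqrt (real n powr (19/20) / 2)"
              using \<kappa>_hi half n19 c by (intro frac_le) auto
            also have "\<dots> \<le> k' / 100" using F(9) k'_lo by linarith
            finally show "card (K \<inter> W) / sqrt (real (card W) - card (K \<inter> W) - 1) \<le> k' / 100"
              by (simp add: N_def \<kappa>_def)
          qed simp
          also have "\<dots> = 2 * N * exp (- (\<kappa>\<^sup>2 / (32 * N))) +
            (N * (N + 1)) * (exp (- ((real k')\<^sup>2 / (5000 * \<kappa>))) + exp (- (real k' / 32)))"
            by (simp add: N_def \<kappa>_def algebra_simps)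
          also have "\<dots> \<le> 2 * n * e + (n * (n + 1)) * (e + e)"
          proof (intro add_mono mult_mono e)
            have "(cs * q ^ t * sqrt N)\<^sup>2 \<le> \<kappa>\<^sup>2"
              using G cs q N0 by (intro power_mono) (auto simp: G_def N_def \<kappa>_def)
            then have "cs\<^sup>2 * (q ^ t)\<^sup>2 * N \<le> \<kappa>\<^sup>2" using N0 by (simp add: power_mult_distrib)
            then have 1: "cs\<^sup>2 * (q ^ t)\<^sup>2 / 32 \<le> \<kappa>\<^sup>2 / (32 * N)" using N0 by (simp add: field_simps)
            have "X = (real n powr \<eta>)\<^sup>2" using n by (simp add: X_def powr_power mult.commute)
            also have "\<dots> \<le> (q * q ^ t)\<^sup>2" using qt by (intro power_mono) auto
            finally have "C * X \<le> cs\<^sup>2 / (32 * q\<^sup>2) * (q * q ^ t)\<^sup>2"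
              using C_le X0 C by (intro mult_mono) auto
            also have "\<dots> = cs\<^sup>2 * (q ^ t)\<^sup>2 / 32" using q by (simp add: power_mult_distrib)
            finally show "C * X \<le> \<kappa>\<^sup>2 / (32 * N)" using 1 by simp
            \<comment> \<open>The exponent is 2/5 = 2 * 9/20 - 1/2, from the square of
              \<open>k'\<close> over an upper bound on the original clique size.\<close>
            have "C * X \<le> cs\<^sup>2 / (20000 * (c + 1)) * real n powr (2/5)"
              using C_le C X0 c by (intro mult_mono X_le) auto
            also have "\<dots> = ((cs/2) * real n powr (9/20))\<^sup>2 / (5000 * ((c + 1) * real n powr (1/2)))"
            proof -
              have "(real n powr (9/20))\<^sup>2 = real n powr (2/5) * real n powr (1/2)"
                using n by (simp add: powr_power flip: powr_add)
              moreover have "cs\<^sup>2 / (20000 * d) * y = (cs\<^sup>2 / 4 * (y * x)) / (5000 * (d * x))"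
                if "0 < d" "0 < x" for d x y :: real using that by (simp add: field_simps)
              from this[of "c + 1" "real n powr (1/2)" "real n powr (2/5)"]
              have "cs\<^sup>2 / (20000 * (c + 1)) * real n powr (2/5) =
                  (cs\<^sup>2 / 4 * (real n powr (2/5) * real n powr (1/2))) / (5000 * ((c + 1) * real n powr (1/2)))"
                using n c by simp
              ultimately show ?thesis by (simp only: power_mult_distrib power_divide) simp
            qed
            also have "\<dots> \<le> (real k')\<^sup>2 / (5000 * \<kappa>)"
              using k'_lo \<kappa>_hi \<kappa>0 cs by (intro frac_le power_mono) auto
            finally show "C * X \<le> (real k')\<^sup>2 / (5000 * \<kappa>)" .
            have "C * X \<le> cs / 64 * real n powr (9/20)"
              using C_le C X0 by (intro mult_mono X_le) auto
            then show "C * X \<le> real k' / 32" using k'_lo by simp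
            have "N * (N + 1) \<le> real n * (real n + 1)" using Nn N0 by (intro mult_mono) auto
            then show "N * (N + 1) \<le> real (n * (n + 1))" by (simp add: distrib_left)
          qed (use Nn N0 X0 in auto)
          finally show "measure_pmf.prob (planted W (K \<inter> W)) {F. \<not> recovers W (K \<inter> W) k' F}
            \<le> 2 * n * e + (n * (n + 1)) * (e + e)" by simp
        qed (use X0 in auto)
        also have "\<dots> = (2 * (real n)\<^sup>2 + 14 * n + 1) * e" by (simp add: algebra_simps power2_eq_square)
        also have "\<dots> \<le> (20 * (real n)\<^sup>2) * e"
        proof (rule mult_right_mono)
          have "real n \<le> (real n)\<^sup>2" using n by (simp add: power2_eq_square)
          then show "2 * (real n)\<^sup>2 + 14 * n + 1 \<le> 20 * (real n)\<^sup>2" using n by linarith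
        qed (rule X0)
        also have "\<dots> \<le> exp (- (real n powr \<eta>))" using F(13) by (simp add: e_def X_def)
        finally show "measure_pmf.prob (planted {..<n} K \<bind> find_clique sel \<alpha> \<beta> c t n k) {X. X \<noteq> K}
          \<le> exp (- (real n powr \<eta>))" .
      qed
    qed
  qed
  show ?thesis
    using \<alpha> \<beta> r s \<Lambda> \<eta> main
    by (intro exI[of _ \<alpha>] exI[of _ \<beta>] exI[of _ \<epsilon>4] exI[of _ \<eta>] exI[of _ "\<lambda>n. real n powr \<eta>"])
      (auto simp: \<epsilon>4_def)
qed

end
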